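(* Let $A=kQ_A/I_A$ be a finite dimensional monomial algebra and let $B=kQ_B/I_B$ be the algebra obtained from $A$ by gluing a source arrow $\alpha:e_1\to e_2$ and a sink arrow $\beta:e_{n-1}\to e_n$. Put $Y:=\psi_1(\mathrm{Im}(\delta_A^0))\oplus Z_{sp}(\alpha,\beta)$ and $I:=Y/\mathrm{Im}(\delta_B^0)$. Then $I$ is a Lie ideal of $\mathrm{HH}^1(B)$ and $$\mathrm{HH}^{1}(A)\simeq \mathrm{HH}^{1}(B)/I$$ as Lie algebras. In particular, if $\alpha$ and $\beta$ are glued from the same block of $A$, then there is a Lie algebra isomorphism $$\mathrm{HH}^{1}(A)\simeq \mathrm{HH}^{1}(B)/\langle \gamma^*\|\gamma^*\rangle,$$ where $\gamma^*\|\gamma^*$ also denotes its class in $\mathrm{HH}^1(B)$; if $\alpha$ and $\beta$ are glued from different blocks of $A$, then there is a Lie algebra isomorphism $\mathrm{HH}^{1}(A)\simeq \mathrm{HH}^{1}(B)$.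
   Context: Let $k$ be a field. Paths are composed from right to left: $p=a_r\cdots a_1$ has $s(p)=s(a_1)$, $t(p)=t(a_r)$; vertices are identified with trivial paths and with the corresponding idempotents. A finite dimensional monomial algebra is a finite dimensional algebra $A=kQ_A/I_A$, where $Q_A$ is a finite quiver (vertex set $(Q_A)_0$, arrow set $(Q_A)_1$) and $I_A$ is an admissible ideal generated by a set $Z_A$ of paths of length $\ge 2$ which is minimal (no proper subpath of an element of $Z_A$ lies in $Z_A$). $\mathcal{B}_A$ is the set of paths of $Q_A$ (including trivial ones) containing no element of $Z_A$ as a subpath; it gives a $k$-basis of $A$. Blocks of $A$ correspond to connected components of $Q_A$. Gluing two arrows. $Q_A$ has vertices $e_1,\dots,e_n$ ($n\ge 4$) and arrows $\alpha,\beta,\gamma_1,\dots,\gamma_m$ ($m\ge 0$) with $\alpha:e_1\to e_2$, $\beta:e_{n-1}\to e_n$, and $e_1,e_2,e_{n-1},e_n$ pairwise different. The algebra $B$ obtained by gluing $\alpha$ and $\beta$ is the subalgebra of $A$ generated by $f_1:=e_1+e_{n-1}$, $f_2:=e_2+e_n$, $f_i:=e_i$ ($3\le i\le n-2$), $\gamma^*:=\alpha+\beta$, $\gamma_j^*:=\gamma_j$ ($1\le j\le m$). Then $B\simeq kQ_B/I_B$, where $Q_B$ is obtained from $Q_A$ by identifying $\alpha$ with $\beta$ (so $e_1$ with $e_{n-1}$ and $e_2$ with $e_n$). Write $a\mapsto a^*$ for the induced map on arrows ($\alpha^*=\beta^*=\gamma^*$), $e_i^*=f_i$ for $3\le i\le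 n-2$, $e_1^*=e_{n-1}^*=f_1$, $e_2^*=e_n^*=f_2$, and $p\mapsto p^*$ for the induced map on paths. $I_B$ is the ideal generated by the images of the paths in $Z_A$ together with $Z_{new}=\{\lambda^*\eta^*,\xi^*\mu^*,\xi^*\gamma^*\eta^*\mid t(\eta)=e_1,t(\mu)=e_2\,(\mu\ne\alpha),s(\lambda)=e_{n-1}\,(\lambda\neq\beta),s(\xi)=e_n\}\cup\{\lambda^*\eta^*,\xi^*\mu^*,\xi^*\gamma^*\eta^*\mid t(\eta)=e_{n-1},t(\mu)=e_n\,(\mu\neq\beta),s(\lambda)=e_1\,(\lambda\neq\alpha),s(\xi)=e_2\}$ ($\eta,\mu,\lambda,\xi\in(Q_A)_1$). Thus $B$ is monomial; $Z_B$, $\mathcal{B}_B$ are defined as for $A$. Source/sink arrows. $\alpha$ is a source arrow if $s(\alpha)$ is a source vertex and, except $\alpha$, no arrow starts at $s(\alpha)$ and no arrow ends at $t(\alpha)$. $\beta$ is a sink arrow if $t(\beta)$ is a sink vertex and, except $\beta$, no arrow starts at $s(\beta)$ and no arrow ends at $t(\beta)$. Complex. Paths $\epsilon,\gamma$ are parallel ($\epsilon\|\gamma$) if they have the same start and the same end. For sets $X,Y$ of paths, $k(X\|Y)$ is the vector space with basis the pairs $\epsilon\|\gamma$ of parallel paths, $\epsilon\in X,\gamma\in Y$. For a monomial algebra with data $(Q,Z,\mathcal{B})$ consider $k(Q_0\|\mathcal{B})\xrightarrow{\delta^0}k(Q_1\|\mathcal{B})\xrightarrow{\delta^1}k(Z\|\mathcal{B})$,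 where $\delta^0(e\|\gamma)=\sum_{s(a)=e,\,a\gamma\in\mathcal{B}}a\|a\gamma-\sum_{t(a)=e,\,\gamma a\in\mathcal{B}}a\|\gamma a$ and $\delta^1(a\|\gamma)=\sum_{r\in Z}r\|r^{a\|\gamma}$, with $r^{a\|\gamma}$ the sum of all paths in $\mathcal{B}$ obtained by replacing one appearance of $a$ in $r$ by $\gamma$ (one summand for each appearance). Then $\mathrm{HH}^1=\mathrm{Ker}(\delta^1)/\mathrm{Im}(\delta^0)$, with Lie bracket induced by $[a\|\gamma,b\|\epsilon]=b\|\epsilon^{a\|\gamma}-a\|\gamma^{b\|\epsilon}$. Subscripts $A,B$ indicate the algebra. $\psi_1:k((Q_A)_1\|\mathcal{B}_A)\to k((Q_B)_1\|\mathcal{B}_B)$ is the linear map $a\|p\mapsto a^*\|p^*$. Special paths. A path $p\in\mathcal{B}_A$ of length $\ge1$ from $e_1$ to $e_{n-1}$ or from $e_{n-1}$ to $e_1$ is special if $\delta_B^0(f_1\|p^* )\ne0$; a path $q\in\mathcal{B}_A$ of length $\ge1$ from $e_2$ to $e_n$ or from $e_n$ to $e_2$ is special if $\delta_B^0(f_2\|q^* )\neq0$. $Z_{sp}(\alpha,\beta)\subseteq\mathrm{Im}(\delta_B^0)$ is the span of the elements $\delta_B^0(f_1\|p^* )$ and $\delta_B^0(f_2\|q^* )$ for all such special $p$ and $q$. Angle brackets denote $k$-linear span. *)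

theory Defs
  imports "Graph_Theory.Digraph_Component" "HOL-Library.Poly_Mapping"
begin

section \<open>Lie algebras\<close>

record ('x, 'k) lie =
  carrier :: "'x set"
  lzero :: 'x
  ladd :: "'x \<Rightarrow> 'x \<Rightarrow> 'x"
  lscale :: "'k \<Rightarrow> 'x \<Rightarrow> 'x"
  lbracket :: "'x \<Rightarrow> 'x \<Rightarrow> 'x"

locale lie_algebra =
  fixes L :: "('x, 'k::field) lie"
  assumes zero_closed: "lzero L \<in> carrier L"
    and add_closed: "\<lbrakk>x \<in> carrier L; y \<in> carrier L\<rbrakk> \<Longrightarrow> ladd L x y \<in> carrier L"
    and scale_closed: "x \<in> carrier L \<Longrightarrow> lscale L c x \<in> carrier L"
    and bracket_closed: "\<lbrakk>x \<in> carrier L; y \<in> carrier L\<rbrakk> \<Longrightarrow> lbracket L x y \<in> carrier L"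
    and add_assoc: "\<lbrakk>x \<in> carrier L; y \<in> carrier L; z \<in> carrier L\<rbrakk>
      \<Longrightarrow> ladd L (ladd L x y) z = ladd L x (ladd L y z)"
    and add_commute: "\<lbrakk>x \<in> carrier L; y \<in> carrier L\<rbrakk> \<Longrightarrow> ladd L x y = ladd L y x"
    and add_zero: "x \<in> carrier L \<Longrightarrow> ladd L (lzero L) x = x"
    and add_inverse: "x \<in> carrier L \<Longrightarrow> \<exists>y\<in>carrier L. ladd L x y = lzero L"
    and scale_add_right: "\<lbrakk>x \<in> carrier L; y \<in> carrier L\<rbrakk>
      \<Longrightarrow> lscale L c (ladd L x y) = ladd L (lscale L c x) (lscale L c y)"
    and scale_add_left: "x \<in> carrier L
      \<Longrightarrow> lscale L (c + d) x = ladd L (lscale L c x) (lscale L d x)"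
    and scale_scale: "x \<in> carrier L \<Longrightarrow> lscale L c (lscale L d x) = lscale L (c * d) x"
    and scale_one: "x \<in> carrier L \<Longrightarrow> lscale L 1 x = x"
    and bracket_add_left: "\<lbrakk>x \<in> carrier L; y \<in> carrier L; z \<in> carrier L\<rbrakk>
      \<Longrightarrow> lbracket L (ladd L x y) z = ladd L (lbracket L x z) (lbracket L y z)"
    and bracket_add_right: "\<lbrakk>x \<in> carrier L; y \<in> carrier L; z \<in> carrier L\<rbrakk>
      \<Longrightarrow> lbracket L x (ladd L y z) = ladd L (lbracket L x y) (lbracket L x z)"
    and bracket_scale_left: "\<lbrakk>x \<in> carrier L; y \<in> carrier L\<rbrakk>
      \<Longrightarrow> lbracket L (lscale L c x) y = lscale L c (lbracket L x y)"
    and bracket_scale_right: "\<lbrakk>x \<in> carrier L; y \<in> carrier L\<rbrakk>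
      \<Longrightarrow> lbracket L x (lscale L c y) = lscale L c (lbracket L x y)"
    and bracket_self: "x \<in> carrier L \<Longrightarrow> lbracket L x x = lzero L"
    and jacobi: "\<lbrakk>x \<in> carrier L; y \<in> carrier L; z \<in> carrier L\<rbrakk>
      \<Longrightarrow> ladd L (lbracket L x (lbracket L y z))
           (ladd L (lbracket L y (lbracket L z x)) (lbracket L z (lbracket L x y))) = lzero L"

definition lie_subspace :: "('x, 'k) lie \<Rightarrow> 'x set \<Rightarrow> bool" where
  "lie_subspace L W \<longleftrightarrow> W \<subseteq> carrier L \<and> lzero L \<in> W
    \<and> (\<forall>x\<in>W. \<forall>y\<in>W. ladd L x y \<in> W) \<and> (\<forall>c. \<forall>x\<in>W. lscale L c x \<in> W)"

definition lie_span :: "('x, 'k) lie \<Rightarrow> 'x set \<Rightarrow> 'x set" where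
  "lie_span L S = \<Inter>{W. lie_subspace L W \<and> S \<subseteq> W}"

definition lie_ideal :: "('x, 'k::field) lie \<Rightarrow> 'x set \<Rightarrow> bool" where
  "lie_ideal L I \<longleftrightarrow> lie_algebra L \<and> lie_subspace L I
    \<and> (\<forall>x\<in>carrier L. \<forall>y\<in>I. lbracket L x y \<in> I)"

definition lie_coset :: "('x, 'k) lie \<Rightarrow> 'x set \<Rightarrow> 'x \<Rightarrow> 'x set" where
  "lie_coset L I x = ladd L x ` I"

text \<open>
  As for the quotient ring in the library, the operations on cosets are formed elementwise, as
  unions over all representatives; when \<^term>\<open>I\<close> is a Lie ideal these unions are single cosets.
\<close>

definition lie_quot :: "('x, 'k) lie \<Rightarrow> 'x set \<Rightarrow> ('x set, 'k) lie" where
  "lie_quot L I = \<lparr>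
     carrier = lie_coset L I ` carrier L,
     lzero = lie_coset L I (lzero L),
     ladd = (\<lambda>X Y. \<Union>x\<in>X. \<Union>y\<in>Y. lie_coset L I (ladd L x y)),
     lscale = (\<lambda>c X. \<Union>x\<in>X. lie_coset L I (lscale L c x)),
     lbracket = (\<lambda>X Y. \<Union>x\<in>X. \<Union>y\<in>Y. lie_coset L I (lbracket L x y)) \<rparr>"

definition lie_isomorphic :: "('x, 'k::field) lie \<Rightarrow> ('y, 'k) lie \<Rightarrow> bool" where
  "lie_isomorphic L M \<longleftrightarrow> lie_algebra L \<and> lie_algebra M \<and>
    (\<exists>f. bij_betw f (carrier L) (carrier M)
      \<and> (\<forall>x\<in>carrier L. \<forall>y\<in>carrier L. f (ladd L x y) = ladd M (f x) (f y))
      \<and> (\<forall>c. \<forall>x\<in>carrier L. f (lscale L c x) = lscale M c (f x))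
      \<and> (\<forall>x\<in>carrier L. \<forall>y\<in>carrier L. f (lbracket L x y) = lbracket M (f x) (f y)))"


section \<open>Paths and monomial algebras\<close>

text \<open>
  A quiver is a \<^typ>\<open>('v, 'a) pre_digraph\<close>. The path $a_r \cdots a_1$ starting at $v$ is the pair
  \<open>(v, [a\<^sub>1, \<dots>, a\<^sub>r])\<close>: the arrows are listed in the order in which they are traversed, and the
  starting vertex is recorded so that \<open>(v, [])\<close> is the trivial path at \<open>v\<close>.
\<close>

type_synonym ('v, 'a) qpath = "'v \<times> 'a list"

definition paths :: "('v, 'a) pre_digraph \<Rightarrow> ('v, 'a) qpath set" where
  "paths Q = {(u, as). \<exists>v. pre_digraph.awalk Q u as v}"

definition path_target :: "('v, 'a) pre_digraph \<Rightarrow> ('v, 'a) qpath \<Rightarrow> 'v" where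
  "path_target Q p = pre_digraph.awlast Q (fst p) (snd p)"

definition vertex_path :: "'v \<Rightarrow> ('v, 'a) qpath" where
  "vertex_path v = (v, [])"

definition arrow_path :: "('v, 'a) pre_digraph \<Rightarrow> 'a \<Rightarrow> ('v, 'a) qpath" where
  "arrow_path Q a = (tail Q a, [a])"

text \<open>The composite $qp$, that is, first \<open>p\<close> and then \<open>q\<close>.\<close>

definition path_comp :: "('v, 'a) qpath \<Rightarrow> ('v, 'a) qpath \<Rightarrow> ('v, 'a) qpath" where
  "path_comp q p = (fst p, snd p @ snd q)"

definition subpath :: "('v, 'a) pre_digraph \<Rightarrow> ('v, 'a) qpath \<Rightarrow> ('v, 'a) qpath \<Rightarrow> bool" where
  "subpath Q p q \<longleftrightarrow> (\<exists>u\<in>paths Q. \<exists>w\<in>paths Q. path_target Q u = fst p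
    \<and> path_target Q p = fst w \<and> q = path_comp w (path_comp p u))"

text \<open>
  The set $\mathcal{B}$. The monomial ideal generated by \<open>Z\<close> is spanned by the remaining paths.
\<close>

definition nonzero_paths ::
    "('v, 'a) pre_digraph \<Rightarrow> ('v, 'a) qpath set \<Rightarrow> ('v, 'a) qpath set" where
  "nonzero_paths Q Z = {p \<in> paths Q. \<forall>r\<in>Z. \<not> subpath Q r p}"

locale monomial_algebra = fin_digraph Q
  for Q :: "('v, 'a) pre_digraph" and Z :: "('v, 'a) qpath set" +
  assumes relations_paths: "Z \<subseteq> paths Q"
    and relations_length: "r \<in> Z \<Longrightarrow> 2 \<le> length (snd r)"
    and relations_minimal: "\<lbrakk>r \<in> Z; r' \<in> Z; subpath Q r' r\<rbrakk> \<Longrightarrow> r' = r"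
    and finite_dimensional: "finite (nonzero_paths Q Z)"

lemma path_comp_in_paths:
  assumes "wf_digraph Q" "p \<in> paths Q" "q \<in> paths Q" "path_target Q p = fst q"
  shows "path_comp q p \<in> paths Q" "path_target Q (path_comp q p) = path_target Q q"
proof -
  interpret wf_digraph Q by fact
  from assms have "awalk (fst p) (snd p @ snd q) (awlast (fst q) (snd q))"
    by (auto simp: paths_def path_target_def intro!: awalk_appendI)
  then show "path_comp q p \<in> paths Q" "path_target Q (path_comp q p) = path_target Q q"
    by (auto simp: paths_def path_comp_def path_target_def)
qed

lemma subpath_trans:
  assumes "wf_digraph Q" "p \<in> paths Q" "subpath Q p q" "subpath Q q r"
  shows "subpath Q p r"
proof -
  from assms(3) obtain u w where 1: "u \<in> paths Q" "w \<in> paths Q" "path_target Q u = fst p"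
    "path_target Q p = fst w" "q = path_comp w (path_comp p u)" by (auto simp: subpath_def)
  from assms(4) obtain u' w' where 2: "u' \<in> paths Q" "w' \<in> paths Q" "path_target Q u' = fst q"
    "path_target Q q = fst w'" "r = path_comp w' (path_comp q u')" by (auto simp: subpath_def)
  have pu: "path_comp p u \<in> paths Q" "path_target Q (path_comp p u) = path_target Q p"
    using path_comp_in_paths[OF assms(1) 1(1) assms(2) 1(3)] by auto
  have q: "path_target Q q = path_target Q w"
    using path_comp_in_paths[OF assms(1) pu(1) 1(2)] pu(2) 1 by auto
  have a: "path_comp u u' \<in> paths Q" "path_target Q (path_comp u u') = fst p"
    using path_comp_in_paths[OF assms(1) 2(1) 1(1)] 1 2 by (auto simp: path_comp_def)
  have b: "path_comp w' w \<in> paths Q" "fst (path_comp w' w) = path_target Q p"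
    using path_comp_in_paths[OF assms(1) 1(2) 2(2)] 1 2 q by (auto simp: path_comp_def)
  have "r = path_comp (path_comp w' w) (path_comp p (path_comp u u'))"
    using 1(5) 2(5) by (simp add: path_comp_def)
  with a b show ?thesis by (metis subpath_def)
qed

context monomial_algebra
begin

text \<open>
  The ideal generated by \<open>Z\<close> is admissible: it lies in the square of the arrow ideal by
  \<open>relations_length\<close>, and it contains a power of the arrow ideal.
\<close>

lemma admissible: "\<exists>N. \<forall>p\<in>paths Q. N \<le> length (snd p) \<longrightarrow> p \<notin> nonzero_paths Q Z"
proof -
  have "finite ((length \<circ> snd) ` nonzero_paths Q Z)" using finite_dimensional by blast
  then obtain N where "\<forall>n\<in>(length \<circ> snd) ` nonzero_paths Q Z. n < N"
    using finite_nat_set_iff_bounded by blast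
  then show ?thesis by (intro exI[of _ N]) force
qed

lemma finite_relations: "finite Z"
proof -
  have "r \<in> (\<lambda>(a, p). path_comp p (arrow_path Q a)) ` (arcs Q \<times> nonzero_paths Q Z)"
    if r: "r \<in> Z" for r
  proof -
    obtain v as where v: "r = (v, as)" by fastforce
    with relations_length[OF r] obtain a bs where as: "as = a # bs" by (cases as) auto
    from relations_paths r v as obtain w where "awalk v (a # bs) w" by (auto simp: paths_def)
    then have a: "a \<in> arcs Q" "tail Q a = v" and bs: "awalk (head Q a) bs w"
      by (auto simp: awalk_Cons_iff)
    have ra: "arrow_path Q a \<in> paths Q" "path_target Q (arrow_path Q a) = head Q a"
      using a by (auto simp: paths_def arrow_path_def path_target_def awalk_def)
    have p: "(head Q a, bs) \<in> paths Q" using bs by (auto simp: paths_def)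
    have "(head Q a, bs) \<in> nonzero_paths Q Z"
    proof (rule ccontr)
      assume "\<not> ?thesis"
      with p obtain r' where r': "r' \<in> Z" "subpath Q r' (head Q a, bs)"
        by (auto simp: nonzero_paths_def)
      have "(path_target Q (head Q a, bs), []) \<in> paths Q"
        using bs awalk_last_in_verts[OF bs] by (auto simp: paths_def path_target_def awalk_def)
      with ra p have "subpath Q (head Q a, bs) r"
        unfolding subpath_def
        by (intro bexI[of _ "arrow_path Q a"] bexI[of _ "(path_target Q (head Q a, bs), [])"])
           (auto simp: v as a path_comp_def arrow_path_def)
      then have "subpath Q r' r"
        using subpath_trans wf_digraph r' relations_paths by blast
      with relations_minimal r r'(1) have "r' = r" by blast
      with r'(2) have "length (snd r) \<le> length bs" by (auto simp: subpath_def path_comp_def)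
      then show False by (simp add: v as)
    qed
    then show ?thesis
      using a by (intro image_eqI[of _ _ "(a, (head Q a, bs))"])
        (auto simp: v as path_comp_def arrow_path_def)
  qed
  then show ?thesis
    using finite_dimensional by (meson finite_SigmaI finite_arcs finite_imageI finite_subset subsetI)
qed

end

text \<open>The minimal relations among a set of paths; they generate the same monomial ideal.\<close>

definition minimal_relations ::
    "('v, 'a) pre_digraph \<Rightarrow> ('v, 'a) qpath set \<Rightarrow> ('v, 'a) qpath set" where
  "minimal_relations Q G = {r \<in> G. \<forall>r'\<in>G. subpath Q r' r \<longrightarrow> r' = r}"

lemma nonzero_paths_minimal_relations:
  assumes "wf_digraph Q" "G \<subseteq> paths Q"
  shows "nonzero_paths Q (minimal_relations Q G) = nonzero_paths Q G"
proof -
  have *: "\<exists>r'\<in>minimal_relations Q G. subpath Q r' p" if "r \<in> G" "subpath Q r p" for r p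
    using that
  proof (induction "length (snd r)" arbitrary: r rule: less_induct)
    case less
    show ?case
    proof (cases "r \<in> minimal_relations Q G")
      case False
      with less.prems obtain r' where r': "r' \<in> G" "subpath Q r' r" "r' \<noteq> r"
        by (auto simp: minimal_relations_def)
      have "length (snd r') < length (snd r)"
      proof -
        from r'(2) obtain u w where uw: "path_target Q u = fst r'"
          "path_target Q r' = fst w" "r = path_comp w (path_comp r' u)" by (auto simp: subpath_def)
        have "snd u \<noteq> [] \<or> snd w \<noteq> []"
        proof (rule ccontr)
          assume "\<not> ?thesis"
          then have "r = r'"
            using uw by (auto simp: path_comp_def path_target_def prod_eq_iff
                pre_digraph.awalk_verts.simps)
          with r'(3) show False by simp
        qed
        with uw(3) show ?thesis by (auto simp: path_comp_def)
      qed
      moreover have "subpath Q r' p"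
        using subpath_trans[OF assms(1)] r' less.prems assms(2) by blast
      ultimately show ?thesis using less.hyps r'(1) by blast
    qed (use less.prems in blast)
  qed
  have "minimal_relations Q G \<subseteq> G" by (auto simp: minimal_relations_def)
  with * show ?thesis unfolding nonzero_paths_def by blast
qed


section \<open>The complex computing the first Hochschild cohomology\<close>

definition parallel :: "('v, 'a) pre_digraph \<Rightarrow> ('v, 'a) qpath \<Rightarrow> ('v, 'a) qpath \<Rightarrow> bool" where
  "parallel Q p q \<longleftrightarrow> fst p = fst q \<and> path_target Q p = path_target Q q"

text \<open>
  A cochain is a finitely supported function on pairs of paths; the basis element
  $\epsilon\|\gamma$ is the pair \<open>(\<epsilon>, \<gamma>)\<close>.
\<close>

type_synonym ('v, 'a, 'k) cochain = "(('v, 'a) qpath \<times> ('v, 'a) qpath) \<Rightarrow>\<^sub>0 'k"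

definition scale :: "'k::field \<Rightarrow> ('x \<Rightarrow>\<^sub>0 'k) \<Rightarrow> ('x \<Rightarrow>\<^sub>0 'k)" where
  "scale c f = Poly_Mapping.map ((*) c) f"

lemma lookup_scale [simp]: "Poly_Mapping.lookup (scale c f) x = c * Poly_Mapping.lookup f x"
  by (simp add: scale_def Poly_Mapping.map.rep_eq when_def)

global_interpretation cochain: vector_space "scale :: 'k::field \<Rightarrow> ('x \<Rightarrow>\<^sub>0 'k) \<Rightarrow> ('x \<Rightarrow>\<^sub>0 'k)"
  by unfold_locales (auto intro!: poly_mapping_eqI simp: lookup_add algebra_simps)

definition basis :: "'x \<Rightarrow> ('x \<Rightarrow>\<^sub>0 'k::field)" where
  "basis x = Poly_Mapping.single x 1"

definition linear_extension :: "('x \<Rightarrow> ('y \<Rightarrow>\<^sub>0 'k::field)) \<Rightarrow> ('x \<Rightarrow>\<^sub>0 'k) \<Rightarrow> ('y \<Rightarrow>\<^sub>0 'k)" where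
  "linear_extension F f = (\<Sum>x\<in>Poly_Mapping.keys f. scale (Poly_Mapping.lookup f x) (F x))"

definition bilinear_extension ::
    "('x \<Rightarrow> 'x \<Rightarrow> ('y \<Rightarrow>\<^sub>0 'k::field)) \<Rightarrow> ('x \<Rightarrow>\<^sub>0 'k) \<Rightarrow> ('x \<Rightarrow>\<^sub>0 'k) \<Rightarrow> ('y \<Rightarrow>\<^sub>0 'k)" where
  "bilinear_extension F f g = linear_extension (\<lambda>x. linear_extension (F x) g) f"

definition cochains :: "('v, 'a) pre_digraph \<Rightarrow> ('v, 'a) qpath set \<Rightarrow> ('v, 'a) qpath set
    \<Rightarrow> ('v, 'a, 'k::field) cochain set" where
  "cochains Q X Y = {f. Poly_Mapping.keys f \<subseteq> {(p, q). p \<in> X \<and> q \<in> Y \<and> parallel Q p q}}"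

definition delta0 :: "('v, 'a) pre_digraph \<Rightarrow> ('v, 'a) qpath set
    \<Rightarrow> ('v, 'a, 'k::field) cochain \<Rightarrow> ('v, 'a, 'k) cochain" where
  "delta0 Q Z = linear_extension (\<lambda>(e, p).
      (\<Sum>a | a \<in> arcs Q \<and> tail Q a = fst e \<and> path_comp (arrow_path Q a) p \<in> nonzero_paths Q Z.
         basis (arrow_path Q a, path_comp (arrow_path Q a) p))
    - (\<Sum>a | a \<in> arcs Q \<and> head Q a = fst e \<and> path_comp p (arrow_path Q a) \<in> nonzero_paths Q Z.
         basis (arrow_path Q a, path_comp p (arrow_path Q a))))"

text \<open>The path obtained from \<open>r\<close> by replacing its arrow in position \<open>i\<close> by \<open>p\<close>.\<close>

definition replace_at :: "('v, 'a) qpath \<Rightarrow> nat \<Rightarrow> ('v, 'a) qpath \<Rightarrow> ('v, 'a) qpath" where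
  "replace_at r i p = (fst r, take i (snd r) @ snd p @ drop (Suc i) (snd r))"

text \<open>
  \<open>subst_sum Q Z b r (a, p)\<close> is $b\|r^{a\|p}$. The arrow \<open>a\<close> is given as a path of length one, and
  the sum runs over the positions at which it occurs in \<open>r\<close>.
\<close>

definition subst_sum :: "('v, 'a) pre_digraph \<Rightarrow> ('v, 'a) qpath set \<Rightarrow> ('v, 'a) qpath
    \<Rightarrow> ('v, 'a) qpath \<Rightarrow> ('v, 'a) qpath \<times> ('v, 'a) qpath \<Rightarrow> ('v, 'a, 'k::field) cochain" where
  "subst_sum Q Z b r = (\<lambda>(a, p).
     \<Sum>i | i < length (snd r) \<and> arrow_path Q (snd r ! i) = a
         \<and> replace_at r i p \<in> nonzero_paths Q Z. basis (b, replace_at r i p))"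

definition delta1 :: "('v, 'a) pre_digraph \<Rightarrow> ('v, 'a) qpath set
    \<Rightarrow> ('v, 'a, 'k::field) cochain \<Rightarrow> ('v, 'a, 'k) cochain" where
  "delta1 Q Z = linear_extension (\<lambda>x. \<Sum>r\<in>Z. subst_sum Q Z r r x)"

definition cochain_bracket :: "('v, 'a) pre_digraph \<Rightarrow> ('v, 'a) qpath set
    \<Rightarrow> ('v, 'a, 'k::field) cochain \<Rightarrow> ('v, 'a, 'k) cochain \<Rightarrow> ('v, 'a, 'k) cochain" where
  "cochain_bracket Q Z = bilinear_extension (\<lambda>x y.
     subst_sum Q Z (fst y) (snd y) x - subst_sum Q Z (fst x) (snd x) y)"

definition cochains0 ::
    "('v, 'a) pre_digraph \<Rightarrow> ('v, 'a) qpath set \<Rightarrow> ('v, 'a, 'k::field) cochain set" where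
  "cochains0 Q Z = cochains Q (vertex_path ` verts Q) (nonzero_paths Q Z)"

definition cochains1 ::
    "('v, 'a) pre_digraph \<Rightarrow> ('v, 'a) qpath set \<Rightarrow> ('v, 'a, 'k::field) cochain set" where
  "cochains1 Q Z = cochains Q (arrow_path Q ` arcs Q) (nonzero_paths Q Z)"

definition im_delta0 ::
    "('v, 'a) pre_digraph \<Rightarrow> ('v, 'a) qpath set \<Rightarrow> ('v, 'a, 'k::field) cochain set" where
  "im_delta0 Q Z = delta0 Q Z ` cochains0 Q Z"

definition ker_delta1 ::
    "('v, 'a) pre_digraph \<Rightarrow> ('v, 'a) qpath set \<Rightarrow> ('v, 'a, 'k::field) cochain set" where
  "ker_delta1 Q Z = {f \<in> cochains1 Q Z. delta1 Q Z f = 0}"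

definition cocycle_lie :: "('v, 'a) pre_digraph \<Rightarrow> ('v, 'a) qpath set
    \<Rightarrow> (('v, 'a, 'k::field) cochain, 'k) lie" where
  "cocycle_lie Q Z = \<lparr> carrier = ker_delta1 Q Z, lzero = 0, ladd = (+), lscale = scale,
     lbracket = cochain_bracket Q Z \<rparr>"

type_synonym ('v, 'a, 'k) hh1 = "(('v, 'a, 'k) cochain set, 'k) lie"

definition HH1 :: "('v, 'a) pre_digraph \<Rightarrow> ('v, 'a) qpath set \<Rightarrow> ('v, 'a, 'k::field) hh1" where
  "HH1 Q Z = lie_quot (cocycle_lie Q Z) (im_delta0 Q Z)"

definition HH1_class :: "('v, 'a) pre_digraph \<Rightarrow> ('v, 'a) qpath set
    \<Rightarrow> ('v, 'a, 'k::field) cochain \<Rightarrow> ('v, 'a, 'k) cochain set" where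
  "HH1_class Q Z = lie_coset (cocycle_lie Q Z) (im_delta0 Q Z)"


section \<open>Gluing two arrows\<close>

text \<open>
  Write $\alpha : e_1 \to e_2$ and $\beta : e_{n-1} \to e_n$. In the glued quiver the vertices $f_1$,
  $f_2$ and the arrow $\gamma^*$ are represented by $e_1$, $e_2$ and $\alpha$; all other vertices and
  arrows keep their names. The operations below are $v \mapsto v^*$, $a \mapsto a^*$ and
  $p \mapsto p^*$.
\<close>

definition star_vertex :: "('v, 'a) pre_digraph \<Rightarrow> 'a \<Rightarrow> 'a \<Rightarrow> 'v \<Rightarrow> 'v" where
  "star_vertex Q \<alpha> \<beta> v =
     (if v = tail Q \<beta> then tail Q \<alpha> else if v = head Q \<beta> then head Q \<alpha> else v)"

definition star_arrow :: "'a \<Rightarrow> 'a \<Rightarrow> 'a \<Rightarrow> 'a" where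
  "star_arrow \<alpha> \<beta> a = (if a = \<beta> then \<alpha> else a)"

definition star_path ::
    "('v, 'a) pre_digraph \<Rightarrow> 'a \<Rightarrow> 'a \<Rightarrow> ('v, 'a) qpath \<Rightarrow> ('v, 'a) qpath" where
  "star_path Q \<alpha> \<beta> p = (star_vertex Q \<alpha> \<beta> (fst p), map (star_arrow \<alpha> \<beta>) (snd p))"

definition glued_quiver :: "('v, 'a) pre_digraph \<Rightarrow> 'a \<Rightarrow> 'a \<Rightarrow> ('v, 'a) pre_digraph" where
  "glued_quiver Q \<alpha> \<beta> = \<lparr>
     verts = star_vertex Q \<alpha> \<beta> ` verts Q,
     arcs = star_arrow \<alpha> \<beta> ` arcs Q,
     tail = (\<lambda>a. star_vertex Q \<alpha> \<beta> (tail Q a)),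
     head = (\<lambda>a. star_vertex Q \<alpha> \<beta> (head Q a)) \<rparr>"

text \<open>
  The first of the two sets in $Z_{new}$, with \<open>QB\<close> the glued quiver and \<open>star\<close> the map on arrows;
  the second one arises by exchanging \<open>\<alpha>\<close> and \<open>\<beta>\<close> while \<open>QB\<close> and \<open>star\<close> stay fixed.
\<close>

definition new_relations_half ::
    "('v, 'a) pre_digraph \<Rightarrow> 'a \<Rightarrow> 'a \<Rightarrow> ('v, 'a) pre_digraph \<Rightarrow> ('a \<Rightarrow> 'a) \<Rightarrow> ('v, 'a) qpath set"
  where
  "new_relations_half Q \<alpha> \<beta> QB star = (let ar = (\<lambda>a. arrow_path QB (star a)) in
     {path_comp (ar l) (ar h) | l h. l \<in> arcs Q \<and> h \<in> arcs Q
        \<and> head Q h = tail Q \<alpha> \<and> tail Q l = tail Q \<beta> \<and> l \<noteq> \<beta>}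
   \<union> {path_comp (ar x) (ar m) | x m. x \<in> arcs Q \<and> m \<in> arcs Q
        \<and> head Q m = head Q \<alpha> \<and> m \<noteq> \<alpha> \<and> tail Q x = head Q \<beta>}
   \<union> {path_comp (ar x) (path_comp (ar \<alpha>) (ar h)) | x h. x \<in> arcs Q \<and> h \<in> arcs Q
        \<and> head Q h = tail Q \<alpha> \<and> tail Q x = head Q \<beta>})"

definition new_relations :: "('v, 'a) pre_digraph \<Rightarrow> 'a \<Rightarrow> 'a \<Rightarrow> ('v, 'a) qpath set" where
  "new_relations Q \<alpha> \<beta> =
     new_relations_half Q \<alpha> \<beta> (glued_quiver Q \<alpha> \<beta>) (star_arrow \<alpha> \<beta>)
   \<union> new_relations_half Q \<beta> \<alpha> (glued_quiver Q \<alpha> \<beta>) (star_arrow \<alpha> \<beta>)"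

definition glued_relations ::
    "('v, 'a) pre_digraph \<Rightarrow> ('v, 'a) qpath set \<Rightarrow> 'a \<Rightarrow> 'a \<Rightarrow> ('v, 'a) qpath set" where
  "glued_relations Q Z \<alpha> \<beta> = minimal_relations (glued_quiver Q \<alpha> \<beta>)
     (star_path Q \<alpha> \<beta> ` Z \<union> new_relations Q \<alpha> \<beta>)"

text \<open>
  The differential \<open>delta1\<close> of the glued algebra sums over this set, so its finiteness matters.
\<close>

lemma finite_glued_relations:
  assumes "monomial_algebra Q Z"
  shows "finite (glued_relations Q Z \<alpha> \<beta>)"
proof -
  interpret monomial_algebra Q Z by fact
  have *: "finite (new_relations_half Q a b QB s)" for a b QB s
    unfolding new_relations_half_def Let_def
    by (intro finite_UnI; rule finite_image_set2[THEN rev_finite_subset,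
          where P1 = "\<lambda>l. l \<in> arcs Q" and Q1 = "\<lambda>l. l \<in> arcs Q"]) auto
  show ?thesis
    using * finite_relations
    by (auto simp: glued_relations_def minimal_relations_def new_relations_def)
qed

definition source_arrow :: "('v, 'a) pre_digraph \<Rightarrow> 'a \<Rightarrow> bool" where
  "source_arrow Q \<alpha> \<longleftrightarrow> \<alpha> \<in> arcs Q \<and> in_arcs Q (tail Q \<alpha>) = {}
    \<and> out_arcs Q (tail Q \<alpha>) = {\<alpha>} \<and> in_arcs Q (head Q \<alpha>) = {\<alpha>}"

definition sink_arrow :: "('v, 'a) pre_digraph \<Rightarrow> 'a \<Rightarrow> bool" where
  "sink_arrow Q \<beta> \<longleftrightarrow> \<beta> \<in> arcs Q \<and> out_arcs Q (head Q \<beta>) = {}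
    \<and> out_arcs Q (tail Q \<beta>) = {\<beta>} \<and> in_arcs Q (head Q \<beta>) = {\<beta>}"

text \<open>
  Blocks correspond to the connected components of the quiver, as an undirected graph; two arrows
  lie in the same component when their tails do.
\<close>

definition same_block :: "('v, 'a) pre_digraph \<Rightarrow> 'a \<Rightarrow> 'a \<Rightarrow> bool" where
  "same_block Q \<alpha> \<beta> \<longleftrightarrow> tail Q \<alpha> \<rightarrow>\<^sup>*\<^bsub>with_proj (mk_symmetric Q)\<^esub> tail Q \<beta>"

definition psi1 :: "('v, 'a) pre_digraph \<Rightarrow> 'a \<Rightarrow> 'a
    \<Rightarrow> ('v, 'a, 'k::field) cochain \<Rightarrow> ('v, 'a, 'k) cochain" where
  "psi1 Q \<alpha> \<beta> = linear_extension (\<lambda>(a, p). basis (star_path Q \<alpha> \<beta> a, star_path Q \<alpha> \<beta> p))"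

text \<open>
  \<open>special_images Q Z \<alpha> \<beta> v w\<close> consists of the elements $\delta^0_B(v^*\|p^*)$ for the special paths
  \<open>p\<close> between \<open>v\<close> and \<open>w\<close>, where $v^* = w^*$.
\<close>

definition special_images :: "('v, 'a) pre_digraph \<Rightarrow> ('v, 'a) qpath set \<Rightarrow> 'a \<Rightarrow> 'a \<Rightarrow> 'v \<Rightarrow> 'v
    \<Rightarrow> ('v, 'a, 'k::field) cochain set" where
  "special_images Q Z \<alpha> \<beta> v w =
     (let \<delta> = (\<lambda>p. delta0 (glued_quiver Q \<alpha> \<beta>) (glued_relations Q Z \<alpha> \<beta>)
                  (basis (vertex_path (star_vertex Q \<alpha> \<beta> v), star_path Q \<alpha> \<beta> p)))
      in {\<delta> p | p. p \<in> nonzero_paths Q Z \<and> 1 \<le> length (snd p)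
           \<and> (fst p = v \<and> path_target Q p = w \<or> fst p = w \<and> path_target Q p = v) \<and> \<delta> p \<noteq> 0})"

definition Z_sp :: "('v, 'a) pre_digraph \<Rightarrow> ('v, 'a) qpath set \<Rightarrow> 'a \<Rightarrow> 'a
    \<Rightarrow> ('v, 'a, 'k::field) cochain set" where
  "Z_sp Q Z \<alpha> \<beta> = cochain.span
     (special_images Q Z \<alpha> \<beta> (tail Q \<alpha>) (tail Q \<beta>)
      \<union> special_images Q Z \<alpha> \<beta> (head Q \<alpha>) (head Q \<beta>))"

definition Y_sum :: "('v, 'a) pre_digraph \<Rightarrow> ('v, 'a) qpath set \<Rightarrow> 'a \<Rightarrow> 'a
    \<Rightarrow> ('v, 'a, 'k::field) cochain set" where
  "Y_sum Q Z \<alpha> \<beta> = {x + y | x y. x \<in> psi1 Q \<alpha> \<beta> ` im_delta0 Q Z \<and> y \<in> Z_sp Q Z \<alpha> \<beta>}"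

end

theory Submission
  imports Defs
begin

text \<open>
  A cocycle is the same as a derivation of the monomial algebra vanishing on the vertices, and the
  bracket is the commutator of derivations; this gives the Jacobi identity, and coboundaries are the
  inner derivations among these.

  Since \<open>\<alpha>\<close> is a source arrow and \<open>\<beta>\<close> a sink arrow, the nonzero paths of the glued algebra are exactly
  the images of those of the original one. For an arrow \<open>a\<close> other than \<open>\<alpha>\<close> and \<open>\<beta>\<close> the paths parallel to
  \<open>a\<close> are literally the same in both algebras. The remaining basis elements are $\alpha\|\alpha$ and
  $\beta\|\beta$ in the original algebra, which are coboundaries because \<open>\<alpha>\<close> and \<open>\<beta>\<close> end in a source and a
  sink, and $\gamma^*\|\gamma^*$ and $\gamma^*\|\gamma^* q \gamma^*$ in the glued one, the latter being
  the special coboundaries up to sign. Forgetting the remaining basis elements is therefore a surjective Lie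
  homomorphism from the cocycles of the glued algebra to the cohomology of the original one. Its kernel
  is \<open>Y\<close>, which is spanned by the coboundaries and $\gamma^*\|\gamma^*$. When \<open>\<alpha>\<close> and \<open>\<beta>\<close> lie in
  different blocks, summing over the vertices of one block shows that $\gamma^*\|\gamma^*$ is itself a
  coboundary.
\<close>

section \<open>Quotients of Lie algebras\<close>

text \<open>The given map \<open>psi1\<close> goes from A to B, but it does not descend to
  cohomology: \<alpha>||\<alpha> is a coboundary of A, while its image \<open>gg\<close> need not be
  one of B. This is why the comparison runs from B to A. Once restriction is known to be a
  homomorphism onto HH1 of A with kernel Y, the ideal property and the isomorphism follow from
  general facts on kernels, and no bracket with an element of Y is ever computed. Two facts carry
  the combinatorics. The families of length two in Z_new are empty, and the one remaining family
  forbids the glued arrow in the interior of a nonzero path. So in such a path it occurs only in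
  first place, as the image of \<alpha>, or in last place, as the image of \<beta>. Moreover f_1 =
  e_1 + e_{n-1} is not additive for the differential: the coboundary of f_1 is the image of that of
  e_{n-1} alone, since the glued arrow leaves f_1 only once. In the same way f_2 corresponds to e_2
  alone. Hence e_1 and e_n are the exceptional vertices, and both contribute the same extra element
  \<open>gg\<close> up to sign.\<close>

definition lie_hom :: "('x, 'k::field) lie \<Rightarrow> ('y, 'k) lie \<Rightarrow> ('x \<Rightarrow> 'y) \<Rightarrow> bool" where
  "lie_hom L M h \<longleftrightarrow> (\<forall>x\<in>carrier L. h x \<in> carrier M)
    \<and> (\<forall>x\<in>carrier L. \<forall>y\<in>carrier L. h (ladd L x y) = ladd M (h x) (h y))
    \<and> (\<forall>c. \<forall>x\<in>carrier L. h (lscale L c x) = lscale M c (h x))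
    \<and> (\<forall>x\<in>carrier L. \<forall>y\<in>carrier L. h (lbracket L x y) = lbracket M (h x) (h y))"

lemma lie_homD:
  assumes "lie_hom L M h"
  shows "x \<in> carrier L \<Longrightarrow> h x \<in> carrier M"
    and "x \<in> carrier L \<Longrightarrow> y \<in> carrier L \<Longrightarrow> h (ladd L x y) = ladd M (h x) (h y)"
    and "x \<in> carrier L \<Longrightarrow> h (lscale L c x) = lscale M c (h x)"
    and "x \<in> carrier L \<Longrightarrow> y \<in> carrier L \<Longrightarrow> h (lbracket L x y) = lbracket M (h x) (h y)"
  using assms by (auto simp: lie_hom_def)

context lie_algebra
begin

lemma add_left_cancel:
  assumes "x \<in> carrier L" "y \<in> carrier L" "z \<in> carrier L" "ladd L x y = ladd L x z"
  shows "y = z"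
proof -
  obtain x' where x': "x' \<in> carrier L" "ladd L x x' = lzero L"
    using add_inverse assms(1) by blast
  have "y = ladd L (ladd L x' x) y"
    using x' assms add_zero add_commute by simp
  also have "\<dots> = ladd L (ladd L x' x) z"
    using x' assms add_assoc by simp
  also have "\<dots> = z"
    using x' assms add_zero add_commute by simp
  finally show ?thesis .
qed

lemma scale_zero: "x \<in> carrier L \<Longrightarrow> lscale L 0 x = lzero L"
proof -
  assume x: "x \<in> carrier L"
  have "ladd L (lscale L 0 x) (lscale L 0 x) = ladd L (lscale L 0 x) (lzero L)"
    using scale_add_left[OF x, of 0 0] add_commute[of "lscale L 0 x" "lzero L"]
      add_zero scale_closed[OF x] zero_closed by simp
  then show ?thesis
    using add_left_cancel scale_closed[OF x] zero_closed by blast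
qed

lemma add_uminus: "x \<in> carrier L \<Longrightarrow> ladd L x (lscale L (- 1) x) = lzero L"
  using scale_add_left[of x 1 "- 1"] scale_one[of x] scale_zero[of x] by simp

lemma add_zero_right: "x \<in> carrier L \<Longrightarrow> ladd L x (lzero L) = x"
  using add_commute add_zero zero_closed by metis

lemma add_diff_cancel:
  "x \<in> carrier L \<Longrightarrow> y \<in> carrier L \<Longrightarrow> ladd L x (ladd L (lscale L (- 1) x) y) = y"
  using add_assoc[of x "lscale L (- 1) x" y] add_uminus scale_closed add_zero by simp

lemma add_left_commute:
  "x \<in> carrier L \<Longrightarrow> y \<in> carrier L \<Longrightarrow> z \<in> carrier L \<Longrightarrow> ladd L x (ladd L y z) = ladd L y (ladd L x z)"
  using add_assoc[of x y z] add_assoc[of y x z] add_commute[of x y] by simp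

text \<open>Polarisation of \<open>bracket_self\<close> at \<open>x + y\<close>; nothing is divided
  by 2, so the characteristic is arbitrary. It supplies the right-hand ideal property, since
  \<open>lie_ideal\<close> only demands closure under brackets from the left.\<close>

lemma bracket_anti:
  assumes "x \<in> carrier L" "y \<in> carrier L"
  shows "lbracket L x y = lscale L (- 1) (lbracket L y x)"
proof -
  let ?s = "ladd L x y"
  have c: "lbracket L x y \<in> carrier L" "lbracket L y x \<in> carrier L"
    using assms bracket_closed by auto
  have "lbracket L ?s ?s = ladd L (lbracket L x ?s) (lbracket L y ?s)"
    using assms add_closed by (simp add: bracket_add_left)
  also have "\<dots> = ladd L (lbracket L x y) (lbracket L y x)"
    using assms c by (simp add: bracket_add_right bracket_self add_zero add_zero_right)
  finally have "ladd L (lbracket L y x) (lbracket L x y) = lzero L"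
    using bracket_self[OF add_closed[OF assms]] add_commute[OF c] by simp
  then have "ladd L (lbracket L y x) (lbracket L x y)
    = ladd L (lbracket L y x) (lscale L (- 1) (lbracket L y x))"
    using add_uminus c by simp
  then show ?thesis using add_left_cancel c scale_closed by blast
qed

lemma hom_zero:
  assumes "lie_algebra M" "lie_hom L M h"
  shows "h (lzero L) = lzero M"
proof -
  have "h (lscale L 0 (lzero L)) = lscale M 0 (h (lzero L))"
    using assms(2) zero_closed by (auto simp: lie_hom_def)
  then show ?thesis
    using lie_algebra.scale_zero[OF assms(1)] scale_zero zero_closed lie_homD(1)[OF assms(2)] by simp
qed

text \<open>Every axiom passes to the image of a map preserving the operations. As
  \<open>lie_hom\<close> does not presuppose that its target is a Lie algebra, this can be used to
  prove that a quotient is one.\<close>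

lemma lie_algebra_image:
  assumes h: "lie_hom L M h" and c: "carrier M = h ` carrier L" and z: "lzero M = h (lzero L)"
  shows "lie_algebra M"
proof -
  note hs = lie_homD(2-4)[OF h, symmetric]
  have inv: "\<exists>y\<in>carrier L. ladd M (h x) (h y) = h (lzero L)" if x: "x \<in> carrier L" for x
    using add_inverse[OF x] hs(1)[OF x] by metis
  show ?thesis
  proof (unfold_locales, goal_cases)
    \<comment> \<open>Commutativity of addition, instantiated at chosen preimages rather than handed
      to the simplifier as a rewrite rule.\<close>
    case (6 x y)
    then obtain x' y' where "x' \<in> carrier L" "y' \<in> carrier L" "x = h x'" "y = h y'"
      by (auto simp: c)
    then show ?case using add_commute[of x' y'] by (simp add: hs)
  qed (use inv in \<open>auto simp: c z hs add_closed scale_closed bracket_closed zero_closed add_assoc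
        add_zero scale_add_right scale_add_left scale_scale scale_one bracket_add_left
        bracket_add_right bracket_scale_left bracket_scale_right bracket_self jacobi\<close>)
qed

end

locale lie_ideal_quot = lie_algebra L for L :: "('x, 'k::field) lie" +
  fixes I
  assumes ideal: "lie_ideal L I"
begin

lemma ideal_closed:
  shows "i \<in> I \<Longrightarrow> i \<in> carrier L" and "lzero L \<in> I"
    and "i \<in> I \<Longrightarrow> j \<in> I \<Longrightarrow> ladd L i j \<in> I" and "i \<in> I \<Longrightarrow> lscale L c i \<in> I"
    and "x \<in> carrier L \<Longrightarrow> i \<in> I \<Longrightarrow> lbracket L x i \<in> I"
    and "x \<in> carrier L \<Longrightarrow> i \<in> I \<Longrightarrow> lbracket L i x \<in> I"
  using ideal bracket_anti[of i x] by (auto simp: lie_ideal_def lie_subspace_def)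

lemma coset_memI: "i \<in> I \<Longrightarrow> ladd L x i \<in> lie_coset L I x"
  by (simp add: lie_coset_def)

lemma coset_self: "x \<in> carrier L \<Longrightarrow> x \<in> lie_coset L I x"
  using coset_memI[OF ideal_closed(2), of x] add_zero_right by simp

lemma coset_absorb:
  assumes x: "x \<in> carrier L" and i: "i \<in> I"
  shows "lie_coset L I (ladd L x i) = lie_coset L I x"
proof -
  note ic = ideal_closed
  have "ladd L (ladd L x i) j \<in> lie_coset L I x" if j: "j \<in> I" for j
    using x i j ic add_assoc coset_memI by simp
  moreover have "ladd L x j \<in> lie_coset L I (ladd L x i)" if j: "j \<in> I" for j
  proof -
    have "ladd L x j = ladd L (ladd L x i) (ladd L (lscale L (- 1) i) j)"
      using x i j ic(1) add_assoc add_diff_cancel scale_closed add_closed by simp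
    then show ?thesis using i j ic coset_memI by simp
  qed
  ultimately show ?thesis by (force simp: lie_coset_def)
qed

lemma coset_eq_iff:
  assumes x: "x \<in> carrier L" and y: "y \<in> carrier L"
  shows "lie_coset L I x = lie_coset L I y \<longleftrightarrow> (\<exists>i\<in>I. x = ladd L y i)"
proof
  assume "lie_coset L I x = lie_coset L I y"
  then have "x \<in> lie_coset L I y" using coset_self[OF x] by simp
  then show "\<exists>i\<in>I. x = ladd L y i" by (auto simp: lie_coset_def)
next
  assume "\<exists>i\<in>I. x = ladd L y i"
  then show "lie_coset L I x = lie_coset L I y" using coset_absorb[OF y] by auto
qed

lemma coset_zero_iff:
  assumes x: "x \<in> carrier L"
  shows "lie_coset L I x = lie_coset L I (lzero L) \<longleftrightarrow> x \<in> I"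
  using coset_eq_iff[OF x zero_closed] ideal_closed(1) add_zero by auto

text \<open>Each union over representatives collapses because all its members are the same coset.
  For the bracket, [x+i, y+j] differs from [x, y] by [x, j] + [i, y+j], which lies in the
  ideal.\<close>

lemma coset_ops:
  assumes x: "x \<in> carrier L" and y: "y \<in> carrier L"
  shows "(\<Union>x'\<in>lie_coset L I x. \<Union>y'\<in>lie_coset L I y. lie_coset L I (ladd L x' y'))
      = lie_coset L I (ladd L x y)" (is ?add)
    and "(\<Union>x'\<in>lie_coset L I x. lie_coset L I (lscale L c x')) = lie_coset L I (lscale L c x)"
      (is ?scale)
    and "(\<Union>x'\<in>lie_coset L I x. \<Union>y'\<in>lie_coset L I y. lie_coset L I (lbracket L x' y'))
      = lie_coset L I (lbracket L x y)" (is ?bracket)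
proof -
  note ic = ideal_closed
  have ne: "I \<noteq> {}" using ic(2) by blast
  have "lie_coset L I (ladd L (ladd L x i) (ladd L y j)) = lie_coset L I (ladd L x y)"
    if i: "i \<in> I" and j: "j \<in> I" for i j
  proof -
    have "ladd L (ladd L x i) (ladd L y j) = ladd L (ladd L x y) (ladd L i j)"
      using x y ic(1)[OF i] ic(1)[OF j] by (simp add: add_assoc add_left_commute add_closed)
    then show ?thesis using coset_absorb add_closed x y i j ic(3) by simp
  qed
  then show ?add using ne unfolding lie_coset_def[of L I x] lie_coset_def[of L I y] by auto
  have "lie_coset L I (lscale L c (ladd L x i)) = lie_coset L I (lscale L c x)" if i: "i \<in> I" for i
    using x i ic scale_add_right coset_absorb scale_closed by simp
  then show ?scale using ne unfolding lie_coset_def[of L I x] by auto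
  have "lie_coset L I (lbracket L (ladd L x i) (ladd L y j)) = lie_coset L I (lbracket L x y)"
    if i: "i \<in> I" and j: "j \<in> I" for i j
  proof -
    have "lbracket L (ladd L x i) (ladd L y j)
      = ladd L (lbracket L x y) (ladd L (lbracket L x j) (lbracket L i (ladd L y j)))"
      using x y ic(1)[OF i] ic(1)[OF j]
      by (simp add: bracket_add_left[of x i] bracket_add_right[of x y j] add_closed bracket_closed
          add_assoc)
    moreover have "ladd L (lbracket L x j) (lbracket L i (ladd L y j)) \<in> I"
      using x y i j ic add_closed by simp
    ultimately show ?thesis using coset_absorb bracket_closed x y by simp
  qed
  then show ?bracket using ne unfolding lie_coset_def[of L I x] lie_coset_def[of L I y] by auto
qed

lemma lie_hom_coset: "lie_hom L (lie_quot L I) (lie_coset L I)"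
  unfolding lie_hom_def by (simp add: lie_quot_def coset_ops)

lemma carrier_quot: "carrier (lie_quot L I) = lie_coset L I ` carrier L"
  by (simp add: lie_quot_def)

lemma zero_quot: "lzero (lie_quot L I) = lie_coset L I (lzero L)"
  by (simp add: lie_quot_def)

lemma lie_algebra_quot: "lie_algebra (lie_quot L I)"
  using lie_algebra_image[OF lie_hom_coset carrier_quot zero_quot] .

lemma factor_hom:
  assumes h: "lie_hom L M h" and M: "lie_algebra M" and ker: "\<And>i. i \<in> I \<Longrightarrow> h i = lzero M"
  obtains g where "lie_hom (lie_quot L I) M g" "\<And>x. x \<in> carrier L \<Longrightarrow> g (lie_coset L I x) = h x"
proof
  interpret M: lie_algebra M by (fact M)
  \<comment> \<open>An arbitrary representative is chosen; two choices differ by an element of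
    \<open>I\<close>, which \<open>h\<close> sends to zero.\<close>
  define g where "g X = h (SOME x. x \<in> X)" for X
  show g: "g (lie_coset L I x) = h x" if x: "x \<in> carrier L" for x
  proof -
    have "(SOME y. y \<in> lie_coset L I x) \<in> lie_coset L I x"
      using coset_self[OF x] by (rule someI)
    then obtain i where i: "i \<in> I" "(SOME y. y \<in> lie_coset L I x) = ladd L x i"
      by (auto simp: lie_coset_def)
    then show ?thesis
      using ker x ideal_closed(1) lie_homD[OF h] M.add_zero_right by (simp add: g_def)
  qed
  show "lie_hom (lie_quot L I) M g"
    unfolding lie_hom_def carrier_quot
    by (auto simp: g lie_homD(2-4)[OF lie_hom_coset, symmetric] lie_homD[OF h]
        add_closed scale_closed bracket_closed)
qed

end

text \<open>The kernel is given as a set \<open>I\<close> with a membership criterion, the form in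
  which the image of Y in HH1 of the glued algebra will appear.\<close>

lemma lie_ideal_kernel:
  assumes L: "lie_algebra L" and M: "lie_algebra M" and h: "lie_hom L M h"
    and I: "I \<subseteq> carrier L" "\<And>x. x \<in> carrier L \<Longrightarrow> x \<in> I \<longleftrightarrow> h x = lzero M"
  shows "lie_ideal L I"
proof -
  interpret L: lie_algebra L by (fact L)
  interpret M: lie_algebra M by (fact M)
  have scale0: "lscale M c (lzero M) = lzero M" for c
    using M.scale_scale[OF M.zero_closed, of c 0] M.scale_zero[OF M.zero_closed] by simp
  have br0: "lbracket M x (lzero M) = lzero M" if "x \<in> carrier M" for x
    using M.bracket_scale_right[OF that M.zero_closed, of 0] that
      M.scale_zero M.zero_closed M.bracket_closed by simp
  have kerI: "x \<in> I \<longleftrightarrow> x \<in> carrier L \<and> h x = lzero M" for x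
    using I by blast
  show ?thesis
    unfolding lie_ideal_def lie_subspace_def
    using L I(1) kerI scale0 br0
    by (auto simp: subset_iff lie_homD[OF h] L.add_closed L.scale_closed L.bracket_closed
        L.zero_closed L.hom_zero[OF M h] M.add_zero M.zero_closed)
qed

lemma lie_isomorphic_sym:
  assumes "lie_isomorphic L M"
  shows "lie_isomorphic M L"
proof -
  from assms obtain f where LM: "lie_algebra L" "lie_algebra M"
    and bij: "bij_betw f (carrier L) (carrier M)"
    and f: "\<And>x y. x \<in> carrier L \<Longrightarrow> y \<in> carrier L \<Longrightarrow> f (ladd L x y) = ladd M (f x) (f y)"
      "\<And>c x. x \<in> carrier L \<Longrightarrow> f (lscale L c x) = lscale M c (f x)"
      "\<And>x y. x \<in> carrier L \<Longrightarrow> y \<in> carrier L \<Longrightarrow> f (lbracket L x y) = lbracket M (f x) (f y)"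
    by (auto simp: lie_isomorphic_def)
  interpret L: lie_algebra L by fact
  let ?g = "inv_into (carrier L) f"
  have g: "?g (f x) = x" if "x \<in> carrier L" for x
    using bij that by (simp add: bij_betw_def)
  have im: "carrier M = f ` carrier L" using bij by (simp add: bij_betw_def)
  have "bij_betw ?g (carrier M) (carrier L)"
    using bij by (rule bij_betw_inv_into)
  moreover have "?g (ladd M u v) = ladd L (?g u) (?g v)"
    "?g (lbracket M u v) = lbracket L (?g u) (?g v)" "?g (lscale M c u) = lscale L c (?g u)"
    if "u \<in> carrier M" "v \<in> carrier M" for u v c
    using that unfolding im
    by (auto simp: f[symmetric] g L.add_closed L.bracket_closed L.scale_closed)
  ultimately show ?thesis using LM unfolding lie_isomorphic_def by blast
qed

lemma lie_first_isomorphism: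
  assumes L: "lie_algebra L" and M: "lie_algebra M" and h: "lie_hom L M h"
    and surj: "h ` carrier L = carrier M"
    and I: "I \<subseteq> carrier L" "\<And>x. x \<in> carrier L \<Longrightarrow> x \<in> I \<longleftrightarrow> h x = lzero M"
  shows "lie_isomorphic (lie_quot L I) M"
proof -
  have ideal: "lie_ideal L I" by (rule lie_ideal_kernel[OF L M h I])
  interpret lie_ideal_quot L I
    using L ideal by (simp add: lie_ideal_quot_def lie_ideal_quot_axioms_def)
  interpret M: lie_algebra M by (fact M)
  obtain g where g: "lie_hom (lie_quot L I) M g"
    "\<And>x. x \<in> carrier L \<Longrightarrow> g (lie_coset L I x) = h x"
    using factor_hom[OF h M] I by blast
  have "inj_on g (carrier (lie_quot L I))"
  proof (rule inj_onI)
    fix X Y assume "X \<in> carrier (lie_quot L I)" "Y \<in> carrier (lie_quot L I)" "g X = g Y"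
    then obtain x y where xy: "x \<in> carrier L" "y \<in> carrier L" "X = lie_coset L I x"
      "Y = lie_coset L I y" "h x = h y"
      by (auto simp: carrier_quot g(2))
    let ?d = "ladd L (lscale L (- 1) y) x"
    have "h ?d = ladd M (h y) (lscale M (- 1) (h y))"
      using xy lie_homD[OF h] scale_closed M.add_commute M.scale_closed by simp
    also have "\<dots> = lzero M" using M.add_uminus xy lie_homD(1)[OF h] by simp
    finally have "?d \<in> I" using xy I(2) add_closed scale_closed by simp
    moreover have "x = ladd L y ?d" using add_diff_cancel xy by simp
    ultimately show "X = Y" using coset_eq_iff xy by blast
  qed
  moreover have "g ` carrier (lie_quot L I) = carrier M"
    unfolding carrier_quot image_image using g(2) surj by (simp cong: image_cong)
  ultimately show ?thesis
    unfolding lie_isomorphic_def bij_betw_def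
    using lie_algebra_quot M lie_homD[OF g(1)] by blast
qed

section \<open>Linear and bilinear extensions\<close>

abbreviation klinear :: "(('x \<Rightarrow>\<^sub>0 'k::field) \<Rightarrow> ('y \<Rightarrow>\<^sub>0 'k)) \<Rightarrow> bool" where
  "klinear \<equiv> Vector_Spaces.linear scale scale"

lemma klinearI:
  assumes "\<And>x y. F (x + y) = F x + F y" "\<And>c x. F (scale c x) = scale c (F x)"
  shows "klinear F"
  unfolding Vector_Spaces.linear_iff using assms by (auto intro: cochain.vector_space_axioms)

lemma klinear_add: "klinear F \<Longrightarrow> F (x + y) = F x + F y"
  by (simp add: Vector_Spaces.linear_iff)

lemma klinear_scale: "klinear F \<Longrightarrow> F (scale c x) = scale c (F x)"
  by (simp add: Vector_Spaces.linear_iff)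

lemma klinear_0: "klinear F \<Longrightarrow> F 0 = 0"
  using klinear_scale[of F 0 0] by simp

lemma klinear_diff: "klinear F \<Longrightarrow> F (x - y) = F x - F y"
  using klinear_add[of F x "- y"] klinear_scale[of F "- 1" y] by simp

lemma klinear_sum: "klinear F \<Longrightarrow> F (sum g A) = (\<Sum>a\<in>A. F (g a))"
  by (induction A rule: infinite_finite_induct) (simp_all add: klinear_0 klinear_add)

lemma klinear_id: "klinear (\<lambda>x. x)"
  by (rule klinearI) simp_all

lemma klinear_zero: "klinear (\<lambda>x. 0)"
  by (rule klinearI) simp_all

lemma klinear_plus: "klinear F \<Longrightarrow> klinear G \<Longrightarrow> klinear (\<lambda>x. F x + G x)"
  by (rule klinearI) (simp_all add: klinear_add klinear_scale cochain.scale_right_distrib)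

lemma klinear_minus: "klinear F \<Longrightarrow> klinear G \<Longrightarrow> klinear (\<lambda>x. F x - G x)"
  by (rule klinearI) (simp_all add: klinear_add klinear_scale cochain.scale_right_diff_distrib)

lemma klinear_comp: "klinear F \<Longrightarrow> klinear G \<Longrightarrow> klinear (\<lambda>x. F (G x))"
  by (rule klinearI) (simp_all add: klinear_add klinear_scale)

lemma lookup_basis: "Poly_Mapping.lookup (basis x) y = (if x = y then 1 else 0)"
  by (simp add: basis_def lookup_single when_def)

lemma keys_basis [simp]: "Poly_Mapping.keys (basis x :: _ \<Rightarrow>\<^sub>0 'k::field) = {x}"
  by (simp add: basis_def)

text \<open>The support of a sum can shrink by cancellation. Over a common finite index set the
  defining sums can be compared term by term.\<close>

lemma linear_extension_superset:
  assumes "finite A" "Poly_Mapping.keys f \<subseteq> A"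
  shows "linear_extension F f = (\<Sum>x\<in>A. scale (Poly_Mapping.lookup f x) (F x))"
  unfolding linear_extension_def
  by (rule sum.mono_neutral_left) (use assms in \<open>auto simp: in_keys_iff\<close>)

lemma klinear_linear_extension:
  fixes F :: "'x \<Rightarrow> ('y \<Rightarrow>\<^sub>0 'k::field)"
  shows "klinear (linear_extension F)"
proof (rule klinearI)
  fix f g :: "'x \<Rightarrow>\<^sub>0 'k"
  let ?A = "Poly_Mapping.keys f \<union> Poly_Mapping.keys g"
  have "linear_extension F (f + g) = (\<Sum>x\<in>?A. scale (Poly_Mapping.lookup (f + g) x) (F x))"
    by (rule linear_extension_superset) (simp_all add: keys_add)
  moreover have "linear_extension F f = (\<Sum>x\<in>?A. scale (Poly_Mapping.lookup f x) (F x))"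
    by (rule linear_extension_superset) auto
  moreover have "linear_extension F g = (\<Sum>x\<in>?A. scale (Poly_Mapping.lookup g x) (F x))"
    by (rule linear_extension_superset) auto
  ultimately show "linear_extension F (f + g) = linear_extension F f + linear_extension F g"
    by (simp add: lookup_add cochain.scale_left_distrib sum.distrib)
next
  fix c f
  have "linear_extension F (scale c f)
    = (\<Sum>x\<in>Poly_Mapping.keys f. scale (Poly_Mapping.lookup (scale c f) x) (F x))"
    by (rule linear_extension_superset) (auto simp: in_keys_iff)
  then show "linear_extension F (scale c f) = scale c (linear_extension F f)"
    by (simp add: linear_extension_def cochain.scale_sum_right)
qed

lemma linear_extension_basis [simp]: "linear_extension F (basis x) = F x"
  by (simp add: linear_extension_def lookup_basis)

lemma basis_expansion: "f = (\<Sum>x\<in>Poly_Mapping.keys f. scale (Poly_Mapping.lookup f x) (basis x))"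
  by (rule poly_mapping_eqI)
    (auto simp: lookup_sum lookup_basis in_keys_iff if_distrib sum.delta cong: if_cong)

lemma klinear_expansion:
  assumes "klinear F"
  shows "F f = (\<Sum>x\<in>Poly_Mapping.keys f. scale (Poly_Mapping.lookup f x) (F (basis x)))"
  using arg_cong[OF basis_expansion[of f], of F]
  by (simp add: klinear_sum[OF assms] klinear_scale[OF assms])

text \<open>The main reduction for identities between cochains: it is enough to look at basis
  elements in the support of \<open>f\<close>, and membership of \<open>f\<close> in a cochain space
  tells which pairs of paths can occur there.\<close>

lemma klinear_eq_on_keys:
  assumes "klinear F" "klinear G" "\<And>x. x \<in> Poly_Mapping.keys f \<Longrightarrow> F (basis x) = G (basis x)"
  shows "F f = G f"
  using assms(3) by (simp add: klinear_expansion[OF assms(1), of f] klinear_expansion[OF assms(2), of f])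

lemma klinear_in_subspace:
  assumes "klinear F" "cochain.subspace W" "\<And>x. x \<in> Poly_Mapping.keys f \<Longrightarrow> F (basis x) \<in> W"
  shows "F f \<in> W"
  using assms(2,3)
  by (auto simp: klinear_expansion[OF assms(1), of f] cochain.subspace_scale intro: cochain.subspace_sum)

lemma subspace_keys: "cochain.subspace {f :: 'x \<Rightarrow>\<^sub>0 'k::field. Poly_Mapping.keys f \<subseteq> S}"
proof (rule cochain.subspaceI)
  fix f g :: "'x \<Rightarrow>\<^sub>0 'k"
  assume "f \<in> {f. Poly_Mapping.keys f \<subseteq> S}" "g \<in> {f. Poly_Mapping.keys f \<subseteq> S}"
  then show "f + g \<in> {f. Poly_Mapping.keys f \<subseteq> S}"
    using keys_add[of f g] by auto
next
  fix c and f :: "'x \<Rightarrow>\<^sub>0 'k"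
  assume "f \<in> {f. Poly_Mapping.keys f \<subseteq> S}"
  then show "scale c f \<in> {f. Poly_Mapping.keys f \<subseteq> S}"
    by (auto simp: in_keys_iff)
qed simp

lemma klinear_image_subspace:
  assumes F: "klinear F" and W: "cochain.subspace W"
  shows "cochain.subspace (F ` W)"
proof (rule cochain.subspaceI)
  show "0 \<in> F ` W" using klinear_0[OF F] cochain.subspace_0[OF W] by (metis imageI)
  show "x + y \<in> F ` W" if "x \<in> F ` W" "y \<in> F ` W" for x y
    using that by (auto simp flip: klinear_add[OF F] intro!: imageI cochain.subspace_add[OF W])
  show "scale c x \<in> F ` W" if "x \<in> F ` W" for c x
    using that by (auto simp flip: klinear_scale[OF F] intro!: imageI cochain.subspace_scale[OF W])
qed

text \<open>Terms with distinct images cannot cancel. Injectivity is asked only on the support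
  because the map induced on paths by gluing identifies paths with different starting
  points.\<close>

lemma klinear_relabel_inj:
  assumes "inj_on s (Poly_Mapping.keys g)" "linear_extension (\<lambda>p. basis (s p)) g = (0 :: _ \<Rightarrow>\<^sub>0 'k::field)"
  shows "g = 0"
proof (rule poly_mapping_eqI)
  fix y
  show "Poly_Mapping.lookup g y = Poly_Mapping.lookup 0 y"
  proof (cases "y \<in> Poly_Mapping.keys g")
    case True
    have "Poly_Mapping.lookup (linear_extension (\<lambda>p. basis (s p)) g) (s y)
      = (\<Sum>x\<in>Poly_Mapping.keys g. if x = y then Poly_Mapping.lookup g x else 0)"
      unfolding linear_extension_def lookup_sum
      by (rule sum.cong) (use assms(1) True in \<open>auto simp: lookup_basis inj_on_def\<close>)
    then show ?thesis using assms(2) True by simp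
  qed (simp add: in_keys_iff)
qed

lemma klinear_bilinear_left: "klinear (\<lambda>f. bilinear_extension F f g)"
  unfolding bilinear_extension_def by (rule klinear_linear_extension)

lemma klinear_nested_right: "klinear (\<lambda>g. linear_extension (\<lambda>x. linear_extension (F x) g) f)"
proof -
  have "klinear (\<lambda>g. linear_extension (F x) g)" for x
    by (rule klinear_linear_extension)
  then show ?thesis
    unfolding linear_extension_def[of _ f]
    by (intro klinearI)
      (simp_all add: klinear_add klinear_scale cochain.scale_right_distrib sum.distrib
        cochain.scale_sum_right mult.commute)
qed

lemma klinear_bilinear_right: "klinear (bilinear_extension F f)"
  unfolding bilinear_extension_def by (rule klinear_nested_right)

lemma bilinear_extension_basis [simp]: "bilinear_extension F (basis x) (basis y) = F x y"
  by (simp add: bilinear_extension_def)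

lemma bilinear_eq_on_keys:
  assumes "\<And>g. klinear (\<lambda>f. F f g)" "\<And>f. klinear (F f)"
    and "\<And>g. klinear (\<lambda>f. G f g)" "\<And>f. klinear (G f)"
    and "\<And>x y. x \<in> Poly_Mapping.keys f \<Longrightarrow> y \<in> Poly_Mapping.keys g
      \<Longrightarrow> F (basis x) (basis y) = G (basis x) (basis y)"
  shows "F f g = G f g"
proof (rule klinear_eq_on_keys[OF assms(1)[of g] assms(3)[of g]])
  fix x assume "x \<in> Poly_Mapping.keys f"
  then show "F (basis x) g = G (basis x) g"
    using klinear_eq_on_keys[OF assms(2)[of "basis x"] assms(4)[of "basis x"], of g] assms(5)
    by blast
qed

text \<open>Reads a 1-cochain as a function on arrows: \<open>component b f\<close> is the value at
  \<open>b\<close> of the derivation that \<open>f\<close> represents. \<open>tag\<close> is the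
  inclusion of such a value at \<open>b\<close>.\<close>

definition component :: "'x \<Rightarrow> (('x \<times> 'y) \<Rightarrow>\<^sub>0 'k::field) \<Rightarrow> ('y \<Rightarrow>\<^sub>0 'k)" where
  "component b = linear_extension (\<lambda>(a, q). if a = b then basis q else 0)"

definition tag :: "'x \<Rightarrow> ('y \<Rightarrow>\<^sub>0 'k::field) \<Rightarrow> (('x \<times> 'y) \<Rightarrow>\<^sub>0 'k)" where
  "tag b = linear_extension (\<lambda>q. basis (b, q))"

lemma klinear_component: "klinear (component b)"
  unfolding component_def by (rule klinear_linear_extension)

lemma klinear_tag: "klinear (tag b)"
  unfolding tag_def by (rule klinear_linear_extension)

lemma component_basis: "component b (basis (a, q)) = (if a = b then basis q else 0)"
  by (simp add: component_def)

lemma tag_basis: "tag b (basis q) = basis (b, q)"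
  by (simp add: tag_def)

lemma lookup_component: "Poly_Mapping.lookup (component b f) q = Poly_Mapping.lookup f (b, q)"
proof -
  have "Poly_Mapping.lookup (component b f) q
    = (\<Sum>x\<in>Poly_Mapping.keys f. if x = (b, q) then Poly_Mapping.lookup f x else 0)"
    unfolding component_def linear_extension_def lookup_sum
    by (rule sum.cong) (auto simp: lookup_basis split: if_splits)
  then show ?thesis by (simp add: in_keys_iff)
qed

lemma component_tag: "component c (tag b g) = (if b = c then g else 0)"
proof -
  have "klinear (\<lambda>g. if b = c then g else 0)"
    by (cases "b = c") (simp_all add: klinear_id klinear_zero)
  then show ?thesis
    by (rule klinear_eq_on_keys[OF klinear_comp[OF klinear_component klinear_tag]])
      (simp add: tag_basis component_basis)
qed

lemma component_eqI: "(\<And>b. component b f = component b g) \<Longrightarrow> f = g"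
  by (rule poly_mapping_eqI) (metis lookup_component prod.collapse)

lemma keys_component: "q \<in> Poly_Mapping.keys (component b f) \<longleftrightarrow> (b, q) \<in> Poly_Mapping.keys f"
  by (simp add: in_keys_iff lookup_component)

section \<open>Paths\<close>

context wf_digraph
begin

lemma paths_Nil_iff: "(u, []) \<in> paths G \<longleftrightarrow> u \<in> verts G"
  by (auto simp: paths_def awalk_simps)

lemma paths_Cons_iff: "(u, a # as) \<in> paths G \<longleftrightarrow> a \<in> arcs G \<and> tail G a = u \<and> (head G a, as) \<in> paths G"
  by (auto simp: paths_def awalk_simps)

lemma target_Nil: "path_target G (u, []) = u"
  by (simp add: path_target_def)

lemma target_Cons: "path_target G (u, a # as) = path_target G (head G a, as)"
  by (simp add: path_target_def)

lemmas path_simps = paths_Nil_iff paths_Cons_iff target_Nil target_Cons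

lemma paths_append_iff:
  "(u, as @ bs) \<in> paths G \<longleftrightarrow> (u, as) \<in> paths G \<and> (path_target G (u, as), bs) \<in> paths G"
proof (induction as arbitrary: u)
  case Nil
  then show ?case by (cases bs) (auto simp: path_simps)
qed (auto simp: path_simps)

lemma target_append: "path_target G (u, as @ bs) = path_target G (path_target G (u, as), bs)"
  by (induction as arbitrary: u) (auto simp: path_simps)

lemma target_in_verts: "(u, as) \<in> paths G \<Longrightarrow> path_target G (u, as) \<in> verts G"
  by (induction as arbitrary: u) (auto simp: path_simps)

lemma fst_in_verts: "p \<in> paths G \<Longrightarrow> fst p \<in> verts G"
  by (auto simp: paths_def)

lemma arrow_path_in_paths: "a \<in> arcs G \<Longrightarrow> arrow_path G a \<in> paths G"
  by (simp add: arrow_path_def path_simps)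

lemma target_arrow_path: "path_target G (arrow_path G a) = head G a"
  by (simp add: arrow_path_def path_simps)

lemma path_comp_iff:
  "path_target G p = fst q \<Longrightarrow> path_comp q p \<in> paths G \<longleftrightarrow> p \<in> paths G \<and> q \<in> paths G"
  by (cases p; cases q) (simp add: path_comp_def paths_append_iff)

lemma target_path_comp:
  "path_target G p = fst q \<Longrightarrow> path_target G (path_comp q p) = path_target G q"
  by (cases p; cases q) (simp add: path_comp_def target_append)

lemma parallel_arrow_iff:
  "parallel G (arrow_path G a) p \<longleftrightarrow> fst p = tail G a \<and> path_target G p = head G a"
  by (auto simp: parallel_def target_arrow_path) (simp_all add: arrow_path_def)

lemma replace_at_path:
  assumes "p \<in> paths G" "i < length (snd p)" "x \<in> paths G" "parallel G (arrow_path G (snd p ! i)) x"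
  shows "replace_at p i x \<in> paths G" and "path_target G (replace_at p i x) = path_target G p"
proof -
  obtain u as v bs where p: "p = (u, as)" and x: "x = (v, bs)" by fastforce
  have as: "as = take i as @ as ! i # drop (Suc i) as"
    using assms(2) p by (simp add: id_take_nth_drop)
  have v: "v = tail G (as ! i)" "path_target G (v, bs) = head G (as ! i)"
    using assms(4) by (auto simp: p x parallel_def arrow_path_def target_Cons target_Nil)
  have "(u, take i as @ as ! i # drop (Suc i) as) \<in> paths G"
    using as assms(1) p by simp
  moreover have "path_target G p
    = path_target G (u, take i as @ as ! i # drop (Suc i) as)"
    using as p by simp
  ultimately show "replace_at p i x \<in> paths G" "path_target G (replace_at p i x) = path_target G p"
    using assms(3) v by (auto simp: replace_at_def p x paths_append_iff target_append path_simps)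
qed

end

lemma subpath_length: "subpath G p q \<Longrightarrow> length (snd p) \<le> length (snd q)"
  by (auto simp: subpath_def path_comp_def)

lemma replace_at_path_comp:
  assumes "i < length (snd p)"
  shows "replace_at (path_comp q p) i x = path_comp q (replace_at p i x)"
  using assms by (simp add: replace_at_def path_comp_def)

lemma replace_at_path_comp':
  "replace_at (path_comp q p) (length (snd p) + j) x = path_comp (replace_at q j x) p"
  by (simp add: replace_at_def path_comp_def)

section \<open>The Lie algebra of cocycles\<close>

text \<open>The common ground on which cocycles of the original and of the glued algebra are
  treated. Finiteness of arrows and relations makes the sums in \<open>delta0\<close> and
  \<open>delta1\<close> meaningful, as a sum over an infinite set is 0 by convention.\<close>

locale bound_quiver = wf_digraph Q for Q :: "('v, 'a) pre_digraph" +
  fixes Z :: "('v, 'a) qpath set"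
  assumes arcs_finite: "finite (arcs Q)"
    and relations_finite: "finite Z"
    and relations_in_paths: "Z \<subseteq> paths Q"
begin

abbreviation "\<B> \<equiv> nonzero_paths Q Z"
abbreviation "tgt \<equiv> path_target Q"
abbreviation "arr \<equiv> arrow_path Q"

lemma nonzero_in_paths: "p \<in> \<B> \<Longrightarrow> p \<in> paths Q"
  by (simp add: nonzero_paths_def)

lemma relation_zero: "r \<in> Z \<Longrightarrow> r \<notin> \<B>"
proof -
  assume r: "r \<in> Z"
  then have p: "r \<in> paths Q" using relations_in_paths by blast
  obtain u as where ras: "r = (u, as)" by fastforce
  have "subpath Q r r"
    unfolding subpath_def
    by (rule bexI[of _ "(u, [])"], rule bexI[of _ "(tgt r, [])"])
      (use p ras in \<open>auto simp: path_simps path_comp_def target_in_verts fst_in_verts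
        dest: fst_in_verts\<close>)
  with r show "r \<notin> \<B>" by (auto simp: nonzero_paths_def)
qed

lemma nonzero_path_comp:
  assumes "p \<in> paths Q" "q \<in> paths Q" "tgt p = fst q" "path_comp q p \<in> \<B>"
  shows "p \<in> \<B>" and "q \<in> \<B>"
proof -
  have "subpath Q p (path_comp q p)"
    unfolding subpath_def
    by (rule bexI[of _ "(fst p, [])"], rule bexI[of _ q])
      (use assms in \<open>auto simp: path_simps path_comp_def fst_in_verts\<close>)
  moreover have "subpath Q q (path_comp q p)"
  proof -
    obtain v bs where q: "q = (v, bs)" by fastforce
    show ?thesis
      unfolding subpath_def
      by (rule bexI[of _ p], rule bexI[of _ "(tgt q, [])"])
        (use assms q in \<open>auto simp: path_simps path_comp_def target_in_verts\<close>)
  qed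
  moreover have "subpath Q r (path_comp q p)" if "r \<in> Z" "subpath Q r s" "subpath Q s (path_comp q p)"
    for r s
    using that relations_in_paths subpath_trans wf_digraph_axioms by blast
  moreover have "\<forall>r\<in>Z. \<not> subpath Q r (path_comp q p)"
    using assms(4) by (simp add: nonzero_paths_def)
  ultimately show "p \<in> \<B>" "q \<in> \<B>"
    using assms(1,2) unfolding nonzero_paths_def by blast+
qed

lemma zero_path_factor:
  assumes "p \<in> paths Q" "p \<notin> \<B>"
  obtains r u w where "r \<in> Z" "u \<in> paths Q" "w \<in> paths Q" "tgt u = fst r" "tgt r = fst w"
    "p = path_comp w (path_comp r u)"
  using assms by (auto simp: nonzero_paths_def subpath_def)

text \<open>
  Multiplication of the monomial algebra. Zero paths stay distinct basis elements of the domain; only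
  products are truncated.
\<close>

definition mult :: "(('v, 'a) qpath \<Rightarrow>\<^sub>0 'k::field) \<Rightarrow> (('v, 'a) qpath \<Rightarrow>\<^sub>0 'k) \<Rightarrow> (('v, 'a) qpath \<Rightarrow>\<^sub>0 'k)"
  where "mult = bilinear_extension
    (\<lambda>q p. if tgt p = fst q \<and> path_comp q p \<in> \<B> then basis (path_comp q p) else 0)"

text \<open>This is \<open>subst_sum\<close> without the label in the first entry, so that its
  values are algebra elements to which derivations can be applied again.\<close>

definition substitution :: "('v, 'a) qpath \<Rightarrow> ('v, 'a) qpath \<times> ('v, 'a) qpath
    \<Rightarrow> (('v, 'a) qpath \<Rightarrow>\<^sub>0 'k::field)"
  where "substitution r = (\<lambda>(a, p). \<Sum>i | i < length (snd r) \<and> arr (snd r ! i) = a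
    \<and> replace_at r i p \<in> \<B>. basis (replace_at r i p))"

text \<open>
  Since the derivation is defined on zero paths as well, being a cocycle amounts to vanishing on the
  relations, hence on all zero paths, so that a cocycle acts as a derivation of the algebra.
\<close>

definition derivation :: "('v, 'a, 'k::field) cochain \<Rightarrow> (('v, 'a) qpath \<Rightarrow>\<^sub>0 'k)
    \<Rightarrow> (('v, 'a) qpath \<Rightarrow>\<^sub>0 'k)"
  where "derivation f = linear_extension (\<lambda>r. linear_extension (substitution r) f)"

section \<open>Truncated multiplication and the Leibniz rule\<close>

lemma mult_basis: "mult (basis q) (basis p)
    = (if tgt p = fst q \<and> path_comp q p \<in> \<B> then basis (path_comp q p) else 0)"
  by (simp add: mult_def)

lemma klinear_mult_left: "klinear (\<lambda>x. mult x y)"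
  unfolding mult_def by (rule klinear_bilinear_left)

lemma klinear_mult_right: "klinear (mult x)"
  unfolding mult_def by (rule klinear_bilinear_right)

lemma klinear_derivation: "klinear (derivation f)"
  unfolding derivation_def by (rule klinear_linear_extension)

lemma klinear_derivation_left: "klinear (\<lambda>f. derivation f x)"
  unfolding derivation_def by (rule klinear_nested_right)

lemma derivation_basis: "derivation (basis (a, p)) (basis r) = substitution r (a, p)"
  by (simp add: derivation_def)

lemmas klinear_intros = klinear_id klinear_plus klinear_minus klinear_comp[OF klinear_mult_left]
  klinear_comp[OF klinear_mult_right] klinear_comp[OF klinear_derivation]
  klinear_comp[OF klinear_derivation_left] klinear_comp[OF klinear_component]
  klinear_comp[OF klinear_tag]

lemma cochain_key:
  assumes "f \<in> cochains1 Q Z" "x \<in> Poly_Mapping.keys f"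
  obtains a p where "x = (arr a, p)" "a \<in> arcs Q" "p \<in> \<B>" "parallel Q (arr a) p"
  using assms by (auto simp: cochains1_def cochains_def)

text \<open>With all positions as index set, the sum for a composite path splits at the length of
  its first factor.\<close>

lemma substitution_alt:
  "substitution r (a, p) = (\<Sum>i<length (snd r). if arr (snd r ! i) = a \<and> replace_at r i p \<in> \<B>
     then basis (replace_at r i p) else 0)"
  unfolding substitution_def
  by (subst sum.inter_filter[symmetric]) (auto intro!: sum.cong)

text \<open>An occurrence of \<open>a\<close> in a composite lies in exactly one of the factors.
  Truncation does no harm: if the composite after replacement is nonzero, then so is the factor in
  which the replacement took place.\<close>

lemma substitution_path_comp:
  assumes p: "p \<in> paths Q" and q: "q \<in> paths Q" and pq: "tgt p = fst q"
    and x: "x \<in> paths Q" "parallel Q (arr a) x"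
  shows "(substitution (path_comp q p) (arr a, x) :: _ \<Rightarrow>\<^sub>0 'k::field)
    = mult (substitution q (arr a, x)) (basis p) + mult (basis q) (substitution p (arr a, x))"
proof -
  define S :: "('v, 'a) qpath \<Rightarrow> nat \<Rightarrow> ('v, 'a) qpath \<Rightarrow>\<^sub>0 'k" where
    "S r i = (if arr (snd r ! i) = arr a \<and> replace_at r i x \<in> \<B> then basis (replace_at r i x) else 0)"
    for r i
  let ?c = "path_comp q p" and ?n = "length (snd p)" and ?m = "length (snd q)"
  have split: "(\<Sum>i<n + m. g i) = (\<Sum>i<n. g i) + (\<Sum>j<m. g (n + j))"
    for n m and g :: "nat \<Rightarrow> ('v, 'a) qpath \<Rightarrow>\<^sub>0 'k"
    by (induction m) (simp_all add: add.assoc)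
  have "substitution ?c (arr a, x) = (\<Sum>i<?n + ?m. S ?c i)"
    by (simp add: substitution_alt S_def path_comp_def)
  also have "\<dots> = (\<Sum>i<?n. S ?c i) + (\<Sum>j<?m. S ?c (?n + j))"
    by (rule split)
  also have "(\<Sum>i<?n. S ?c i) = (\<Sum>i<?n. mult (basis q) (S p i))"
  proof (rule sum.cong)
    fix i assume "i \<in> {..<?n}"
    then have i: "i < ?n" by simp
    have nth: "snd ?c ! i = snd p ! i" using i by (simp add: path_comp_def nth_append)
    show "S ?c i = mult (basis q) (S p i)"
    proof (cases "arr (snd p ! i) = arr a")
      case True
      then have "parallel Q (arr (snd p ! i)) x" using x by simp
      note r = replace_at_path[OF p i x(1) this]
      then show ?thesis
        using nonzero_path_comp[OF r(1) q] pq
        by (auto simp: S_def nth replace_at_path_comp[OF i] mult_basis klinear_0[OF klinear_mult_right])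
    qed (simp add: S_def nth klinear_0[OF klinear_mult_right])
  qed simp
  also have "(\<Sum>j<?m. S ?c (?n + j)) = (\<Sum>j<?m. mult (S q j) (basis p))"
  proof (rule sum.cong)
    fix j assume "j \<in> {..<?m}"
    then have j: "j < ?m" by simp
    have nth: "snd ?c ! (?n + j) = snd q ! j" by (simp add: path_comp_def nth_append)
    show "S ?c (?n + j) = mult (S q j) (basis p)"
    proof (cases "arr (snd q ! j) = arr a")
      case True
      then have "parallel Q (arr (snd q ! j)) x" using x by simp
      note r = replace_at_path[OF q j x(1) this]
      have "fst (replace_at q j x) = fst q" by (simp add: replace_at_def)
      then show ?thesis
        using nonzero_path_comp[OF p r(1)] pq
        by (auto simp: S_def nth replace_at_path_comp' mult_basis klinear_0[OF klinear_mult_left])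
    qed (simp add: S_def nth klinear_0[OF klinear_mult_left])
  qed simp
  also have "(\<Sum>i<?n. mult (basis q) (S p i)) = mult (basis q) (substitution p (arr a, x))"
    by (simp add: substitution_alt S_def klinear_sum[OF klinear_mult_right])
  also have "(\<Sum>j<?m. mult (S q j) (basis p)) = mult (substitution q (arr a, x)) (basis p)"
    by (simp add: substitution_alt S_def klinear_sum[OF klinear_mult_left])
  finally show ?thesis by (simp add: add.commute)
qed

text \<open>The left side evaluates the untruncated composite, which may be a zero path, and in this
  form the Leibniz rule holds for every 1-cochain. The cocycle condition enters when the composite
  is replaced by the truncated product, in \<open>derivation_mult\<close>.\<close>

lemma derivation_path_comp:
  assumes f: "f \<in> cochains1 Q Z" and p: "p \<in> paths Q" and q: "q \<in> paths Q" and pq: "tgt p = fst q"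
  shows "derivation f (basis (path_comp q p))
    = mult (derivation f (basis q)) (basis p) + mult (basis q) (derivation f (basis p))"
proof (rule klinear_eq_on_keys[where f = f])
  fix x assume "x \<in> Poly_Mapping.keys f"
  then obtain a y where "x = (arr a, y)" "y \<in> \<B>" "parallel Q (arr a) y"
    using cochain_key[OF f] by metis
  then show "derivation (basis x) (basis (path_comp q p))
    = mult (derivation (basis x) (basis q)) (basis p) + mult (basis q) (derivation (basis x) (basis p))"
    by (simp add: derivation_basis substitution_path_comp[OF p q pq] nonzero_in_paths)
qed (intro klinear_intros)+

lemma derivation_vertex: "derivation f (basis (v, [])) = 0"
  by (rule klinear_eq_on_keys[OF klinear_derivation_left klinear_zero])
    (auto simp: derivation_basis substitution_alt)

lemma derivation_arrow:
  assumes f: "f \<in> cochains1 Q Z"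
  shows "derivation f (basis (arr b)) = component (arr b) f"
proof (rule klinear_eq_on_keys[OF klinear_derivation_left klinear_component])
  fix x assume "x \<in> Poly_Mapping.keys f"
  then obtain a y where "x = (arr a, y)" "y \<in> \<B>" "parallel Q (arr a) y"
    using cochain_key[OF f] by metis
  moreover from this have "replace_at (arr b) 0 y = y" if "arr a = arr b"
    using that by (cases y) (auto simp: replace_at_def parallel_def arrow_path_def)
  ultimately show "derivation (basis x) (basis (arr b)) = component (arr b) (basis x)"
    by (auto simp: derivation_basis substitution_alt component_basis arrow_path_def)
qed

text \<open>The corner e_t A e_s of the algebra, where s and t are the ends of \<open>p\<close>.
  Derivations that vanish on the vertices preserve it.\<close>

definition parallel_span :: "('v, 'a) qpath \<Rightarrow> (('v, 'a) qpath \<Rightarrow>\<^sub>0 'k::field) set" where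
  "parallel_span p = {g. Poly_Mapping.keys g \<subseteq> {q \<in> \<B>. parallel Q p q}}"

lemma subspace_parallel_span: "cochain.subspace (parallel_span p)"
  unfolding parallel_span_def by (rule subspace_keys)

lemma basis_in_parallel_span: "q \<in> \<B> \<Longrightarrow> parallel Q p q \<Longrightarrow> basis q \<in> parallel_span p"
  by (simp add: parallel_span_def)

lemma derivation_in_parallel_span:
  assumes f: "f \<in> cochains1 Q Z" and p: "p \<in> paths Q" and g: "g \<in> parallel_span p"
  shows "derivation f g \<in> parallel_span p" "derivation f (basis p) \<in> parallel_span p"
proof -
  have *: "derivation f (basis q) \<in> parallel_span p" if q: "q \<in> paths Q" "parallel Q p q" for q
  proof (rule klinear_in_subspace[OF klinear_derivation_left subspace_parallel_span])
    fix x assume "x \<in> Poly_Mapping.keys f"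
    then obtain a y where y: "x = (arr a, y)" "y \<in> \<B>" "parallel Q (arr a) y"
      using cochain_key[OF f] by metis
    have "parallel Q p (replace_at q i y)" if "i < length (snd q)" "arr (snd q ! i) = arr a" for i
      using replace_at_path[OF q(1) that(1), of y] y that q nonzero_in_paths
      by (auto simp: parallel_def replace_at_def)
    then show "derivation (basis x) (basis q) \<in> parallel_span p"
      by (auto simp: y derivation_basis substitution_def subspace_parallel_span
          intro!: cochain.subspace_sum basis_in_parallel_span)
  qed
  show "derivation f (basis p) \<in> parallel_span p"
    using * p by (simp add: parallel_def)
  show "derivation f g \<in> parallel_span p"
  proof (rule klinear_in_subspace[OF klinear_derivation subspace_parallel_span])
    fix q assume "q \<in> Poly_Mapping.keys g"
    then have "q \<in> \<B>" "parallel Q p q" using g by (auto simp: parallel_span_def)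
    then show "derivation f (basis q) \<in> parallel_span p" using * nonzero_in_paths by blast
  qed
qed

text \<open>Used as a dummy for \<open>g\<close> when only the claim about \<open>basis p\<close> in
  \<open>derivation_in_parallel_span\<close> is wanted.\<close>

lemma parallel_span_0: "0 \<in> parallel_span p"
  by (simp add: parallel_span_def)

lemma cochains1_iff:
  "f \<in> cochains1 Q Z \<longleftrightarrow> (\<forall>c. component c f \<in> (if c \<in> arr ` arcs Q then parallel_span c else {0}))"
proof -
  have zero: "component c f = 0 \<longleftrightarrow> (\<forall>q. (c, q) \<notin> Poly_Mapping.keys f)" for c
    unfolding keys_component[symmetric] keys_eq_empty[symmetric] by blast
  have "f \<in> cochains1 Q Z \<longleftrightarrow> (\<forall>c q. (c, q) \<in> Poly_Mapping.keys f
    \<longrightarrow> c \<in> arr ` arcs Q \<and> q \<in> \<B> \<and> parallel Q c q)"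
    unfolding cochains1_def cochains_def by blast
  also have "\<dots> \<longleftrightarrow>
    (\<forall>c. if c \<in> arr ` arcs Q then component c f \<in> parallel_span c else component c f = 0)"
    unfolding zero parallel_span_def subset_iff mem_Collect_eq keys_component by meson
  finally show ?thesis by (metis singleton_iff)
qed

text \<open>The entry of \<open>delta1 f\<close> at a relation is the value of the derivation there,
  so the cocycle condition says that the derivation kills the generators of the ideal.\<close>

lemma delta1_component:
  "component r (delta1 Q Z f) = (if r \<in> Z then derivation f (basis r) else 0)"
proof -
  have *: "subst_sum Q Z s s x = tag s (derivation (basis x) (basis s))" for s x
    by (cases x) (simp add: derivation_basis subst_sum_def substitution_def klinear_sum[OF klinear_tag]
        tag_basis)
  have L: "klinear (\<lambda>f. if r \<in> Z then derivation f (basis r) else 0)"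
    by (cases "r \<in> Z") (simp_all add: klinear_derivation_left klinear_zero)
  have R: "klinear (\<lambda>f. component r (delta1 Q Z f))"
    unfolding delta1_def by (rule klinear_comp[OF klinear_component klinear_linear_extension])
  show ?thesis
  proof (rule klinear_eq_on_keys[OF R L])
    show "component r (delta1 Q Z (basis x)) = (if r \<in> Z then derivation (basis x) (basis r) else 0)"
      for x :: "('v, 'a) qpath \<times> ('v, 'a) qpath"
      by (simp add: delta1_def * klinear_sum[OF klinear_component] component_tag relations_finite)
  qed
qed

lemma cocycle_iff:
  "f \<in> ker_delta1 Q Z \<longleftrightarrow> f \<in> cochains1 Q Z \<and> (\<forall>r\<in>Z. derivation f (basis r) = 0)"
proof -
  have "delta1 Q Z f = 0 \<longleftrightarrow> (\<forall>r. component r (delta1 Q Z f) = 0)"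
    using component_eqI[of "delta1 Q Z f" 0] by (auto simp: klinear_0[OF klinear_component])
  then show ?thesis by (auto simp: ker_delta1_def delta1_component)
qed

section \<open>Cocycles as derivations of the truncated algebra\<close>

lemma mult_zero_path:
  assumes s: "s \<in> paths Q" "s \<notin> \<B>" and x: "Poly_Mapping.keys x \<subseteq> paths Q"
  shows "mult x (basis s) = 0" "mult (basis s) x = 0"
proof -
  have *: "mult (basis q) (basis s) = 0 \<and> mult (basis s) (basis q) = 0" if "q \<in> paths Q" for q
    using nonzero_path_comp[OF s(1) that] nonzero_path_comp[OF that s(1)] s(2)
    by (auto simp: mult_basis)
  show "mult x (basis s) = 0" "mult (basis s) x = 0"
    using klinear_eq_on_keys[OF klinear_mult_left klinear_zero, of x]
      klinear_eq_on_keys[OF klinear_mult_right klinear_zero, of x] * x by blast+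
qed

lemma parallel_span_paths: "x \<in> parallel_span p \<Longrightarrow> Poly_Mapping.keys x \<subseteq> paths Q"
  using nonzero_in_paths by (auto simp: parallel_span_def)

text \<open>A zero path factors as w r u with r a relation. After applying the Leibniz rule twice,
  the value at r is 0 and every other term still has the zero path r or r u as a factor.\<close>

lemma cocycle_kills_zero_paths:
  assumes f: "f \<in> ker_delta1 Q Z" and p: "p \<in> paths Q" "p \<notin> \<B>"
  shows "derivation f (basis p) = 0"
proof -
  have f1: "f \<in> cochains1 Q Z" using f by (simp add: ker_delta1_def)
  obtain r u w where r: "r \<in> Z" and uw: "u \<in> paths Q" "w \<in> paths Q" "tgt u = fst r"
    "tgt r = fst w" "p = path_comp w (path_comp r u)"
    using zero_path_factor[OF p] by blast
  have rp: "r \<in> paths Q" and rz: "r \<notin> \<B>" using r relations_in_paths relation_zero by auto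
  let ?s = "path_comp r u"
  have s: "?s \<in> paths Q" "tgt ?s = fst w"
    using uw rp by (simp_all add: path_comp_iff target_path_comp)
  have sz: "?s \<notin> \<B>" using nonzero_path_comp rp uw rz by blast
  note keys = parallel_span_paths[OF derivation_in_parallel_span(2)[OF f1 _ parallel_span_0]]
  have "derivation f (basis ?s) = 0"
    using derivation_path_comp[OF f1 uw(1) rp uw(3)] mult_zero_path(2)[OF rp rz keys[OF uw(1)]] f r
    by (simp add: cocycle_iff klinear_0[OF klinear_mult_left])
  then show ?thesis
    using derivation_path_comp[OF f1 s(1) uw(2) s(2)] mult_zero_path(1)[OF s(1) sz keys[OF uw(2)]] uw
    by (simp add: klinear_0[OF klinear_mult_right])
qed

text \<open>If two paths compose but their product is truncated, the derivation vanishes on the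
  composite anyway. If they do not compose, both products on the right vanish, because values of a
  derivation keep the ends of their argument.\<close>

lemma derivation_mult:
  assumes f: "f \<in> ker_delta1 Q Z"
    and x: "Poly_Mapping.keys x \<subseteq> paths Q" and y: "Poly_Mapping.keys y \<subseteq> paths Q"
  shows "derivation f (mult x y) = mult (derivation f x) y + mult x (derivation f y)"
proof (rule bilinear_eq_on_keys[where f = x and g = y])
  have f1: "f \<in> cochains1 Q Z" using f by (simp add: ker_delta1_def)
  fix q p assume "q \<in> Poly_Mapping.keys x" "p \<in> Poly_Mapping.keys y"
  then have qp: "q \<in> paths Q" "p \<in> paths Q" using x y by auto
  show "derivation f (mult (basis q) (basis p))
    = mult (derivation f (basis q)) (basis p) + mult (basis q) (derivation f (basis p))"
  proof (cases "tgt p = fst q")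
    case True
    then have "path_comp q p \<in> paths Q" using qp by (simp add: path_comp_iff)
    then have "derivation f (mult (basis q) (basis p)) = derivation f (basis (path_comp q p))"
      using True cocycle_kills_zero_paths[OF f]
      by (auto simp: mult_basis klinear_0[OF klinear_derivation])
    then show ?thesis using derivation_path_comp[OF f1 qp(2,1) True] by simp
  next
    case False
    note span = derivation_in_parallel_span(2)[OF f1 _ parallel_span_0]
    have "mult (derivation f (basis q)) (basis p) = 0"
      by (rule klinear_eq_on_keys[OF klinear_mult_left klinear_zero])
        (use False span[OF qp(1)] in \<open>auto simp: mult_basis parallel_span_def parallel_def subset_iff\<close>)
    moreover have "mult (basis q) (derivation f (basis p)) = 0"
      by (rule klinear_eq_on_keys[OF klinear_mult_right klinear_zero])
        (use False span[OF qp(2)] in \<open>auto simp: mult_basis parallel_span_def parallel_def subset_iff\<close>)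
    ultimately show ?thesis
      using False by (simp add: mult_basis klinear_0[OF klinear_derivation])
  qed
qed (intro klinear_intros)+

text \<open>Induction on the length, splitting off the first arrow. \<open>D\<close> and
  \<open>E\<close> are arbitrary functions, so that commutators and inner derivations can be
  inserted without first writing them as \<open>derivation f\<close>.\<close>

lemma derivations_agree:
  assumes p: "p \<in> paths Q"
    and vertex: "\<And>v. v \<in> verts Q \<Longrightarrow> D (basis (v, [])) = E (basis (v, []))"
    and arrow: "\<And>a. a \<in> arcs Q \<Longrightarrow> D (basis (arr a)) = E (basis (arr a))"
    and D: "\<And>p q. p \<in> paths Q \<Longrightarrow> q \<in> paths Q \<Longrightarrow> tgt p = fst q
      \<Longrightarrow> D (basis (path_comp q p)) = mult (D (basis q)) (basis p) + mult (basis q) (D (basis p))"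
    and E: "\<And>p q. p \<in> paths Q \<Longrightarrow> q \<in> paths Q \<Longrightarrow> tgt p = fst q
      \<Longrightarrow> E (basis (path_comp q p)) = mult (E (basis q)) (basis p) + mult (basis q) (E (basis p))"
  shows "D (basis p) = E (basis p)"
proof -
  have "(u, as) \<in> paths Q \<Longrightarrow> D (basis (u, as)) = E (basis (u, as))" for u as
  proof (induction as arbitrary: u)
    case Nil
    then show ?case using vertex by (simp add: path_simps)
  next
    case (Cons a as)
    then have a: "a \<in> arcs Q" "tail Q a = u" "(head Q a, as) \<in> paths Q" by (auto simp: path_simps)
    have c: "(u, a # as) = path_comp (head Q a, as) (arr a)"
      using a by (simp add: path_comp_def arrow_path_def)
    have t: "tgt (arr a) = fst (head Q a, as)" by (simp add: target_arrow_path)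
    show ?case
      unfolding c D[OF arrow_path_in_paths[OF a(1)] a(3) t] E[OF arrow_path_in_paths[OF a(1)] a(3) t]
      using Cons.IH[OF a(3)] arrow[OF a(1)] by simp
  qed
  then show ?thesis using p by (cases p) simp
qed

section \<open>The bracket as a commutator of derivations\<close>

lemma klinear_bracket_left: "klinear (\<lambda>f. cochain_bracket Q Z f g)"
  unfolding cochain_bracket_def by (rule klinear_bilinear_left)

lemma klinear_bracket_right: "klinear (cochain_bracket Q Z f)"
  unfolding cochain_bracket_def by (rule klinear_bilinear_right)

text \<open>In terms of values on arrows the combinatorial bracket is f(g(c)) - g(f(c)), with the
  sign convention of the substitution formula.\<close>

lemma bracket_component:
  "component c (cochain_bracket Q Z f g)
    = derivation f (component c g) - derivation g (component c f)"
proof (rule bilinear_eq_on_keys[where f = f and g = g])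
  have *: "subst_sum Q Z b r x = tag b (derivation (basis x) (basis r))" for b r x
    by (cases x) (simp add: derivation_basis subst_sum_def substitution_def klinear_sum[OF klinear_tag]
        tag_basis)
  fix x y :: "('v, 'a) qpath \<times> ('v, 'a) qpath"
  show "component c (cochain_bracket Q Z (basis x) (basis y))
    = derivation (basis x) (component c (basis y)) - derivation (basis y) (component c (basis x))"
    by (cases x; cases y)
      (auto simp: cochain_bracket_def * klinear_diff[OF klinear_component] component_tag
        component_basis klinear_0[OF klinear_derivation])
qed (intro klinear_intros klinear_derivation klinear_derivation_left klinear_component
      klinear_comp[OF klinear_component klinear_bracket_left]
      klinear_comp[OF klinear_component klinear_bracket_right])+

lemma cochains1_component:
  assumes "f \<in> cochains1 Q Z"
  shows "a \<in> arcs Q \<Longrightarrow> component (arr a) f \<in> parallel_span (arr a)"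
    and "c \<notin> arr ` arcs Q \<Longrightarrow> component c f = 0"
  using assms[unfolded cochains1_iff, rule_format, of "arr a"]
    assms[unfolded cochains1_iff, rule_format, of c] by auto

lemma bracket_cochains1:
  assumes f: "f \<in> cochains1 Q Z" and g: "g \<in> cochains1 Q Z"
  shows "cochain_bracket Q Z f g \<in> cochains1 Q Z"
  unfolding cochains1_iff bracket_component
  using f g
  by (auto simp: cochains1_component klinear_0[OF klinear_derivation] arrow_path_in_paths
      intro!: cochain.subspace_diff subspace_parallel_span derivation_in_parallel_span)

text \<open>The commutator satisfies the Leibniz rule since the mixed terms cancel, so it is enough
  to compare on vertices and arrows. Cocycles are required because one derivation is applied to
  truncated products produced by the other.\<close>

lemma derivation_bracket:
  assumes f: "f \<in> ker_delta1 Q Z" and g: "g \<in> ker_delta1 Q Z" and x: "Poly_Mapping.keys x \<subseteq> paths Q"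
  shows "derivation (cochain_bracket Q Z f g) x
    = derivation f (derivation g x) - derivation g (derivation f x)"
proof (rule klinear_eq_on_keys[where f = x])
  have f1: "f \<in> cochains1 Q Z" and g1: "g \<in> cochains1 Q Z"
    using f g by (simp_all add: ker_delta1_def)
  note b1 = bracket_cochains1[OF f1 g1]
  fix p assume "p \<in> Poly_Mapping.keys x"
  then have "p \<in> paths Q" using x by blast
  then show "derivation (cochain_bracket Q Z f g) (basis p)
    = derivation f (derivation g (basis p)) - derivation g (derivation f (basis p))"
  proof (rule derivations_agree)
    fix p q assume pq: "p \<in> paths Q" "q \<in> paths Q" "tgt p = fst q"
    note keys_f = parallel_span_paths[OF derivation_in_parallel_span(2)[OF f1 _ parallel_span_0]]
    note keys_g = parallel_span_paths[OF derivation_in_parallel_span(2)[OF g1 _ parallel_span_0]]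
    show "derivation f (derivation g (basis (path_comp q p)))
        - derivation g (derivation f (basis (path_comp q p)))
      = mult (derivation f (derivation g (basis q)) - derivation g (derivation f (basis q))) (basis p)
        + mult (basis q) (derivation f (derivation g (basis p)) - derivation g (derivation f (basis p)))"
      using pq keys_f keys_g
      by (simp add: derivation_path_comp[OF f1 pq] derivation_path_comp[OF g1 pq]
          klinear_add[OF klinear_derivation] derivation_mult[OF f] derivation_mult[OF g]
          klinear_diff[OF klinear_mult_left] klinear_diff[OF klinear_mult_right])
  qed (simp_all add: derivation_vertex klinear_0[OF klinear_derivation] derivation_arrow[OF b1]
      derivation_arrow[OF f1] derivation_arrow[OF g1] bracket_component derivation_path_comp[OF b1])
qed (intro klinear_intros klinear_derivation)+

lemma bracket_cocycle:
  assumes f: "f \<in> ker_delta1 Q Z" and g: "g \<in> ker_delta1 Q Z"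
  shows "cochain_bracket Q Z f g \<in> ker_delta1 Q Z"
proof -
  have "derivation (cochain_bracket Q Z f g) (basis r) = 0" if "r \<in> Z" for r
    using derivation_bracket[OF f g, of "basis r"] that f g relations_in_paths
    by (auto simp: cocycle_iff klinear_0[OF klinear_derivation])
  then show ?thesis
    using bracket_cochains1 f g by (auto simp: cocycle_iff)
qed

lemma subspace_cochains1: "cochain.subspace (cochains1 Q Z)"
  unfolding cochains1_def cochains_def by (rule subspace_keys)

lemma klinear_delta1: "klinear (delta1 Q Z)"
  unfolding delta1_def by (rule klinear_linear_extension)

lemma subspace_ker_delta1: "cochain.subspace (ker_delta1 Q Z)"
  unfolding ker_delta1_def
  by (rule cochain.subspaceI)
    (simp_all add: klinear_0[OF klinear_delta1] klinear_add[OF klinear_delta1]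
      klinear_scale[OF klinear_delta1] cochain.subspace_0[OF subspace_cochains1]
      cochain.subspace_add[OF subspace_cochains1] cochain.subspace_scale[OF subspace_cochains1])

lemma component_cocycle_paths:
  assumes "f \<in> ker_delta1 Q Z"
  shows "Poly_Mapping.keys (component c f) \<subseteq> paths Q"
proof -
  have f: "f \<in> cochains1 Q Z" using assms by (simp add: ker_delta1_def)
  then show ?thesis
    using cochains1_component[OF f] parallel_span_paths by (cases "c \<in> arr ` arcs Q") fastforce+
qed

text \<open>Evaluated at \<open>c\<close>, each double bracket yields four iterated derivations; the
  resulting twelve terms cancel in pairs.\<close>

lemma bracket_jacobi:
  assumes f: "f \<in> ker_delta1 Q Z" and g: "g \<in> ker_delta1 Q Z" and h: "h \<in> ker_delta1 Q Z"
  shows "cochain_bracket Q Z f (cochain_bracket Q Z g h)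
    + (cochain_bracket Q Z g (cochain_bracket Q Z h f) + cochain_bracket Q Z h (cochain_bracket Q Z f g)) = 0"
proof (rule component_eqI)
  fix c
  show "component c (cochain_bracket Q Z f (cochain_bracket Q Z g h)
    + (cochain_bracket Q Z g (cochain_bracket Q Z h f) + cochain_bracket Q Z h (cochain_bracket Q Z f g)))
    = component c 0"
    using f g h component_cocycle_paths[OF f, of c] component_cocycle_paths[OF g, of c]
      component_cocycle_paths[OF h, of c]
    by (simp add: klinear_add[OF klinear_component] klinear_0[OF klinear_component] bracket_component
        derivation_bracket klinear_diff[OF klinear_derivation])
qed

lemma lie_algebra_cocycles: "lie_algebra (cocycle_lie Q Z :: (('v, 'a, 'k::field) cochain, 'k) lie)"
proof -
  note s = subspace_ker_delta1
  have "\<exists>y\<in>ker_delta1 Q Z. x + y = 0" if "x \<in> ker_delta1 Q Z" for x :: "('v, 'a, 'k) cochain"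
    using cochain.subspace_neg[OF s that] by (intro bexI[of _ "- x"]) auto
  moreover have "cochain_bracket Q Z x x = 0" for x :: "('v, 'a, 'k) cochain"
    by (rule component_eqI) (simp add: bracket_component klinear_0[OF klinear_component])
  ultimately show ?thesis
    by unfold_locales
      (simp_all add: cocycle_lie_def cochain.subspace_0[OF s] cochain.subspace_add[OF s]
        cochain.subspace_scale[OF s] bracket_cocycle bracket_jacobi cochain.scale_right_distrib
        cochain.scale_left_distrib add.assoc add.commute
        klinear_add[OF klinear_bracket_left] klinear_add[OF klinear_bracket_right]
        klinear_scale[OF klinear_bracket_left] klinear_scale[OF klinear_bracket_right])
qed

section \<open>Inner derivations\<close>

text \<open>Turns a 0-cochain into an algebra element; the dropped vertex is the start of the closed
  path \<open>p\<close>.\<close>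

definition forget :: "('v, 'a, 'k::field) cochain \<Rightarrow> (('v, 'a) qpath \<Rightarrow>\<^sub>0 'k)" where
  "forget = linear_extension (\<lambda>(e, p). basis p)"

lemma klinear_forget: "klinear forget"
  unfolding forget_def by (rule klinear_linear_extension)

lemma klinear_delta0: "klinear (delta0 Q Z)"
  unfolding delta0_def by (rule klinear_linear_extension)

lemma cochain0_key:
  assumes "x \<in> cochains0 Q Z" "k \<in> Poly_Mapping.keys x"
  obtains v p where "k = (vertex_path v, p)" "v \<in> verts Q" "p \<in> \<B>" "fst p = v" "tgt p = v"
proof -
  obtain e p where k: "k = (e, p)" by (cases k)
  with assms have e: "e \<in> vertex_path ` verts Q" "p \<in> \<B>" "parallel Q e p"
    unfolding cochains0_def cochains_def by blast+
  then obtain v where v: "e = vertex_path v" "v \<in> verts Q" by blast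
  then have "fst p = v" "tgt p = v"
    using e(3) by (auto simp: vertex_path_def parallel_def target_Nil)
  with k v e(2) show thesis using that by blast
qed

lemma arr_eq_iff [simp]: "arr a = arr b \<longleftrightarrow> a = b"
  by (auto simp: arrow_path_def)

lemma fst_arr: "fst (arr a) = tail Q a"
  by (simp add: arrow_path_def)

lemma component_sum_basis:
  assumes "finite S"
  shows "component (arr a) (\<Sum>b\<in>S. basis (arr b, F b)) = (if a \<in> S then basis (F a) else 0)"
  using assms by (simp add: klinear_sum[OF klinear_component] component_basis)

lemma component_sum_basis':
  assumes "c \<notin> arr ` S"
  shows "component c (\<Sum>b\<in>S. basis (arr b, F b)) = 0"
  using assms by (auto simp: klinear_sum[OF klinear_component] component_basis intro!: sum.neutral)

text \<open>At an arrow a the coboundary of x takes the value a x - x a, which fixes the sign of the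
  inner derivation belonging to x.\<close>

lemma delta0_component:
  assumes x: "x \<in> cochains0 Q Z"
  shows "a \<in> arcs Q \<Longrightarrow> component (arr a) (delta0 Q Z x)
      = mult (basis (arr a)) (forget x) - mult (forget x) (basis (arr a))"
    and "c \<notin> arr ` arcs Q \<Longrightarrow> component c (delta0 Q Z x) = 0"
proof -
  have fin: "finite {a. a \<in> arcs Q \<and> P a}" for P using arcs_finite by simp
  have expand: "delta0 Q Z (basis (vertex_path v, p)) =
      (\<Sum>a | a \<in> arcs Q \<and> tail Q a = v \<and> path_comp (arr a) p \<in> \<B>. basis (arr a, path_comp (arr a) p))
    - (\<Sum>a | a \<in> arcs Q \<and> head Q a = v \<and> path_comp p (arr a) \<in> \<B>. basis (arr a, path_comp p (arr a)))"
    for v p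
    by (simp add: delta0_def vertex_path_def)
  show "component (arr a) (delta0 Q Z x)
      = mult (basis (arr a)) (forget x) - mult (forget x) (basis (arr a))" if a: "a \<in> arcs Q"
  proof (rule klinear_eq_on_keys[where f = x])
    fix k assume "k \<in> Poly_Mapping.keys x"
    then obtain v p where k: "k = (vertex_path v, p)" "fst p = v" "tgt p = v"
      using cochain0_key[OF x] by metis
    show "component (arr a) (delta0 Q Z (basis k))
      = mult (basis (arr a)) (forget (basis k)) - mult (forget (basis k)) (basis (arr a))"
      unfolding k(1) expand klinear_diff[OF klinear_component] component_sum_basis[OF fin]
      using k(2,3) a
      by (simp add: forget_def mult_basis target_arrow_path fst_arr)
  qed (intro klinear_intros klinear_delta0 klinear_forget)+
  show "component c (delta0 Q Z x) = 0" if c: "c \<notin> arr ` arcs Q"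
  proof (rule klinear_eq_on_keys[OF klinear_comp[OF klinear_component klinear_delta0] klinear_zero])
    fix k assume "k \<in> Poly_Mapping.keys x"
    then obtain v p where k: "k = (vertex_path v, p)"
      using cochain0_key[OF x] by metis
    show "component c (delta0 Q Z (basis k)) = 0"
      unfolding k expand klinear_diff[OF klinear_component]
      using c by (subst (1 2) component_sum_basis') auto
  qed
qed

lemma forget_basis: "forget (basis (e, p)) = basis p"
  by (simp add: forget_def)

text \<open>Associativity on paths, also with one of the products replaced by untruncated
  concatenation. All forms rest on the fact that a nonzero triple composite has nonzero partial
  composites.\<close>

lemma mult_path_comp:
  assumes "p \<in> paths Q" "q \<in> paths Q" "r \<in> paths Q"
  shows "tgt q = fst r \<Longrightarrow> mult (basis (path_comp r q)) (basis p)
      = (mult (basis r) (mult (basis q) (basis p)) :: _ \<Rightarrow>\<^sub>0 'k::field)"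
    and "tgt p = fst q \<Longrightarrow> mult (basis r) (basis (path_comp q p))
      = (mult (mult (basis r) (basis q)) (basis p) :: _ \<Rightarrow>\<^sub>0 'k::field)"
    and "mult (mult (basis r) (basis q)) (basis p)
      = (mult (basis r) (mult (basis q) (basis p)) :: _ \<Rightarrow>\<^sub>0 'k::field)"
proof -
  have comp: "path_comp (path_comp r q) p = path_comp r (path_comp q p)"
    by (simp add: path_comp_def)
  have fst: "fst (path_comp q p) = fst p" for q p :: "('v, 'a) qpath"
    by (simp add: path_comp_def)
  have *: "path_comp q p \<in> \<B>" if "tgt p = fst q" "tgt q = fst r" "path_comp r (path_comp q p) \<in> \<B>"
    using nonzero_path_comp(1)[of "path_comp q p" r] assms that
    by (simp add: path_comp_iff target_path_comp)
  have **: "path_comp r q \<in> \<B>"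
    if "tgt p = fst q" "tgt q = fst r" "path_comp r (path_comp q p) \<in> \<B>"
    using nonzero_path_comp(2)[of p "path_comp r q"] assms that
    by (simp add: path_comp_iff fst comp)
  note simps = mult_basis klinear_0[OF klinear_mult_left] klinear_0[OF klinear_mult_right]
    comp fst target_path_comp
  show "mult (basis (path_comp r q)) (basis p)
      = (mult (basis r) (mult (basis q) (basis p)) :: _ \<Rightarrow>\<^sub>0 'k)" if "tgt q = fst r"
    using that * by (auto simp: simps)
  show "mult (basis r) (basis (path_comp q p))
      = (mult (mult (basis r) (basis q)) (basis p) :: _ \<Rightarrow>\<^sub>0 'k)" if "tgt p = fst q"
    using that ** by (auto simp: simps)
  show "mult (mult (basis r) (basis q)) (basis p)
      = (mult (basis r) (mult (basis q) (basis p)) :: _ \<Rightarrow>\<^sub>0 'k)"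
    using * ** by (auto simp: simps)
qed

lemma delta0_cochains1:
  assumes x: "x \<in> cochains0 Q Z"
  shows "delta0 Q Z x \<in> cochains1 Q Z"
  unfolding cochains1_iff
proof
  fix c
  show "component c (delta0 Q Z x) \<in> (if c \<in> arr ` arcs Q then parallel_span c else {0})"
  proof (cases "c \<in> arr ` arcs Q")
    case True
    then obtain a where a: "a \<in> arcs Q" "c = arr a" by blast
    have "component (arr a) (delta0 Q Z x) \<in> parallel_span (arr a)"
      unfolding delta0_component(1)[OF x a(1)]
    proof (rule cochain.subspace_diff[OF subspace_parallel_span])
      have *: "mult (basis (arr a)) (forget (basis k)) \<in> parallel_span (arr a)
        \<and> mult (forget (basis k)) (basis (arr a)) \<in> parallel_span (arr a)"
        if "k \<in> Poly_Mapping.keys x" for k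
      proof -
        obtain v p where "k = (vertex_path v, p)" "fst p = v" "tgt p = v"
          using cochain0_key[OF x \<open>k \<in> _\<close>] by metis
        then show ?thesis
          by (auto simp: forget_basis mult_basis target_path_comp parallel_def fst_arr target_arrow_path
              path_comp_def[THEN arg_cong[of _ _ fst]] parallel_span_0 intro!: basis_in_parallel_span)
      qed
      show "mult (basis (arr a)) (forget x) \<in> parallel_span (arr a)"
        by (rule klinear_in_subspace[OF klinear_comp[OF klinear_mult_right klinear_forget]
              subspace_parallel_span]) (use * in blast)
      show "mult (forget x) (basis (arr a)) \<in> parallel_span (arr a)"
        by (rule klinear_in_subspace[OF klinear_comp[OF klinear_mult_left klinear_forget]
              subspace_parallel_span]) (use * in blast)
    qed
    then show ?thesis using a by simp
  qed (simp add: delta0_component(2)[OF x])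
qed

text \<open>By associativity y x - x y satisfies the Leibniz rule in y, so the values on vertices
  and arrows decide. On a vertex both products agree, because x consists of closed paths.\<close>

lemma derivation_delta0:
  assumes x: "x \<in> cochains0 Q Z" and y: "Poly_Mapping.keys y \<subseteq> paths Q"
  shows "derivation (delta0 Q Z x) y = mult y (forget x) - mult (forget x) y"
proof (rule bilinear_eq_on_keys[where f = x and g = y])
  fix k q assume k: "k \<in> Poly_Mapping.keys x" and q: "q \<in> Poly_Mapping.keys y"
  obtain v p where p: "k = (vertex_path v, p)" "p \<in> \<B>" "fst p = v" "tgt p = v"
    using cochain0_key[OF x k] by metis
  have pp: "p \<in> paths Q" using p nonzero_in_paths by blast
  have kx: "basis k \<in> cochains0 Q Z"
    using k x by (auto simp: cochains0_def cochains_def)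
  note d1 = delta0_cochains1[OF kx]
  have f: "forget (basis k) = basis p" by (simp add: forget_basis p)
  have "q \<in> paths Q" using q y by blast
  then show "derivation (delta0 Q Z (basis k)) (basis q)
    = mult (basis q) (forget (basis k)) - mult (forget (basis k)) (basis q)"
  proof (rule derivations_agree)
    fix w
    have "path_comp (w, []) p = p" if "tgt p = w" using that by (simp add: path_comp_def)
    moreover have "path_comp p (w, []) = p" if "w = fst p"
      using that by (simp add: path_comp_def)
    ultimately show "derivation (delta0 Q Z (basis k)) (basis (w, []))
      = mult (basis (w, [])) (forget (basis k)) - mult (forget (basis k)) (basis (w, []))"
      unfolding f using p(3,4) by (auto simp: derivation_vertex mult_basis target_Nil)
  next
    fix a assume a: "a \<in> arcs Q"
    show "derivation (delta0 Q Z (basis k)) (basis (arr a))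
      = mult (basis (arr a)) (forget (basis k)) - mult (forget (basis k)) (basis (arr a))"
      by (simp add: derivation_arrow[OF d1] delta0_component(1)[OF kx a])
  next
    fix s r assume sr: "s \<in> paths Q" "r \<in> paths Q" "tgt s = fst r"
    then show "derivation (delta0 Q Z (basis k)) (basis (path_comp r s))
      = mult (derivation (delta0 Q Z (basis k)) (basis r)) (basis s)
        + mult (basis r) (derivation (delta0 Q Z (basis k)) (basis s))"
      by (rule derivation_path_comp[OF d1])
    show "mult (basis (path_comp r s)) (forget (basis k)) - mult (forget (basis k)) (basis (path_comp r s))
      = mult (mult (basis r) (forget (basis k)) - mult (forget (basis k)) (basis r)) (basis s)
        + mult (basis r) (mult (basis s) (forget (basis k)) - mult (forget (basis k)) (basis s))"
      by (simp add: f mult_path_comp(1)[OF pp sr] mult_path_comp(2)[OF sr(1,2) pp sr(3)]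
          mult_path_comp(3)[OF sr(1) pp sr(2)] klinear_diff[OF klinear_mult_left] klinear_diff[OF klinear_mult_right]
          algebra_simps)
  qed
qed (intro klinear_intros klinear_derivation klinear_delta0 klinear_forget)+

lemma forget_paths:
  assumes x: "x \<in> cochains0 Q Z"
  shows "Poly_Mapping.keys (forget x) \<subseteq> paths Q"
proof -
  have "forget x \<in> {g. Poly_Mapping.keys g \<subseteq> paths Q}"
  proof (rule klinear_in_subspace[OF klinear_forget subspace_keys])
    fix k assume "k \<in> Poly_Mapping.keys x"
    then obtain v p where "k = (vertex_path v, p)" "p \<in> \<B>"
      using cochain0_key[OF x] by metis
    then show "forget (basis k) \<in> {g. Poly_Mapping.keys g \<subseteq> paths Q}"
      using nonzero_in_paths by (auto simp: forget_basis)
  qed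
  then show ?thesis by simp
qed

text \<open>An inner derivation kills a relation, since a zero path times anything is 0 on either
  side.\<close>

lemma delta0_cocycle:
  assumes x: "x \<in> cochains0 Q Z"
  shows "delta0 Q Z x \<in> ker_delta1 Q Z"
proof -
  have "derivation (delta0 Q Z x) (basis r) = 0" if r: "r \<in> Z" for r
  proof -
    have "r \<in> paths Q" "r \<notin> \<B>" using r relations_in_paths relation_zero by auto
    then show ?thesis
      using derivation_delta0[OF x, of "basis r"] mult_zero_path[of r "forget x"] forget_paths[OF x] by simp
  qed
  then show ?thesis using delta0_cochains1[OF x] by (simp add: cocycle_iff)
qed

lemma im_delta0_cocycle: "g \<in> im_delta0 Q Z \<Longrightarrow> g \<in> ker_delta1 Q Z"
  unfolding im_delta0_def using delta0_cocycle by blast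

lemma subspace_im_delta0: "cochain.subspace (im_delta0 Q Z)"
  unfolding im_delta0_def cochains0_def cochains_def
  by (rule klinear_image_subspace[OF klinear_delta0 subspace_keys])

text \<open>The commutator of a derivation f with the inner derivation of x is the inner derivation
  of f(x).\<close>

lemma bracket_delta0:
  fixes f x :: "('v, 'a, 'k::field) cochain"
  assumes f: "f \<in> ker_delta1 Q Z" and x: "x \<in> cochains0 Q Z"
  shows "cochain_bracket Q Z f (delta0 Q Z x) \<in> im_delta0 Q Z"
proof -
  have f1: "f \<in> cochains1 Q Z" using f by (simp add: ker_delta1_def)
  \<comment> \<open>\<open>T x\<close> is f(x) written as a 0-cochain: f acts on the closed path and
    the vertex label is kept, which is legitimate as f preserves ends.\<close>
  define T :: "('v, 'a, 'k) cochain \<Rightarrow> ('v, 'a, 'k) cochain" where "T = linear_extension (\<lambda>(e, p). tag e (derivation f (basis p)))"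
  have T: "klinear T" unfolding T_def by (rule klinear_linear_extension)
  have Tx: "T x \<in> cochains0 Q Z"
    unfolding cochains0_def cochains_def
  proof (rule klinear_in_subspace[OF T subspace_keys])
    fix k assume "k \<in> Poly_Mapping.keys x"
    then obtain v p where k: "k = (vertex_path v, p)" "v \<in> verts Q" "p \<in> \<B>" "fst p = v" "tgt p = v"
      using cochain0_key[OF x] by metis
    have "derivation f (basis p) \<in> parallel_span p"
      by (rule derivation_in_parallel_span(2)[OF f1 _ parallel_span_0]) (use k nonzero_in_paths in blast)
    then have *: "q \<in> \<B> \<and> parallel Q p q" if "q \<in> Poly_Mapping.keys (derivation f (basis p))" for q
      using that by (auto simp: parallel_span_def)
    have "tag (vertex_path v) (derivation f (basis p))
      \<in> {f. Poly_Mapping.keys f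
          \<subseteq> {(p, q). p \<in> vertex_path ` verts Q \<and> q \<in> \<B> \<and> parallel Q p q}}"
      by (rule klinear_in_subspace[OF klinear_tag subspace_keys])
        (use * k in \<open>auto simp: tag_basis parallel_def vertex_path_def target_Nil\<close>)
    then show "T (basis k) \<in> {f. Poly_Mapping.keys f
          \<subseteq> {(p, q). p \<in> vertex_path ` verts Q \<and> q \<in> \<B> \<and> parallel Q p q}}"
      by (simp add: T_def k)
  qed
  have forget_tag: "forget (tag e g) = g" for e :: "('v, 'a) qpath" and g :: "('v, 'a) qpath \<Rightarrow>\<^sub>0 'k"
    by (rule klinear_eq_on_keys[OF klinear_comp[OF klinear_forget klinear_tag] klinear_id])
      (simp add: tag_basis forget_basis)
  have forget_T: "forget (T x) = derivation f (forget x)"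
    by (rule klinear_eq_on_keys[OF klinear_comp[OF klinear_forget T]
          klinear_comp[OF klinear_derivation klinear_forget]])
      (auto simp: T_def forget_tag forget_basis)
  note paths = forget_paths[OF x]
  have "cochain_bracket Q Z f (delta0 Q Z x) = delta0 Q Z (T x)"
  proof (rule component_eqI)
    fix c
    show "component c (cochain_bracket Q Z f (delta0 Q Z x)) = component c (delta0 Q Z (T x))"
    proof (cases "c \<in> arr ` arcs Q")
      case True
      then obtain a where a: "a \<in> arcs Q" "c = arr a" by blast
      have keys: "Poly_Mapping.keys (basis (arr a)) \<subseteq> paths Q"
        using arrow_path_in_paths[OF a(1)] by simp
      show ?thesis
        using component_cocycle_paths[OF f, of c]
        by (simp add: a bracket_component delta0_component(1)[OF x a(1)]
            delta0_component(1)[OF Tx a(1)] klinear_diff[OF klinear_derivation]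
            derivation_mult[OF f keys paths] derivation_mult[OF f paths keys] forget_T
            derivation_arrow[OF f1] derivation_delta0[OF x])
    next
      case False
      then show ?thesis
        by (simp add: bracket_component delta0_component(2)[OF x] delta0_component(2)[OF Tx]
            cochains1_component(2)[OF f1] klinear_0[OF klinear_derivation])
    qed
  qed
  then show ?thesis using Tx by (simp add: im_delta0_def)
qed

lemma lie_ideal_im_delta0:
  "lie_ideal (cocycle_lie Q Z :: (('v, 'a, 'k::field) cochain, 'k) lie) (im_delta0 Q Z)"
proof -
  have "cochain_bracket Q Z f g \<in> im_delta0 Q Z" if "f \<in> ker_delta1 Q Z" "g \<in> im_delta0 Q Z"
    for f g :: "('v, 'a, 'k) cochain"
    using that bracket_delta0 by (auto simp: im_delta0_def[of Q Z])
  then show ?thesis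
    unfolding lie_ideal_def lie_subspace_def
    using lie_algebra_cocycles im_delta0_cocycle cochain.subspace_0[OF subspace_im_delta0]
      cochain.subspace_add[OF subspace_im_delta0] cochain.subspace_scale[OF subspace_im_delta0]
    by (auto simp: cocycle_lie_def)
qed

sublocale coboundaries: lie_ideal_quot
  "cocycle_lie Q Z :: (('v, 'a, 'k::field) cochain, 'k) lie" "im_delta0 Q Z"
  using lie_algebra_cocycles lie_ideal_im_delta0
  by (simp add: lie_ideal_quot_def lie_ideal_quot_axioms_def)

section \<open>First Hochschild cohomology as a quotient Lie algebra\<close>

lemma lie_algebra_HH1: "lie_algebra (HH1 Q Z :: ('v, 'a, 'k::field) hh1)"
  unfolding HH1_def by (rule coboundaries.lie_algebra_quot)

lemma lie_hom_HH1_class: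
  "lie_hom (cocycle_lie Q Z) (HH1 Q Z :: ('v, 'a, 'k::field) hh1) (HH1_class Q Z)"
  unfolding HH1_def HH1_class_def by (rule coboundaries.lie_hom_coset)

lemma carrier_HH1: "carrier (HH1 Q Z) = HH1_class Q Z ` ker_delta1 Q Z"
  unfolding HH1_def HH1_class_def coboundaries.carrier_quot by (simp add: cocycle_lie_def)

lemma zero_HH1: "lzero (HH1 Q Z) = HH1_class Q Z 0"
  unfolding HH1_def HH1_class_def coboundaries.zero_quot by (simp add: cocycle_lie_def)

lemma HH1_class_zero_iff:
  "f \<in> ker_delta1 Q Z \<Longrightarrow> HH1_class Q Z f = lzero (HH1 Q Z) \<longleftrightarrow> f \<in> im_delta0 Q Z"
  using coboundaries.coset_zero_iff[of f]
  by (simp add: zero_HH1 HH1_class_def cocycle_lie_def)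

lemma HH1_class_eqI:
  assumes "f \<in> ker_delta1 Q Z" "g \<in> ker_delta1 Q Z" "f - g \<in> im_delta0 Q Z"
  shows "HH1_class Q Z f = HH1_class Q Z g"
proof -
  have "f = ladd (cocycle_lie Q Z) g (f - g)" by (simp add: cocycle_lie_def)
  then show ?thesis
    unfolding HH1_class_def using coboundaries.coset_eq_iff[of f g] assms
    by (auto simp: cocycle_lie_def intro!: bexI[of _ "f - g"])
qed

end

section \<open>Gluing a source arrow and a sink arrow\<close>

locale gluing = monomial_algebra Q Z for Q :: "('v, 'a) pre_digraph" and Z :: "('v, 'a) qpath set" +
  fixes \<alpha> \<beta> :: 'a
  assumes source: "source_arrow Q \<alpha>" and sink: "sink_arrow Q \<beta>"
    and vertices_distinct: "distinct [tail Q \<alpha>, head Q \<alpha>, tail Q \<beta>, head Q \<beta>]"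
begin

text \<open>The names \<open>e3\<close> and \<open>e4\<close> stand for the vertices e_{n-1} and
  e_n.\<close>

abbreviation "e1 \<equiv> tail Q \<alpha>"
abbreviation "e2 \<equiv> head Q \<alpha>"
abbreviation "e3 \<equiv> tail Q \<beta>"
abbreviation "e4 \<equiv> head Q \<beta>"
abbreviation "sv \<equiv> star_vertex Q \<alpha> \<beta>"
abbreviation "sa \<equiv> star_arrow \<alpha> \<beta>"
abbreviation "sp \<equiv> star_path Q \<alpha> \<beta>"
abbreviation "QB \<equiv> glued_quiver Q \<alpha> \<beta>"
abbreviation "ZB \<equiv> glued_relations Q Z \<alpha> \<beta>"
abbreviation "BA \<equiv> nonzero_paths Q Z"
abbreviation "BB \<equiv> nonzero_paths QB ZB"

lemma distinct_vertices [simp]: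
  "e1 \<noteq> e2" "e1 \<noteq> e3" "e1 \<noteq> e4" "e2 \<noteq> e1" "e2 \<noteq> e3" "e2 \<noteq> e4"
  "e3 \<noteq> e1" "e3 \<noteq> e2" "e3 \<noteq> e4" "e4 \<noteq> e1" "e4 \<noteq> e2" "e4 \<noteq> e3" "\<alpha> \<noteq> \<beta>" "\<beta> \<noteq> \<alpha>"
  using vertices_distinct by auto

lemma arcs_glued [simp]: "\<alpha> \<in> arcs Q" "\<beta> \<in> arcs Q"
  using source sink by (auto simp: source_arrow_def sink_arrow_def)

text \<open>Together with the membership of both arrows in the quiver, these are all the facts drawn
  from the source and sink hypotheses.\<close>

lemma incident:
  assumes "a \<in> arcs Q"
  shows "head Q a \<noteq> e1" "tail Q a = e1 \<longleftrightarrow> a = \<alpha>" "head Q a = e2 \<longleftrightarrow> a = \<alpha>"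
    and "tail Q a \<noteq> e4" "tail Q a = e3 \<longleftrightarrow> a = \<beta>" "head Q a = e4 \<longleftrightarrow> a = \<beta>"
  using source sink assms
  by (auto simp: source_arrow_def sink_arrow_def in_arcs_def out_arcs_def set_eq_iff)

lemma sv_simps [simp]: "sv e1 = e1" "sv e2 = e2" "sv e3 = e1" "sv e4 = e2"
  by (simp_all add: star_vertex_def)

lemma sv_other: "v \<noteq> e3 \<Longrightarrow> v \<noteq> e4 \<Longrightarrow> sv v = v"
  by (simp add: star_vertex_def)

lemma sv_eq_iff: "sv u = sv v \<longleftrightarrow> u = v \<or> {u, v} = {e1, e3} \<or> {u, v} = {e2, e4}"
  by (auto simp: star_vertex_def doubleton_eq_iff)

lemma sa_simps [simp]: "sa \<alpha> = \<alpha>" "sa \<beta> = \<alpha>"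
  by (simp_all add: star_arrow_def)

lemma sa_other: "a \<noteq> \<beta> \<Longrightarrow> sa a = a"
  by (simp add: star_arrow_def)

lemma sa_eq_other: "a \<noteq> \<alpha> \<Longrightarrow> a \<noteq> \<beta> \<Longrightarrow> sa b = a \<longleftrightarrow> b = a"
  by (auto simp: star_arrow_def)

lemma glued_simps: "verts QB = sv ` verts Q" "arcs QB = arcs Q - {\<beta>}"
    "tail QB a = sv (tail Q a)" "head QB a = sv (head Q a)"
  by (auto simp: glued_quiver_def star_arrow_def image_iff)

lemma glued_star_arrow [simp]: "tail QB (sa a) = sv (tail Q a)" "head QB (sa a) = sv (head Q a)"
  by (auto simp: glued_simps star_arrow_def)

lemma glued_wf: "wf_digraph QB"
  by unfold_locales (auto simp: glued_simps)

interpretation B0: wf_digraph QB by (rule glued_wf)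

lemma star_path_path_comp: "sp (path_comp q p) = path_comp (sp q) (sp p)"
  by (simp add: star_path_def path_comp_def)

lemma fst_star_path: "fst (sp p) = sv (fst p)"
  by (simp add: star_path_def)

lemma star_arrow_path: "sp (arrow_path Q a) = arrow_path QB (sa a)"
  by (simp add: star_path_def arrow_path_def)

lemma star_path_in_paths:
  assumes "p \<in> paths Q"
  shows "sp p \<in> paths QB" and "path_target QB (sp p) = sv (path_target Q p)"
proof -
  have "(u, as) \<in> paths Q \<Longrightarrow> sp (u, as) \<in> paths QB
    \<and> path_target QB (sp (u, as)) = sv (path_target Q (u, as))" for u as
  proof (induction as arbitrary: u)
    case Nil
    then show ?case by (simp add: path_simps B0.path_simps star_path_def glued_simps(1))
  next
    case (Cons a as)
    then have a: "a \<in> arcs Q" "tail Q a = u" and IH: "sp (head Q a, as) \<in> paths QB"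
      "path_target QB (sp (head Q a, as)) = sv (path_target Q (head Q a, as))"
      by (auto simp: path_simps)
    have "sa a \<in> arcs QB" using a(1) by (auto simp: glued_simps star_arrow_def)
    then show ?case using a IH by (simp add: path_simps B0.path_simps star_path_def)
  qed
  then show "sp p \<in> paths QB" "path_target QB (sp p) = sv (path_target Q p)"
    using assms by (cases p; blast)+
qed

text \<open>Five of the six families in Z_new are empty: they need an arrow into \<open>e1\<close>,
  a second arrow out of \<open>e1\<close>, or a second arrow into \<open>e2\<close> or
  \<open>e4\<close>. What remains says that an arrow into \<open>e3\<close>, the glued arrow and an
  arrow out of \<open>e2\<close> compose to zero.\<close>

lemma new_relations_iff:
  "r \<in> new_relations Q \<alpha> \<beta> \<longleftrightarrow>
    (\<exists>x h. x \<in> arcs Q \<and> h \<in> arcs Q \<and> head Q h = e3 \<and> tail Q x = e2 \<and> r = (sv (tail Q h), [h, \<alpha>, x]))"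
proof -
  have 1: "new_relations_half Q \<alpha> \<beta> QB sa = {}"
  proof -
    have "\<not> (\<exists>l h. l \<in> arcs Q \<and> h \<in> arcs Q \<and> head Q h = e1 \<and> P l h)"
      "\<not> (\<exists>x m. x \<in> arcs Q \<and> m \<in> arcs Q \<and> head Q m = e2 \<and> m \<noteq> \<alpha> \<and> P x m)" for P
      using incident(1,3) by blast+
    then show ?thesis unfolding new_relations_half_def Let_def by blast
  qed
  have 2: "new_relations_half Q \<beta> \<alpha> QB sa =
    {path_comp (arrow_path QB (sa x)) (path_comp (arrow_path QB (sa \<beta>)) (arrow_path QB (sa h)))
      | x h. x \<in> arcs Q \<and> h \<in> arcs Q \<and> head Q h = e3 \<and> tail Q x = e2}"
  proof -
    have "\<not> (\<exists>l h. l \<in> arcs Q \<and> h \<in> arcs Q \<and> head Q h = e3 \<and> tail Q l = e1 \<and> l \<noteq> \<alpha>)"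
      "\<not> (\<exists>x m. x \<in> arcs Q \<and> m \<in> arcs Q \<and> head Q m = e4 \<and> m \<noteq> \<beta> \<and> tail Q x = e2)"
      using incident(2,6) by blast+
    then show ?thesis unfolding new_relations_half_def Let_def by blast
  qed
  have 3: "path_comp (arrow_path QB (sa x)) (path_comp (arrow_path QB (sa \<beta>)) (arrow_path QB (sa h)))
      = (sv (tail Q h), [h, \<alpha>, x])"
    if "head Q h = e3" "tail Q x = e2" for x h
  proof -
    have "h \<noteq> \<beta>" "x \<noteq> \<beta>" using that by auto
    then show ?thesis by (simp add: path_comp_def arrow_path_def sa_other glued_simps(3))
  qed
  show ?thesis
    unfolding new_relations_def 1 2 using 3 by (simp, metis)
qed

lemma generators_in_paths: "sp ` Z \<union> new_relations Q \<alpha> \<beta> \<subseteq> paths QB"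
proof -
  have "r \<in> paths QB" if new: "r \<in> new_relations Q \<alpha> \<beta>" for r
  proof -
    obtain x h where "x \<in> arcs Q" "h \<in> arcs Q" "head Q h = e3" "tail Q x = e2"
      "r = (sv (tail Q h), [h, \<alpha>, x])"
      using new unfolding new_relations_iff by blast
    moreover from this have "h \<noteq> \<beta>" "x \<noteq> \<beta>" by auto
    ultimately show ?thesis by (auto simp: B0.path_simps glued_simps)
  qed
  then show ?thesis using star_path_in_paths relations_paths by blast
qed

lemma glued_bound_quiver: "bound_quiver QB ZB"
proof -
  have "ZB \<subseteq> paths QB"
    using generators_in_paths by (auto simp: glued_relations_def minimal_relations_def)
  moreover have "finite (arcs QB)" by (simp add: glued_simps)
  moreover have "finite ZB"
    by (rule finite_glued_relations) (rule monomial_algebra_axioms)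
  ultimately show ?thesis
    using glued_wf by (simp add: bound_quiver_def bound_quiver_axioms_def)
qed

lemma original_bound_quiver: "bound_quiver Q Z"
  using finite_relations relations_paths wf_digraph_axioms
  by (simp add: bound_quiver_def bound_quiver_axioms_def)

end

sublocale gluing \<subseteq> A: bound_quiver Q Z
  by (rule original_bound_quiver)

sublocale gluing \<subseteq> B: bound_quiver QB ZB
  by (rule glued_bound_quiver)

section \<open>Nonzero paths of the original and of the glued algebra\<close>

context gluing
begin

text \<open>Passing to minimal relations does not change the nonzero paths, so from here on all
  generators may be tested and minimality of an image need not be discussed.\<close>

lemma glued_nonzero_iff:
  "p \<in> BB \<longleftrightarrow>
    p \<in> paths QB \<and> (\<forall>r \<in> sp ` Z \<union> new_relations Q \<alpha> \<beta>. \<not> subpath QB r p)"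
  using nonzero_paths_minimal_relations[OF glued_wf generators_in_paths]
  by (auto simp: glued_relations_def nonzero_paths_def[of _ "sp ` Z \<union> _"])

lemma path_to_e1: "(u, as) \<in> paths Q \<Longrightarrow> path_target Q (u, as) = e1 \<Longrightarrow> as = []"
  by (cases as rule: rev_cases) (auto simp: paths_append_iff target_append path_simps incident)

lemma path_to_e2: "(u, as) \<in> paths Q \<Longrightarrow> path_target Q (u, as) = e2 \<Longrightarrow> as = [] \<or> as = [\<alpha>]"
proof (cases as rule: rev_cases)
  case (snoc bs a)
  moreover assume "(u, as) \<in> paths Q" "path_target Q (u, as) = e2"
  ultimately have "a = \<alpha>" "(u, bs) \<in> paths Q" "path_target Q (u, bs) = e1"
    by (auto simp: paths_append_iff target_append path_simps incident)
  then show ?thesis using snoc path_to_e1 by simp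
qed simp

lemma path_from_e4: "(e4, as) \<in> paths Q \<Longrightarrow> as = []"
  by (cases as) (auto simp: path_simps incident)

lemma path_from_e3: "(e3, as) \<in> paths Q \<Longrightarrow> as = [] \<or> as = [\<beta>]"
  by (cases as) (auto simp: path_simps incident path_from_e4)

lemma alpha_first: "(u, xs @ \<alpha> # ys) \<in> paths Q \<Longrightarrow> xs = []"
  by (auto simp: paths_append_iff path_simps intro: path_to_e1)

lemma beta_last: "(u, xs @ \<beta> # ys) \<in> paths Q \<Longrightarrow> ys = []"
  by (auto simp: paths_append_iff path_simps intro: path_from_e4)

lemma alpha_free:
  assumes "p \<in> paths Q" "fst p \<noteq> e1"
  shows "\<alpha> \<notin> set (snd p)"
proof
  assume "\<alpha> \<in> set (snd p)"
  then obtain xs ys where "snd p = xs @ \<alpha> # ys" by (auto simp: in_set_conv_decomp)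
  then have p: "p = (fst p, xs @ \<alpha> # ys)" by (simp add: prod_eq_iff)
  with assms(1) have "xs = []" using alpha_first by metis
  with p assms show False by (metis append_Nil paths_Cons_iff)
qed

lemma beta_free:
  assumes "p \<in> paths Q" "path_target Q p \<noteq> e4"
  shows "\<beta> \<notin> set (snd p)"
proof
  assume "\<beta> \<in> set (snd p)"
  then obtain xs ys where "snd p = xs @ \<beta> # ys" by (auto simp: in_set_conv_decomp)
  then have p: "p = (fst p, xs @ \<beta> # ys)" by (simp add: prod_eq_iff)
  with assms(1) have "ys = []" using beta_last by metis
  with p have "path_target Q p = e4" by (metis target_append target_Cons target_Nil)
  with assms show False by simp
qed

lemma star_path_id: "fst p \<noteq> e3 \<Longrightarrow> fst p \<noteq> e4 \<Longrightarrow> \<beta> \<notin> set (snd p) \<Longrightarrow> sp p = p"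
  by (cases p) (auto simp: star_path_def sv_other star_arrow_def intro!: map_idI)

text \<open>Only \<alpha> and \<beta> are identified, and they start at different vertices. A path
  is therefore recovered arrow by arrow once its start is known.\<close>

lemma star_path_inj:
  assumes "p \<in> paths Q" "q \<in> paths Q" "fst p = fst q" "sp p = sp q"
  shows "p = q"
proof -
  have "(u, as) \<in> paths Q \<Longrightarrow> (u, bs) \<in> paths Q \<Longrightarrow> map sa as = map sa bs \<Longrightarrow> as = bs" for u as bs
  proof (induction as arbitrary: u bs)
    case (Cons a as)
    then obtain b bs' where b: "bs = b # bs'" "sa a = sa b" "map sa as = map sa bs'"
      by (cases bs) auto
    with Cons.prems have "tail Q a = u" "tail Q b = u" by (auto simp: path_simps)
    moreover have "a = b \<or> a = \<alpha> \<and> b = \<beta> \<or> a = \<beta> \<and> b = \<alpha>"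
      using b(2) by (auto simp: star_arrow_def split: if_splits)
    ultimately have "a = b" using distinct_vertices(2) by metis
    with Cons b show ?case by (auto simp: path_simps)
  qed simp
  moreover have "map sa (snd p) = map sa (snd q)" using assms(4) by (simp add: star_path_def)
  ultimately show ?thesis using assms(1-3) by (metis prod.collapse)
qed

text \<open>The arrow before the glued one must end in \<open>e3\<close>, as none ends in
  \<open>e1\<close>, and the one after it must start in \<open>e2\<close>, as none starts in
  \<open>e4\<close>. The three arrows together form a new relation.\<close>

lemma interior_alpha:
  assumes "snd p = xs @ h # \<alpha> # x # ys"
  shows "p \<notin> BB"
proof
  assume nz: "p \<in> BB"
  obtain u where p: "p = (u, xs @ h # \<alpha> # x # ys)" using assms by (cases p) simp
  have path: "p \<in> paths QB" using nz by (rule B.nonzero_in_paths)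
  then have h: "h \<in> arcs Q" "h \<noteq> \<beta>" "sv (head Q h) = e1" and x: "x \<in> arcs Q" "x \<noteq> \<beta>" "sv (tail Q x) = e2"
    by (auto simp: p B.paths_append_iff B.path_simps glued_simps)
  have "head Q h = e3" "tail Q x = e2"
    using h x incident[OF h(1)] incident[OF x(1)] by (auto simp: star_vertex_def split: if_splits)
  then have new: "(sv (tail Q h), [h, \<alpha>, x]) \<in> new_relations Q \<alpha> \<beta>"
    using h x unfolding new_relations_iff by blast
  have "subpath QB (sv (tail Q h), [h, \<alpha>, x]) p"
    unfolding subpath_def
    by (rule bexI[of _ "(u, xs)"], rule bexI[of _ "(sv (head Q x), ys)"])
      (use path in \<open>auto simp: p path_comp_def B.paths_append_iff B.path_simps glued_simps(3,4)\<close>)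
  then show False
    using nz new unfolding glued_nonzero_iff by blast
qed

lemma star_subpath:
  assumes "subpath Q r p" "r \<in> paths Q"
  shows "subpath QB (sp r) (sp p)"
proof -
  obtain u w where uw: "u \<in> paths Q" "w \<in> paths Q" "path_target Q u = fst r"
    "path_target Q r = fst w" "p = path_comp w (path_comp r u)"
    using assms(1) by (auto simp: subpath_def)
  show ?thesis
    unfolding subpath_def
    by (rule bexI[where x = "sp u"], rule bexI[where x = "sp w"])
      (simp_all add: uw assms(2) star_path_path_comp star_path_in_paths fst_star_path)
qed

text \<open>For the harder direction, a generator inside the image of \<open>p\<close> lifts to a
  segment \<open>rs\<close> of \<open>p\<close>. A new relation would put \<alpha> or \<beta>
  strictly inside a path of the original quiver, which is impossible. For the image of a relation r,
  the segment turns out to be r itself.\<close>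

lemma star_nonzero_iff:
  assumes p: "p \<in> paths Q"
  shows "sp p \<in> BB \<longleftrightarrow> p \<in> BA"
proof
  assume nz: "sp p \<in> BB"
  have "\<not> subpath Q r p" if r: "r \<in> Z" for r
    using nz star_subpath[of r p] r relations_paths
    unfolding glued_nonzero_iff by blast
  then show "p \<in> BA" using p by (simp add: nonzero_paths_def)
next
  assume nz: "p \<in> BA"
  obtain u as where pu: "p = (u, as)" by fastforce
  have "\<not> subpath QB r' (sp p)" if r': "r' \<in> sp ` Z \<union> new_relations Q \<alpha> \<beta>" for r'
  proof
    assume "subpath QB r' (sp p)"
    then obtain xs ys where "map sa as = xs @ snd r' @ ys"
      by (auto simp: subpath_def path_comp_def star_path_def pu)
    then obtain xs' ts where ts: "as = xs' @ ts" "snd r' @ ys = map sa ts"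
      unfolding map_eq_append_conv by blast
    from ts(2)[symmetric] obtain rs ys' where "ts = rs @ ys'" and rs: "map sa rs = snd r'"
      unfolding map_eq_append_conv by metis
    with ts have as: "as = xs' @ rs @ ys'" by simp
    let ?v = "path_target Q (u, xs')"
    have paths: "(u, xs') \<in> paths Q" "(?v, rs) \<in> paths Q" "(path_target Q (?v, rs), ys') \<in> paths Q"
      using p by (auto simp: pu as paths_append_iff)
    from r' show False
    proof
      assume "r' \<in> new_relations Q \<alpha> \<beta>"
      then obtain h x where "map sa rs = [h, \<alpha>, x]" using rs unfolding new_relations_iff by auto
      then obtain a b c where abc: "rs = [a, b, c]" "sa b = \<alpha>" by auto
      then have "b = \<alpha> \<or> b = \<beta>" by (auto simp: star_arrow_def split: if_splits)
      then show False
        using alpha_first[of u "xs' @ [a]" "c # ys'"] beta_last[of u "xs' @ [a]" "c # ys'"] p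
        by (auto simp: pu as abc)
    next
      assume "r' \<in> sp ` Z"
      then obtain r where r: "r \<in> Z" "r' = sp r" by blast
      have rp: "r \<in> paths Q" using r relations_paths by blast
      obtain v bs where vbs: "r = (v, bs)" by fastforce
      \<comment> \<open>With at least two arrows the first is not the last, hence is not \<beta>. So
        the first arrows of \<open>rs\<close> and of the relation, having equal images, are equal;
        then the starts agree and \<open>star_path_inj\<close> applies.\<close>
      have "2 \<le> length bs" using relations_length[OF r(1)] by (simp add: vbs)
      moreover have map: "map sa rs = map sa bs" using rs r by (simp add: star_path_def vbs)
      moreover from map have "length rs = length bs" by (metis length_map)
      ultimately obtain a a' as' b b' bs' where ab: "rs = a # a' # as'" "bs = b # b' # bs'"
        by (cases rs; cases "tl rs"; cases bs; cases "tl bs") auto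
      have "sa a = sa b" using map by (simp add: ab)
      moreover have "a \<noteq> \<beta>" using beta_last[of ?v "[]" "a' # as'"] paths(2) by (auto simp: ab)
      moreover have "b \<noteq> \<beta>" using beta_last[of v "[]" "b' # bs'"] rp by (auto simp: ab vbs)
      ultimately have "a = b" by (simp add: sa_other)
      then have v: "?v = v" using paths(2) rp by (auto simp: ab vbs path_simps)
      then have "(?v, rs) = r"
        using star_path_inj[OF paths(2) rp] map by (simp add: vbs star_path_def)
      then have "subpath Q r p"
        unfolding subpath_def using paths
        by (intro bexI[of _ "(u, xs')"] bexI[of _ "(path_target Q (?v, rs), ys')"])
          (auto simp: pu as path_comp_def)
      then show False using nz r by (simp add: nonzero_paths_def)
    qed
  qed
  then show "sp p \<in> BB"
    using star_path_in_paths(1)[OF p] unfolding glued_nonzero_iff by blast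
qed

text \<open>Two consecutive arrows of the glued quiver already compose in the original one unless
  the second is the glued arrow: a mismatch at f_1 would need the second to start in
  \<open>e1\<close> or \<open>e3\<close>, and one at f_2 would need the first to be \<beta>.\<close>

lemma lift_path:
  assumes "(u, a # as) \<in> paths QB" "\<alpha> \<notin> set as"
  shows "(tail Q a, a # as) \<in> paths Q"
  using assms
proof (induction as arbitrary: u a)
  case Nil
  then show ?case by (auto simp: B.path_simps path_simps glued_simps)
next
  case (Cons b as)
  then have arcs: "a \<in> arcs Q" "b \<in> arcs Q" "a \<noteq> \<beta>" "b \<noteq> \<beta>" "b \<noteq> \<alpha>" "sv (head Q a) = sv (tail Q b)"
    by (auto simp: B.path_simps glued_simps)
  then have "head Q a = tail Q b"
    using incident[OF arcs(1)] incident[OF arcs(2)]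
    by (auto simp: sv_eq_iff doubleton_eq_iff)
  then show ?case
    using Cons arcs by (auto simp: path_simps B.paths_Cons_iff[of u])
qed

text \<open>An occurrence of the glued arrow in first place is lifted to \<alpha>. A later one must
  be the last arrow by \<open>interior_alpha\<close>, and is lifted to \<beta>.\<close>

lemma nonzero_path_lift:
  assumes nz: "p \<in> BB"
  obtains q where "q \<in> BA" "sp q = p"
proof -
  have pp: "p \<in> paths QB" using nz by (rule B.nonzero_in_paths)
  obtain u as where pu: "p = (u, as)" by fastforce
  have "\<exists>q\<in>paths Q. sp q = p"
  proof (cases as)
    case Nil
    then have "u \<in> sv ` verts Q" using pp by (simp add: pu B.path_simps glued_simps)
    then obtain v where "v \<in> verts Q" "u = sv v" by blast
    then show ?thesis
      by (intro bexI[of _ "(v, [])"]) (auto simp: Nil pu star_path_def path_simps)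
  next
    case (Cons a bs)
    have u: "sv (tail Q a) = u" and a: "a \<noteq> \<beta>" "\<beta> \<notin> set bs"
    proof -
      have "set as \<subseteq> arcs QB" using pp unfolding pu paths_def B.awalk_def by auto
      then show "a \<noteq> \<beta>" "\<beta> \<notin> set bs" by (auto simp: Cons glued_simps)
      show "sv (tail Q a) = u" using pp by (simp add: pu Cons B.path_simps glued_simps)
    qed
    have map: "map sa cs = cs" if "\<beta> \<notin> set cs" for cs
      using that by (auto intro!: map_idI simp: star_arrow_def)
    show ?thesis
    proof (cases "\<alpha> \<in> set bs")
      case False
      then have "(tail Q a, a # bs) \<in> paths Q" using lift_path pp pu Cons by blast
      then show ?thesis
        using a u map[OF a(2)]
        by (intro bexI[of _ "(tail Q a, a # bs)"]) (auto simp: star_path_def pu Cons sa_other)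
    next
      case True
      then obtain ms ys where ms: "bs = ms @ \<alpha> # ys" "\<alpha> \<notin> set ms"
        by (meson split_list_first)
      have "ys = []"
      proof (rule ccontr)
        assume "ys \<noteq> []"
        then obtain x ys' where "ys = x # ys'" by (cases ys) auto
        moreover obtain zs z where "a # ms = zs @ [z]" by (cases "a # ms" rule: rev_cases) auto
        ultimately have "snd p = zs @ z # \<alpha> # x # ys'" by (simp add: pu Cons ms flip: append_Cons)
        then show False using interior_alpha nz by blast
      qed
      then have split: "as = (a # ms) @ [\<alpha>]" by (simp add: Cons ms)
      then have path: "(u, a # ms) \<in> paths QB" and t: "path_target QB (u, a # ms) = e1"
        using pp unfolding pu split B.paths_append_iff by (simp_all add: B.paths_Cons_iff glued_simps(3))
      have lift: "(tail Q a, a # ms) \<in> paths Q" using lift_path[OF path ms(2)] .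
      have sp: "sp (tail Q a, a # ms) = (u, a # ms)"
        using a u map[of ms] ms by (auto simp: star_path_def sa_other)
      have "sv (path_target Q (tail Q a, a # ms)) = e1"
        using star_path_in_paths(2)[OF lift] t sp by simp
      \<comment> \<open>The alternative \<open>e1\<close> is excluded because no path of positive
        length ends there; ending in \<open>e3\<close> is what allows \<beta> to be
        appended.\<close>
      then have "path_target Q (tail Q a, a # ms) = e3"
        using path_to_e1[OF lift] by (auto simp: star_vertex_def split: if_splits)
      then have "(tail Q a, (a # ms) @ [\<beta>]) \<in> paths Q"
        unfolding paths_append_iff using lift by (auto simp: path_simps)
      moreover have "sp (tail Q a, (a # ms) @ [\<beta>]) = p"
        using sp by (simp add: star_path_def pu split)
      ultimately show ?thesis by blast
    qed
  qed
  then show thesis using that star_nonzero_iff nz by blast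
qed

section \<open>Cochains shared by the two algebras\<close>

definition common_keys :: "(('v, 'a) qpath \<times> ('v, 'a) qpath) set" where
  "common_keys = {(A.arr a, p) | a p. a \<in> arcs Q \<and> a \<noteq> \<alpha> \<and> a \<noteq> \<beta> \<and> p \<in> BA
     \<and> parallel Q (A.arr a) p}"

definition common :: "('v, 'a, 'k::field) cochain set" where
  "common = {f. Poly_Mapping.keys f \<subseteq> common_keys}"

text \<open>The projection that drops the values at \<alpha> and \<beta>. It serves both algebras,
  since the arrow path of the glued arrow is the same term as that of \<alpha>.\<close>

definition restrict :: "('v, 'a, 'k::field) cochain \<Rightarrow> ('v, 'a, 'k) cochain" where
  "restrict = linear_extension (\<lambda>(x, p). if x = A.arr \<alpha> \<or> x = A.arr \<beta> then 0 else basis (x, p))"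

definition relabel :: "(('v, 'a) qpath \<Rightarrow>\<^sub>0 'k::field) \<Rightarrow> (('v, 'a) qpath \<Rightarrow>\<^sub>0 'k)" where
  "relabel = linear_extension (\<lambda>p. basis (sp p))"

text \<open>One term with two readings: \<alpha>||\<alpha> in the original algebra, and the glued
  arrow parallel to itself in the glued one.\<close>

abbreviation "gg \<equiv> (A.arr \<alpha>, A.arr \<alpha>)"

lemma klinear_restrict: "klinear restrict"
  unfolding restrict_def by (rule klinear_linear_extension)

lemma klinear_relabel: "klinear relabel"
  unfolding relabel_def by (rule klinear_linear_extension)

lemma klinear_psi1: "klinear (psi1 Q \<alpha> \<beta>)"
  unfolding psi1_def by (rule klinear_linear_extension)

lemma restrict_basis: "restrict (basis (x, p)) = (if x = A.arr \<alpha> \<or> x = A.arr \<beta> then 0 else basis (x, p))"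
  by (simp add: restrict_def)

lemma psi1_basis: "psi1 Q \<alpha> \<beta> (basis (x, p)) = basis (sp x, sp p)"
  by (simp add: psi1_def)

lemma subspace_common: "cochain.subspace common"
  unfolding common_def by (rule subspace_keys)

lemma glued_arrow_alpha: "B.arr \<alpha> = A.arr \<alpha>"
  by (simp add: arrow_path_def glued_simps)

lemma glued_arrow_other:
  assumes "a \<in> arcs Q" "a \<noteq> \<alpha>" "a \<noteq> \<beta>"
  shows "B.arr a = A.arr a" "sp (A.arr a) = A.arr a" "a \<in> arcs QB"
  using assms incident[OF assms(1)]
  by (auto simp: arrow_path_def glued_simps sv_other star_path_def sa_other)

text \<open>A path parallel to \<open>a\<close> does not start in \<open>e1\<close>, so it avoids
  \<alpha>, and does not end in \<open>e4\<close>, so it avoids \<beta>. Gluing therefore leaves it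
  unchanged.\<close>

lemma common_key:
  assumes a: "a \<in> arcs Q" "a \<noteq> \<alpha>" "a \<noteq> \<beta>" and p: "p \<in> BA" "parallel Q (A.arr a) p"
  shows "fst p \<noteq> e1" "fst p \<noteq> e3" "fst p \<noteq> e4" "\<alpha> \<notin> set (snd p)" "\<beta> \<notin> set (snd p)"
    and "sp p = p" "p \<in> BB" "parallel QB (A.arr a) p"
proof -
  have pp: "p \<in> paths Q" using p A.nonzero_in_paths by blast
  have t: "fst p = tail Q a" "A.tgt p = head Q a"
    using p by (simp_all add: parallel_arrow_iff)
  show f: "fst p \<noteq> e1" "fst p \<noteq> e3" "fst p \<noteq> e4" using t incident[OF a(1)] a by auto
  show "\<alpha> \<notin> set (snd p)" using alpha_free[OF pp f(1)] .
  show b: "\<beta> \<notin> set (snd p)" using beta_free[OF pp] t incident[OF a(1)] a by auto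
  show s: "sp p = p" using star_path_id f b by blast
  show "p \<in> BB" using star_nonzero_iff[OF pp] s p by simp
  have "B.tgt p = sv (head Q a)" using star_path_in_paths(2)[OF pp] s t by simp
  then show "parallel QB (A.arr a) p"
    unfolding glued_arrow_other(1)[OF a, symmetric] B.parallel_arrow_iff
    using t f by (simp add: glued_simps sv_other)
qed

lemma sv_eq_e: "sv u = e1 \<longleftrightarrow> u = e1 \<or> u = e3" "sv u = e2 \<longleftrightarrow> u = e2 \<or> u = e4"
  by (auto simp: star_vertex_def)

lemma common_keysE:
  assumes "k \<in> common_keys"
  obtains a p where "k = (A.arr a, p)" "a \<in> arcs Q" "a \<noteq> \<alpha>" "a \<noteq> \<beta>" "p \<in> BA" "parallel Q (A.arr a) p"
  using assms by (auto simp: common_keys_def)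

lemma common_subset: "common \<subseteq> cochains1 Q Z" "common \<subseteq> cochains1 QB ZB"
proof -
  have "x \<in> A.arr ` arcs Q \<and> p \<in> BA \<and> parallel Q x p" "x \<in> B.arr ` arcs QB \<and> p \<in> BB \<and> parallel QB x p"
    if key: "(x, p) \<in> common_keys" for x p
  proof -
    obtain a where a: "x = A.arr a" "a \<in> arcs Q" "a \<noteq> \<alpha>" "a \<noteq> \<beta>" and p: "p \<in> BA" "parallel Q (A.arr a) p"
      using key unfolding common_keys_def by blast
    then show "x \<in> A.arr ` arcs Q \<and> p \<in> BA \<and> parallel Q x p" by blast
    have "x = B.arr a" using a glued_arrow_other by simp
    moreover have "a \<in> arcs QB" using a glued_arrow_other by blast
    ultimately show "x \<in> B.arr ` arcs QB \<and> p \<in> BB \<and> parallel QB x p"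
      using common_key(7,8)[OF a(2-4) p] a(1) by (metis image_eqI)
  qed
  then show "common \<subseteq> cochains1 Q Z" "common \<subseteq> cochains1 QB ZB"
    unfolding common_def cochains1_def cochains_def by blast+
qed

lemma restrict_common:
  assumes "f \<in> common"
  shows "restrict f = f" "psi1 Q \<alpha> \<beta> f = f"
proof -
  show "restrict f = f"
  proof (rule klinear_eq_on_keys[OF klinear_restrict klinear_id])
    fix k assume "k \<in> Poly_Mapping.keys f"
    then have "k \<in> common_keys" using assms by (auto simp: common_def)
    then show "restrict (basis k) = basis k"
      by (rule common_keysE) (simp add: restrict_basis)
  qed
  show "psi1 Q \<alpha> \<beta> f = f"
  proof (rule klinear_eq_on_keys[OF klinear_psi1 klinear_id])
    fix k assume "k \<in> Poly_Mapping.keys f"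
    then have "k \<in> common_keys" using assms by (auto simp: common_def)
    then obtain a p where k: "k = (A.arr a, p)" and a: "a \<in> arcs Q" "a \<noteq> \<alpha>" "a \<noteq> \<beta>"
      and p: "p \<in> BA" "parallel Q (A.arr a) p"
      by (rule common_keysE)
    show "psi1 Q \<alpha> \<beta> (basis k) = basis k"
      unfolding k psi1_basis glued_arrow_other(2)[OF a] common_key(6)[OF a p] ..
  qed
qed

lemma arrow_nonzero: "a \<in> arcs Q \<Longrightarrow> A.arr a \<in> BA"
proof -
  assume a: "a \<in> arcs Q"
  have "\<not> subpath Q r (A.arr a)" if "r \<in> Z" for r
    using relations_length[OF that] subpath_length[of Q r "A.arr a"] by (auto simp: arrow_path_def)
  then show ?thesis using arrow_path_in_paths[OF a] by (simp add: nonzero_paths_def)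
qed

text \<open>A path into \<open>e2\<close> is trivial or \<alpha>, and a path out of
  \<open>e3\<close> is trivial or \<beta>; nothing else is parallel to \<alpha> or \<beta>.\<close>

lemma cochains1_original_key:
  assumes "f \<in> cochains1 Q Z" "k \<in> Poly_Mapping.keys f"
  shows "k \<in> common_keys \<or> k = (A.arr \<alpha>, A.arr \<alpha>) \<or> k = (A.arr \<beta>, A.arr \<beta>)"
proof -
  obtain a p where k: "k = (A.arr a, p)" "a \<in> arcs Q" "p \<in> BA" "parallel Q (A.arr a) p"
    using A.cochain_key[OF assms] by metis
  obtain u as where p: "p = (u, as)" by fastforce
  have path: "(u, as) \<in> paths Q" using k A.nonzero_in_paths p by blast
  have t: "u = tail Q a" "A.tgt (u, as) = head Q a" using k(4) unfolding p parallel_arrow_iff by auto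
  consider "a = \<alpha>" | "a = \<beta>" | "a \<noteq> \<alpha>" "a \<noteq> \<beta>" by blast
  then show ?thesis
  proof cases
    case 1
    then have "as = [\<alpha>]" using path_to_e2[OF path] t by (auto simp: target_Nil)
    then show ?thesis using 1 k p t by (simp add: arrow_path_def)
  next
    case 2
    then have "as = [\<beta>]" using path_from_e3[of as] path t by (auto simp: target_Nil)
    then show ?thesis using 2 k p t by (simp add: arrow_path_def)
  next
    case 3
    then show ?thesis using k unfolding common_keys_def by blast
  qed
qed

text \<open>Of the four directions in the definition of special paths only two can occur, since no
  path of positive length ends in \<open>e1\<close> or starts in \<open>e4\<close>.\<close>

lemma star_cases:
  assumes q: "q \<in> paths Q" and "fst q \<noteq> A.tgt q" and "sv (fst q) = sv (A.tgt q)"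
  shows "fst q = e1 \<and> A.tgt q = e3 \<or> fst q = e2 \<and> A.tgt q = e4"
proof -
  obtain u as where qu: "q = (u, as)" by fastforce
  have "A.tgt q \<noteq> e1" using path_to_e1[of u as] q assms(2) by (auto simp: qu target_Nil)
  moreover have "fst q \<noteq> e4" using path_from_e4[of as] q assms(2) by (auto simp: qu target_Nil)
  ultimately show ?thesis using assms(2,3) by (auto simp: sv_eq_iff doubleton_eq_iff)
qed

section \<open>Special paths and their coboundaries\<close>

lemma delta0_glued_basis:
  "delta0 QB ZB (basis (vertex_path v, p)) =
      (\<Sum>a | a \<in> arcs QB \<and> tail QB a = v \<and> path_comp (B.arr a) p \<in> BB. basis (B.arr a, path_comp (B.arr a) p))
    - (\<Sum>a | a \<in> arcs QB \<and> head QB a = v \<and> path_comp p (B.arr a) \<in> BB. basis (B.arr a, path_comp p (B.arr a)))"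
  by (simp add: delta0_def vertex_path_def)

lemma delta0_original_basis:
  "delta0 Q Z (basis (vertex_path v, p)) =
      (\<Sum>a | a \<in> arcs Q \<and> tail Q a = v \<and> path_comp (A.arr a) p \<in> BA. basis (A.arr a, path_comp (A.arr a) p))
    - (\<Sum>a | a \<in> arcs Q \<and> head Q a = v \<and> path_comp p (A.arr a) \<in> BA. basis (A.arr a, path_comp p (A.arr a)))"
  by (simp add: delta0_def vertex_path_def)

lemma glued_incident:
  "a \<in> arcs QB \<and> tail QB a = e1 \<longleftrightarrow> a = \<alpha>" "a \<in> arcs QB \<and> head QB a = e2 \<longleftrightarrow> a = \<alpha>"
  using incident[of a] by (auto simp: glued_simps sv_eq_e)

text \<open>The only arrow leaving f_1 is the glued one, which gives the single term. The path
  begins with \<alpha> and continues, so composing it with an arrow into f_1 puts the glued arrow in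
  the interior and gives zero.\<close>

lemma special_first:
  assumes q: "(e1, as) \<in> paths Q" "A.tgt (e1, as) = e3"
  shows "delta0 QB ZB (basis (vertex_path e1, sp (e1, as)))
    = (if (e1, as @ [\<beta>]) \<in> BA then basis (A.arr \<alpha>, sp (e1, as @ [\<beta>])) else 0)"
proof -
  obtain b bs where as: "as = \<alpha> # b # bs"
  proof (cases as)
    case Nil
    then show ?thesis using q by (simp add: target_Nil)
  next
    case (Cons a as')
    then have "a = \<alpha>" using q(1) incident(2)[of a] by (auto simp: path_simps)
    then show ?thesis using Cons q(2) that by (cases as') (auto simp: target_Cons target_Nil)
  qed
  have path: "(e1, as @ [\<beta>]) \<in> paths Q" using q by (simp add: paths_append_iff path_simps)
  have comp: "path_comp (B.arr \<alpha>) (sp (e1, as)) = sp (e1, as @ [\<beta>])"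
    by (simp add: path_comp_def arrow_path_def star_path_def)
  have 1: "{a \<in> arcs QB. tail QB a = e1 \<and> path_comp (B.arr a) (sp (e1, as)) \<in> BB}
    = (if (e1, as @ [\<beta>]) \<in> BA then {\<alpha>} else {})"
    using glued_incident(1) comp star_nonzero_iff[OF path] by (auto simp: conj_assoc[symmetric])
  have 2: "{a \<in> arcs QB. head QB a = e1 \<and> path_comp (sp (e1, as)) (B.arr a) \<in> BB} = {}"
  proof -
    have "path_comp (sp (e1, as)) (B.arr a) \<notin> BB" for a
      by (rule interior_alpha[of _ "[]" a "sa b" "map sa bs"])
        (simp add: path_comp_def star_path_def arrow_path_def as)
    then show ?thesis by blast
  qed
  show ?thesis
    unfolding delta0_glued_basis 1 2 by (simp add: comp[unfolded glued_arrow_alpha] glued_arrow_alpha)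
qed

text \<open>Dual to the preceding case: the path ends with \<beta>, so the outgoing sum vanishes and
  the incoming sum has one term, whence the minus sign.\<close>

lemma special_second:
  assumes q: "(e2, as) \<in> paths Q" "A.tgt (e2, as) = e4"
  shows "delta0 QB ZB (basis (vertex_path e2, sp (e2, as)))
    = (if (e1, \<alpha> # as) \<in> BA then - basis (A.arr \<alpha>, sp (e1, \<alpha> # as)) else 0)"
proof -
  obtain bs b where as: "as = bs @ [b, \<beta>]"
  proof (cases as rule: rev_cases)
    case Nil
    then show ?thesis using q by (simp add: target_Nil)
  next
    case (snoc cs a)
    then have "a = \<beta>" "A.tgt (e2, cs) = e3"
      using q incident(6)[of a] by (auto simp: paths_append_iff target_append path_simps)
    then show ?thesis using snoc that by (cases cs rule: rev_cases) (auto simp: target_Nil)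
  qed
  have path: "(e1, \<alpha> # as) \<in> paths Q" using q by (simp add: path_simps)
  have comp: "path_comp (sp (e2, as)) (B.arr \<alpha>) = sp (e1, \<alpha> # as)"
    by (simp add: path_comp_def arrow_path_def star_path_def glued_simps)
  have 1: "{a \<in> arcs QB. tail QB a = e2 \<and> path_comp (B.arr a) (sp (e2, as)) \<in> BB} = {}"
  proof -
    have "path_comp (B.arr a) (sp (e2, as)) \<notin> BB" for a
      by (rule interior_alpha[of _ "map sa bs" "sa b" a "[]"])
        (simp add: path_comp_def star_path_def arrow_path_def as)
    then show ?thesis by blast
  qed
  have 2: "{a \<in> arcs QB. head QB a = e2 \<and> path_comp (sp (e2, as)) (B.arr a) \<in> BB}
    = (if (e1, \<alpha> # as) \<in> BA then {\<alpha>} else {})"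
    using glued_incident(2) comp star_nonzero_iff[OF path] by (auto simp: conj_assoc[symmetric])
  show "delta0 QB ZB (basis (vertex_path e2, sp (e2, as)))
    = (if (e1, \<alpha> # as) \<in> BA then - basis (A.arr \<alpha>, sp (e1, \<alpha> # as)) else 0)"
    unfolding delta0_glued_basis 1 2 by (simp add: comp[unfolded glued_arrow_alpha] glued_arrow_alpha)
qed

definition special_set :: "('v, 'a, 'k::field) cochain set" where
  "special_set = special_images Q Z \<alpha> \<beta> e1 e3 \<union> special_images Q Z \<alpha> \<beta> e2 e4"

lemma special_cases:
  assumes "y \<in> special_set"
  obtains p where "p \<in> BA" "1 \<le> length (snd p)"
    "y = delta0 QB ZB (basis (vertex_path (sv (fst p)), sp p))"
    "fst p = e1 \<and> A.tgt p = e3 \<or> fst p = e2 \<and> A.tgt p = e4"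
proof -
  obtain v w p where p: "p \<in> BA" "1 \<le> length (snd p)" "y = delta0 QB ZB (basis (vertex_path (sv v), sp p))"
    "fst p = v \<and> A.tgt p = w \<or> fst p = w \<and> A.tgt p = v"
    and vw: "v = e1 \<and> w = e3 \<or> v = e2 \<and> w = e4"
    using assms unfolding special_set_def special_images_def Let_def by blast
  have path: "p \<in> paths Q" using p A.nonzero_in_paths by blast
  have "fst p \<noteq> A.tgt p" "sv (fst p) = sv (A.tgt p)" "sv (fst p) = sv v" using p(4) vw by auto
  then show thesis using that[OF p(1,2)] p(3) star_cases[OF path] by simp
qed

text \<open>Separates special coboundaries from the common part and from \<open>gg\<close>; this is
  what makes the sum defining Y direct and lets restriction kill \<open>Z_sp\<close>.\<close>

lemma special_keys:
  assumes "y \<in> special_set"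
  shows "Poly_Mapping.keys y \<subseteq> {(A.arr \<alpha>, p) | p. p \<noteq> A.arr \<alpha>}"
  using assms
proof (rule special_cases)
  fix p assume p: "p \<in> BA" "1 \<le> length (snd p)"
    "y = delta0 QB ZB (basis (vertex_path (sv (fst p)), sp p))"
    "fst p = e1 \<and> A.tgt p = e3 \<or> fst p = e2 \<and> A.tgt p = e4"
  obtain u as where pu: "p = (u, as)" by (cases p)
  have path: "(u, as) \<in> paths Q" using p A.nonzero_in_paths by (simp add: pu)
  from p(4) show ?thesis
  proof
    assume e: "fst p = e1 \<and> A.tgt p = e3"
    then have u: "u = e1" "A.tgt (e1, as) = e3" by (auto simp: pu)
    then have "y = (if (e1, as @ [\<beta>]) \<in> BA then basis (A.arr \<alpha>, sp (e1, as @ [\<beta>])) else 0)"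
      using path by (simp add: special_first p(3) pu)
    moreover have "sp (e1, as @ [\<beta>]) \<noteq> A.arr \<alpha>"
      using p(2) by (auto simp: star_path_def arrow_path_def pu)
    ultimately show ?thesis by (simp del: split_paired_Ex)
  next
    assume e: "fst p = e2 \<and> A.tgt p = e4"
    then have u: "u = e2" "A.tgt (e2, as) = e4" by (auto simp: pu)
    then have "y = (if (e1, \<alpha> # as) \<in> BA then - basis (A.arr \<alpha>, sp (e1, \<alpha> # as)) else 0)"
      using path by (simp add: special_second p(3) pu)
    moreover have "sp (e1, \<alpha> # as) \<noteq> A.arr \<alpha>"
      using p(2) by (auto simp: star_path_def arrow_path_def pu)
    ultimately show ?thesis by (simp del: split_paired_Ex)
  qed
qed

text \<open>Besides common pairs and \<open>gg\<close> there are only pairs whose first entry is the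
  glued arrow and whose second lifts to a path from \<open>e1\<close> to \<open>e4\<close>. Such a
  basis element is itself a special coboundary, not merely a combination of some.\<close>

lemma cochains1_glued_key:
  fixes f :: "('v, 'a, 'k::field) cochain"
  assumes "f \<in> cochains1 QB ZB" "k \<in> Poly_Mapping.keys f"
  shows "k \<in> common_keys \<or> k = gg \<or> basis k \<in> (special_set :: ('v, 'a, 'k) cochain set)"
proof -
  obtain a p where k: "k = (B.arr a, p)" "a \<in> arcs QB" "p \<in> BB" "parallel QB (B.arr a) p"
    using B.cochain_key[OF assms] by metis
  obtain q where q: "q \<in> BA" "sp q = p" using nonzero_path_lift[OF k(3)] .
  have qp: "q \<in> paths Q" using q A.nonzero_in_paths by blast
  obtain u as where qu: "q = (u, as)" by fastforce
  have a: "a \<in> arcs Q" "a \<noteq> \<beta>" using k by (auto simp: glued_simps)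
  have t: "sv u = sv (tail Q a)" "sv (A.tgt q) = sv (head Q a)"
    using k(4) q star_path_in_paths(2)[OF qp]
    by (auto simp: B.parallel_arrow_iff glued_simps qu star_path_def)
  show ?thesis
  proof (cases "a = \<alpha>")
    case True
    then have u: "u = e1 \<or> u = e3" and w: "A.tgt q = e2 \<or> A.tgt q = e4"
      using t by (auto simp: sv_eq_e)
    from u show ?thesis
    proof
      assume "u = e3"
      then have "as = [\<beta>]" using path_from_e3[of as] qp w by (auto simp: qu target_Nil)
      then have "p = A.arr \<alpha>" using q \<open>u = e3\<close> by (auto simp: qu star_path_def arrow_path_def)
      then show ?thesis using k True glued_arrow_alpha by simp
    next
      assume u: "u = e1"
      from w show ?thesis
      proof
        assume "A.tgt q = e2"
        then have "as = [\<alpha>]" using path_to_e2[of u as] qp u by (auto simp: qu target_Nil)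
        then have "p = A.arr \<alpha>" using q u by (auto simp: qu star_path_def arrow_path_def)
        then show ?thesis using k True glued_arrow_alpha by simp
      next
        assume t4: "A.tgt q = e4"
        obtain bs where as: "as = bs @ [\<beta>]"
        proof (cases as rule: rev_cases)
          case Nil
          then show ?thesis using t4 u by (simp add: qu target_Nil)
        next
          case (snoc cs b)
          then have "b = \<beta>"
            using qp t4 incident(6)[of b] by (auto simp: qu paths_append_iff target_append path_simps)
          then show ?thesis using snoc that by blast
        qed
        have bs: "(e1, bs) \<in> paths Q" "A.tgt (e1, bs) = e3"
          using qp by (auto simp: qu u as paths_append_iff path_simps)
        have "path_comp (A.arr \<beta>) (e1, bs) = q" by (simp add: path_comp_def arrow_path_def qu u as)
        then have "(e1, bs) \<in> BA"
          using A.nonzero_path_comp(1)[OF bs(1) arrow_path_in_paths[OF arcs_glued(2)]] bs q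
          by (simp add: A.fst_arr)
        moreover have "1 \<le> length bs" using bs(2) by (cases bs) (auto simp: target_Nil)
        \<comment> \<open>Removing the final \<beta> leaves a path from \<open>e1\<close> to
          \<open>e3\<close>, whose coboundary is \<open>basis k\<close> with coefficient exactly
          1.\<close>
        moreover have "delta0 QB ZB (basis (vertex_path (sv e1), sp (e1, bs)))
            = (basis k :: ('v, 'a, 'k) cochain)"
          using special_first[OF bs] q k(1) True by (simp add: qu u as glued_arrow_alpha)
        moreover have "basis k \<noteq> (0 :: ('v, 'a, 'k) cochain)"
          using keys_basis[of k, where 'k = 'k] by force
        ultimately have "basis k \<in> (special_images Q Z \<alpha> \<beta> e1 e3 :: ('v, 'a, 'k) cochain set)"
          unfolding special_images_def Let_def
          using bs by (intro CollectI exI[of _ "(e1, bs)"]) simp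
        then show ?thesis by (simp add: special_set_def)
      qed
    qed
  next
    case False
    note inc = incident[OF a(1)]
    \<comment> \<open>Different ends with equal images would force \<open>u = e4\<close> and
      \<open>tail Q a = e2\<close>; the lift is then trivial, and \<open>a\<close> would end at f_2,
      making it \<alpha> or \<beta>.\<close>
    have "u = tail Q a"
    proof (rule ccontr)
      assume "u \<noteq> tail Q a"
      then have "u = e4" "tail Q a = e2"
        using t(1) inc a False by (auto simp: sv_eq_iff doubleton_eq_iff)
      then have "A.tgt q = e4" using path_from_e4[of as] qp by (auto simp: qu target_Nil)
      then have "sv (head Q a) = e2" using t(2) by simp
      then show False using inc a False by (simp add: sv_eq_e)
    qed
    moreover have "A.tgt q = head Q a"
    proof (rule ccontr)
      assume "A.tgt q \<noteq> head Q a"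
      then have "A.tgt q = e1"
        using t(2) inc a False by (auto simp: sv_eq_iff doubleton_eq_iff)
      then have "u = e1" using path_to_e1[of u as] qp by (auto simp: qu target_Nil)
      then show False using \<open>u = tail Q a\<close> inc a False by auto
    qed
    ultimately have par: "parallel Q (A.arr a) q" by (simp add: parallel_arrow_iff qu)
    then have "p = q" using common_key(6)[OF a(1) False a(2) q(1)] q by simp
    then have "k = (A.arr a, q)" using k(1) glued_arrow_other(1)[OF a(1) False a(2)] by simp
    then show ?thesis using par q(1) a False unfolding common_keys_def by blast
  qed
qed

subsection \<open>Cocycles of the two algebras\<close>

lemma restrict_in_common:
  shows "f \<in> cochains1 Q Z \<Longrightarrow> restrict f \<in> common"
    and "f \<in> cochains1 QB ZB \<Longrightarrow> restrict f \<in> common"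
proof -
  have common: "restrict (basis k) \<in> common" if "k \<in> common_keys" for k
    using that by (cases k) (auto simp: restrict_basis common_def)
  have zero: "restrict (basis k) \<in> common" if "k = (A.arr \<alpha>, p) \<or> k = (A.arr \<beta>, p)" for k p
    using that cochain.subspace_0[OF subspace_common] by (auto simp: restrict_basis)
  show "restrict f \<in> common" if f: "f \<in> cochains1 Q Z"
  proof (rule klinear_in_subspace[OF klinear_restrict subspace_common])
    fix k assume "k \<in> Poly_Mapping.keys f"
    then show "restrict (basis k) \<in> common"
      using cochains1_original_key[OF f] common zero by metis
  qed
  show "restrict f \<in> common" if f: "f \<in> cochains1 QB ZB"
  proof (rule klinear_in_subspace[OF klinear_restrict subspace_common])
    fix k assume "k \<in> Poly_Mapping.keys f"
    then consider "k \<in> common_keys" | "k = gg" | "basis k \<in> (special_set :: ('v, 'a, 'b) cochain set)"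
      using cochains1_glued_key[OF f] by blast
    then show "restrict (basis k) \<in> common"
    proof cases
      case 3
      then have "k \<in> {(A.arr \<alpha>, p) | p. p \<noteq> A.arr \<alpha>}" using special_keys[OF 3] by simp
      then show ?thesis using zero by blast
    qed (use common zero in blast)+
  qed
qed

lemma restrict_idem: "f \<in> cochains1 Q Z \<Longrightarrow> restrict (restrict f) = restrict f"
  using restrict_in_common(1) restrict_common(1) by blast

text \<open>The subspace \<open>W\<close> is left open: the first claim is used with the
  coboundaries, the second with the kernel of \<open>restrict\<close>.\<close>

lemma original_remainder:
  fixes f :: "('v, 'a, 'k::field) cochain"
  assumes f: "f \<in> cochains1 Q Z" and W: "cochain.subspace W" "basis gg \<in> W"
  shows "basis (A.arr \<beta>, A.arr \<beta>) \<in> W \<Longrightarrow> f - restrict f \<in> W"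
    and "psi1 Q \<alpha> \<beta> f - restrict f \<in> W"
proof -
  have common: "restrict (basis k) = basis k \<and> psi1 Q \<alpha> \<beta> (basis k) = (basis k :: ('v, 'a, 'k) cochain)"
    if "k \<in> common_keys" for k
    using restrict_common[of "basis k"] that by (simp add: common_def)
  have star: "sp (A.arr \<alpha>) = A.arr \<alpha>" "sp (A.arr \<beta>) = A.arr \<alpha>"
    by (simp_all add: star_arrow_path glued_arrow_alpha)
  show "f - restrict f \<in> W" if b: "basis (A.arr \<beta>, A.arr \<beta>) \<in> W"
  proof (rule klinear_in_subspace[OF klinear_minus[OF klinear_id klinear_restrict] W(1)])
    fix k assume "k \<in> Poly_Mapping.keys f"
    then consider "k \<in> common_keys" | "k = gg" | "k = (A.arr \<beta>, A.arr \<beta>)"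
      using cochains1_original_key[OF f] by blast
    then show "basis k - restrict (basis k) \<in> W"
      by cases (simp_all add: common restrict_basis b W cochain.subspace_0[OF W(1)])
  qed
  show "psi1 Q \<alpha> \<beta> f - restrict f \<in> W"
  proof (rule klinear_in_subspace[OF klinear_minus[OF klinear_psi1 klinear_restrict] W(1)])
    fix k assume "k \<in> Poly_Mapping.keys f"
    then consider "k \<in> common_keys" | "k = gg" | "k = (A.arr \<beta>, A.arr \<beta>)"
      using cochains1_original_key[OF f] by blast
    then show "psi1 Q \<alpha> \<beta> (basis k) - restrict (basis k) \<in> W"
      by cases (simp_all add: common restrict_basis psi1_basis star W cochain.subspace_0[OF W(1)])
  qed
qed

text \<open>Used with the cocycles and with Y in place of \<open>W\<close>, both of which contain
  \<open>gg\<close> and all special coboundaries.\<close>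

lemma glued_remainder:
  fixes f :: "('v, 'a, 'k::field) cochain"
  assumes f: "f \<in> cochains1 QB ZB" and W: "cochain.subspace W" "basis gg \<in> W" "special_set \<subseteq> W"
  shows "f - restrict f \<in> W"
proof (rule klinear_in_subspace[OF klinear_minus[OF klinear_id klinear_restrict] W(1)])
  fix k assume "k \<in> Poly_Mapping.keys f"
  then consider "k \<in> common_keys" | "k = gg" | "basis k \<in> (special_set :: ('v, 'a, 'k) cochain set)"
    using cochains1_glued_key[OF f] by blast
  then show "basis k - restrict (basis k) \<in> W"
  proof cases
    case 1
    then have "restrict (basis k) = (basis k :: ('v, 'a, 'k) cochain)"
      using restrict_common(1)[of "basis k"] by (simp add: common_def)
    then show ?thesis using cochain.subspace_0[OF W(1)] by simp
  next
    case 2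
    then show ?thesis using W by (simp add: restrict_basis)
  next
    case 3
    then have "k \<in> {(A.arr \<alpha>, p) | p. p \<noteq> A.arr \<alpha>}" using special_keys[OF 3] by simp
    then show ?thesis using W 3 by (auto simp: restrict_basis)
  qed
qed

section \<open>Coboundaries of trivial paths\<close>

lemma vertex_nonzero: "v \<in> verts Q \<Longrightarrow> (v, []) \<in> BA"
proof -
  assume v: "v \<in> verts Q"
  have "\<not> subpath Q r (v, [])" if "r \<in> Z" for r
    using relations_length[OF that] by (auto simp: subpath_def path_comp_def)
  then show ?thesis using v by (simp add: nonzero_paths_def path_simps)
qed

lemma vertex_cochain: "v \<in> verts Q \<Longrightarrow> basis (vertex_path v, (v, [])) \<in> cochains0 Q Z"
  by (simp add: cochains0_def cochains_def vertex_nonzero parallel_def vertex_path_def)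

lemma delta0_vertex:
  "delta0 Q Z (basis (vertex_path v, (v, []))) =
    (\<Sum>a | a \<in> arcs Q \<and> tail Q a = v. basis (A.arr a, A.arr a))
    - (\<Sum>a | a \<in> arcs Q \<and> head Q a = v. basis (A.arr a, A.arr a))"
proof -
  have 1: "path_comp (A.arr a) (v, []) = A.arr a" if "tail Q a = v" for a
    using that by (simp add: path_comp_def arrow_path_def)
  have 2: "path_comp (v, []) (A.arr a) = A.arr a" for a
    by (simp add: path_comp_def arrow_path_def)
  have "{a \<in> arcs Q. tail Q a = v \<and> path_comp (A.arr a) (v, []) \<in> BA} = {a \<in> arcs Q. tail Q a = v}"
    "{a \<in> arcs Q. head Q a = v \<and> path_comp (v, []) (A.arr a) \<in> BA} = {a \<in> arcs Q. head Q a = v}"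
    using 1 2 arrow_nonzero by auto
  then show ?thesis
    unfolding delta0_original_basis 2 by (auto simp: 1 intro!: sum.cong)
qed

lemma delta0_end_vertices:
  "delta0 Q Z (basis (vertex_path e1, (e1, []))) = basis gg"
  "delta0 Q Z (basis (vertex_path e4, (e4, []))) = - basis (A.arr \<beta>, A.arr \<beta>)"
proof -
  have "{a \<in> arcs Q. tail Q a = e1} = {\<alpha>}" "{a \<in> arcs Q. head Q a = e1} = {}"
    "{a \<in> arcs Q. tail Q a = e4} = {}" "{a \<in> arcs Q. head Q a = e4} = {\<beta>}"
    using incident arcs_glued by blast+
  note sets = this
  show "delta0 Q Z (basis (vertex_path e1, (e1, []))) = basis gg"
    "delta0 Q Z (basis (vertex_path e4, (e4, []))) = - basis (A.arr \<beta>, A.arr \<beta>)"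
    unfolding delta0_vertex sets by simp_all
qed

lemma end_arrows_coboundary:
  "basis gg \<in> im_delta0 Q Z" "basis (A.arr \<beta>, A.arr \<beta>) \<in> im_delta0 Q Z"
proof -
  have "e1 \<in> verts Q" "e4 \<in> verts Q" by simp_all
  then have "delta0 Q Z (basis (vertex_path e1, (e1, []))) \<in> im_delta0 Q Z"
    "delta0 Q Z (basis (vertex_path e4, (e4, []))) \<in> im_delta0 Q Z"
    unfolding im_delta0_def by (intro imageI vertex_cochain; simp)+
  then show "basis gg \<in> im_delta0 Q Z" "basis (A.arr \<beta>, A.arr \<beta>) \<in> im_delta0 Q Z"
    unfolding delta0_end_vertices
    using cochain.subspace_neg[OF A.subspace_im_delta0] by force+
qed

text \<open>An arrow other than \<alpha> and \<beta> occurs in a path and in its image at the same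
  positions, the inserted path is fixed by gluing, and nonzero results correspond to nonzero
  results.\<close>

lemma substitution_star:
  assumes p: "p \<in> paths Q" and k: "k \<in> common_keys"
  shows "B.substitution (sp p) k = relabel (A.substitution p k)"
proof -
  obtain a x where kx: "k = (A.arr a, x)" and a: "a \<in> arcs Q" "a \<noteq> \<alpha>" "a \<noteq> \<beta>"
    and x: "x \<in> BA" "parallel Q (A.arr a) x"
    using k by (rule common_keysE)
  note ck = common_key[OF a x]
  have xp: "x \<in> paths Q" using x A.nonzero_in_paths by blast
  have mapx: "map sa (snd x) = snd x"
    using ck(5) by (auto intro!: map_idI simp: star_arrow_def)
  have len: "length (snd (sp p)) = length (snd p)" by (simp add: star_path_def)
  have repl: "replace_at (sp p) i x = sp (replace_at p i x)" for i
    by (simp add: replace_at_def star_path_def take_map drop_map mapx)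
  have nth: "B.arr (snd (sp p) ! i) = A.arr a \<longleftrightarrow> A.arr (snd p ! i) = A.arr a" if "i < length (snd p)" for i
  proof -
    have "B.arr (snd (sp p) ! i) = A.arr a \<longleftrightarrow> sa (snd p ! i) = a"
      using that glued_arrow_other(1)[OF a] B.arr_eq_iff by (simp add: star_path_def flip: glued_arrow_other(1)[OF a])
    then show ?thesis using sa_eq_other[OF a(2,3)] by simp
  qed
  have nz: "sp (replace_at p i x) \<in> BB \<longleftrightarrow> replace_at p i x \<in> BA"
    if "i < length (snd p)" "A.arr (snd p ! i) = A.arr a" for i
    using replace_at_path(1)[OF p that(1) xp] that(2) x star_nonzero_iff by simp
  show ?thesis
    unfolding kx A.substitution_alt B.substitution_alt klinear_sum[OF klinear_relabel] len repl
    by (rule sum.cong) (use nth nz in \<open>auto simp: relabel_def klinear_0[OF klinear_linear_extension]\<close>)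
qed

lemma derivation_star:
  assumes f: "f \<in> common" and p: "p \<in> paths Q"
  shows "B.derivation f (basis (sp p)) = relabel (A.derivation f (basis p))"
proof (rule klinear_eq_on_keys[OF B.klinear_derivation_left
      klinear_comp[OF klinear_relabel A.klinear_derivation_left]])
  fix k assume "k \<in> Poly_Mapping.keys f"
  then have "k \<in> common_keys" using f by (auto simp: common_def)
  then show "B.derivation (basis k) (basis (sp p)) = relabel (A.derivation (basis k) (basis p))"
    using substitution_star[OF p] by (cases k) (simp add: A.derivation_basis B.derivation_basis)
qed

text \<open>From B to A, the value at a relation is carried to 0 by gluing and is itself 0, since
  its paths share a start and gluing is injective on them. From A to B, images of relations are
  clear by \<open>derivation_star\<close>; for a new relation, any replacement keeps the glued arrow
  in the interior.\<close>

lemma common_cocycle_iff: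
  assumes f: "f \<in> common"
  shows "f \<in> ker_delta1 QB ZB \<longleftrightarrow> f \<in> ker_delta1 Q Z"
proof
  have f1: "f \<in> cochains1 Q Z" "f \<in> cochains1 QB ZB" using f common_subset by auto
  {
    assume fB: "f \<in> ker_delta1 QB ZB"
    have "A.derivation f (basis r) = 0" if r: "r \<in> Z" for r
    proof (rule klinear_relabel_inj)
      have rp: "r \<in> paths Q" "r \<notin> BA" using r relations_paths A.relation_zero by auto
      have "A.derivation f (basis r) \<in> A.parallel_span r"
        by (rule A.derivation_in_parallel_span(2)[OF f1(1) rp(1) A.parallel_span_0])
      then have q: "q \<in> paths Q \<and> fst q = fst r"
        if "q \<in> Poly_Mapping.keys (A.derivation f (basis r))" for q
        using that A.nonzero_in_paths[of q] by (auto simp: A.parallel_span_def parallel_def)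
      then show "inj_on sp (Poly_Mapping.keys (A.derivation f (basis r)))"
        using star_path_inj by (intro inj_onI) metis
      \<comment> \<open>That the image is a zero path is enough; whether it survives minimisation is
        never asked.\<close>
      have "sp r \<notin> BB" using star_nonzero_iff rp by blast
      then have "B.derivation f (basis (sp r)) = 0"
        using B.cocycle_kills_zero_paths[OF fB star_path_in_paths(1)[OF rp(1)]] by blast
      then show "linear_extension (\<lambda>p. basis (sp p)) (A.derivation f (basis r)) = 0"
        using derivation_star[OF f rp(1)] by (simp add: relabel_def)
    qed
    then show "f \<in> ker_delta1 Q Z" using f1 by (simp add: A.cocycle_iff)
  }
  assume fA: "f \<in> ker_delta1 Q Z"
  have "B.derivation f (basis r) = 0" if r: "r \<in> ZB" for r
  proof -
    consider r0 where "r0 \<in> Z" "r = sp r0" | "r \<in> new_relations Q \<alpha> \<beta>"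
      using r by (auto simp: glued_relations_def minimal_relations_def)
    then show ?thesis
    proof cases
      case 1
      then show ?thesis
        using derivation_star[OF f, of r0] fA relations_paths
        by (auto simp: A.cocycle_iff klinear_0[OF klinear_relabel])
    next
      case 2
      then obtain x h where xh: "x \<in> arcs Q" "h \<in> arcs Q" "head Q h = e3" "tail Q x = e2"
        and r: "r = (sv (tail Q h), [h, \<alpha>, x])"
        unfolding new_relations_iff by blast
      show ?thesis
      proof (rule klinear_eq_on_keys[OF B.klinear_derivation_left klinear_zero])
        fix k assume "k \<in> Poly_Mapping.keys f"
        then have "k \<in> common_keys" using f by (auto simp: common_def)
        then obtain a y where k: "k = (A.arr a, y)" and a: "a \<in> arcs Q" "a \<noteq> \<alpha>" "a \<noteq> \<beta>"
          and y: "y \<in> BA" "parallel Q (A.arr a) y"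
          by (rule common_keysE)
        have t: "fst y = tail Q a" "A.tgt y = head Q a" using y(2) by (auto simp: parallel_arrow_iff)
        have zero: "replace_at r i y \<notin> BB" if i: "i < length (snd r)" "B.arr (snd r ! i) = A.arr a" for i
        proof -
          have ia: "snd r ! i = a" using i(2) by (simp add: arrow_path_def)
          \<comment> \<open>The middle arrow is \<alpha>, where a common cochain has no value. At
            the outer positions the replacing path has positive length, as neither \<open>h\<close>
            nor \<open>x\<close> is a loop, so the glued arrow still has neighbours on both
            sides.\<close>
          then consider "i = 0" "a = h" | "i = 2" "a = x"
            using i(1) a(2) by (auto simp: r less_Suc_eq)
          then show ?thesis
          proof cases
            case 1
            have "snd y \<noteq> []"
            proof
              assume "snd y = []"
              then have "tail Q h = e3" using t 1 xh by (cases y) (auto simp: target_Nil)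
              then show False using incident(5) xh(2,3) by auto
            qed
            then have "snd (replace_at r i y) = butlast (snd y) @ last (snd y) # \<alpha> # x # []"
              using 1 by (simp add: replace_at_def r flip: append_butlast_last_id)
            then show ?thesis using interior_alpha by blast
          next
            case 2
            have "snd y \<noteq> []"
            proof
              assume "snd y = []"
              then have "head Q x = e2" using t 2 xh by (cases y) (auto simp: target_Nil)
              then show False using incident(3)[OF xh(1)] xh by auto
            qed
            then have "snd (replace_at r i y) = [] @ h # \<alpha> # hd (snd y) # tl (snd y)"
              using 2 by (simp add: replace_at_def r numeral_2_eq_2)
            then show ?thesis using interior_alpha by blast
          qed
        qed
        show "B.derivation (basis k) (basis r) = 0"
          unfolding k B.derivation_basis B.substitution_alt by (rule sum.neutral) (use zero in auto)
      qed
    qed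
  qed
  then show "f \<in> ker_delta1 QB ZB" using f1 by (simp add: B.cocycle_iff)
qed

text \<open>Replacing an arrow by itself returns the relation, which is a zero path, so every
  summand is truncated.\<close>

lemma gg_cocycle: "(basis gg :: ('v, 'a, 'k::field) cochain) \<in> ker_delta1 QB ZB"
proof -
  have "A.arr \<alpha> \<in> BB"
    using star_nonzero_iff[OF arrow_path_in_paths[OF arcs_glued(1)]] arrow_nonzero[OF arcs_glued(1)]
    by (simp add: star_arrow_path glued_arrow_alpha)
  moreover have "A.arr \<alpha> \<in> B.arr ` arcs QB"
    using glued_arrow_alpha by (intro image_eqI[of _ _ \<alpha>]) (auto simp: glued_simps)
  ultimately have "(basis gg :: ('v, 'a, 'k) cochain) \<in> cochains1 QB ZB"
    by (simp add: cochains1_def cochains_def parallel_def)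
  moreover have "B.derivation (basis gg :: ('v, 'a, 'k) cochain) (basis r) = 0" if r: "r \<in> ZB" for r
  proof -
    have "replace_at r i (A.arr \<alpha>) = r" if "i < length (snd r)" "B.arr (snd r ! i) = A.arr \<alpha>" for i
    proof -
      have "snd r ! i = \<alpha>" using that by (simp add: arrow_path_def)
      then have "take i (snd r) @ \<alpha> # drop (Suc i) (snd r) = snd r"
        using id_take_nth_drop[OF that(1)] by simp
      then show ?thesis by (simp add: replace_at_def arrow_path_def)
    qed
    then show ?thesis
      using B.relation_zero[OF r] unfolding B.derivation_basis B.substitution_alt
      by (intro sum.neutral) auto
  qed
  ultimately show ?thesis by (simp add: B.cocycle_iff)
qed

lemma star_cochain0:
  assumes p: "p \<in> BA" and loop: "sv (fst p) = sv (A.tgt p)"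
  shows "basis (vertex_path (sv (fst p)), sp p) \<in> cochains0 QB ZB"
proof -
  have path: "p \<in> paths Q" using p A.nonzero_in_paths by blast
  have "sp p \<in> BB" using star_nonzero_iff[OF path] p by blast
  moreover have "sv (fst p) \<in> verts QB" using path fst_in_verts by (auto simp: glued_simps)
  moreover have "parallel QB (vertex_path (sv (fst p))) (sp p)"
    using loop star_path_in_paths(2)[OF path]
    by (simp add: parallel_def vertex_path_def fst_star_path B.target_Nil)
  ultimately show ?thesis by (simp add: cochains0_def cochains_def)
qed

lemma special_coboundary: "special_set \<subseteq> im_delta0 QB ZB"
proof
  fix y :: "('v, 'a, 'k::field) cochain"
  assume "y \<in> special_set"
  then obtain p where p: "p \<in> BA" "1 \<le> length (snd p)"
    "y = delta0 QB ZB (basis (vertex_path (sv (fst p)), sp p))"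
    "fst p = e1 \<and> A.tgt p = e3 \<or> fst p = e2 \<and> A.tgt p = e4"
    by (rule special_cases)
  have "sv (fst p) = sv (A.tgt p)" using p(4) by auto
  then show "y \<in> im_delta0 QB ZB"
    unfolding im_delta0_def p(3) by (intro imageI star_cochain0[OF p(1)])
qed

text \<open>What restriction removes is a combination of \<open>gg\<close> and special coboundaries,
  all of them cocycles; the remaining common cocycle then changes algebra by
  \<open>common_cocycle_iff\<close>.\<close>

lemma restrict_cocycle:
  assumes f: "f \<in> ker_delta1 QB ZB"
  shows "restrict f \<in> ker_delta1 Q Z"
proof -
  have f1: "f \<in> cochains1 QB ZB" using f by (simp add: ker_delta1_def)
  have "f - restrict f \<in> ker_delta1 QB ZB"
    by (rule glued_remainder[OF f1 B.subspace_ker_delta1 gg_cocycle])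
      (use special_coboundary B.im_delta0_cocycle in blast)
  then have "f - (f - restrict f) \<in> ker_delta1 QB ZB"
    by (rule cochain.subspace_diff[OF B.subspace_ker_delta1 f])
  then show ?thesis using common_cocycle_iff[OF restrict_in_common(2)[OF f1]] by simp
qed

text \<open>Every class of the original algebra thus has a common representative, which is also a
  cocycle of the glued algebra. This yields surjectivity.\<close>

lemma restrict_original:
  assumes f: "f \<in> ker_delta1 Q Z"
  shows "f - restrict f \<in> im_delta0 Q Z" "restrict f \<in> ker_delta1 Q Z" "restrict f \<in> ker_delta1 QB ZB"
proof -
  have f1: "f \<in> cochains1 Q Z" using f by (simp add: ker_delta1_def)
  show d: "f - restrict f \<in> im_delta0 Q Z"
    by (rule original_remainder(1)[OF f1 A.subspace_im_delta0 end_arrows_coboundary])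
  then have "f - (f - restrict f) \<in> ker_delta1 Q Z"
    using cochain.subspace_diff[OF A.subspace_ker_delta1 f] A.im_delta0_cocycle by blast
  then show "restrict f \<in> ker_delta1 Q Z" by simp
  then show "restrict f \<in> ker_delta1 QB ZB"
    using common_cocycle_iff[OF restrict_in_common(1)[OF f1]] by simp
qed

section \<open>Restriction respects the bracket\<close>

lemma component_restrict:
  "component c (restrict f) = (if c = A.arr \<alpha> \<or> c = A.arr \<beta> then 0 else component c f)"
proof -
  have "klinear (\<lambda>f. if c = A.arr \<alpha> \<or> c = A.arr \<beta> then 0 else component c f)"
    by (cases "c = A.arr \<alpha> \<or> c = A.arr \<beta>") (simp_all add: klinear_zero klinear_component)
  then show ?thesis
    by (rule klinear_eq_on_keys[OF klinear_comp[OF klinear_component klinear_restrict]])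
      (auto simp: restrict_basis component_basis klinear_0[OF klinear_component])
qed

text \<open>The glued arrow does not occur in \<open>p\<close>, so the values of \<open>f\<close> at
  it contribute nothing. The other values act alike in both algebras, since gluing fixes all paths
  parallel to a common arrow.\<close>

lemma derivation_restrict:
  fixes f :: "('v, 'a, 'k::field) cochain"
  assumes f: "f \<in> cochains1 QB ZB" and p: "(A.arr a, p) \<in> common_keys"
  shows "B.derivation f (basis p) = A.derivation (restrict f) (basis p)"
proof (rule klinear_eq_on_keys[OF B.klinear_derivation_left
      klinear_comp[OF A.klinear_derivation_left klinear_restrict]])
  have a: "a \<in> arcs Q" "a \<noteq> \<alpha>" "a \<noteq> \<beta>" and pa: "p \<in> BA" "parallel Q (A.arr a) p"
    using p unfolding common_keys_def by auto
  have pp: "p \<in> paths Q" using pa A.nonzero_in_paths by blast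
  fix k assume k: "k \<in> Poly_Mapping.keys f"
  let ?k = "basis k :: ('v, 'a, 'k) cochain"
  have away: "B.derivation ?k (basis p) = A.derivation (restrict ?k) (basis p)"
    if "k = (A.arr \<alpha>, y)" for y
  proof -
    have "B.arr (snd p ! i) \<noteq> A.arr \<alpha>" if "i < length (snd p)" for i
      using common_key(4)[OF a pa] that by (auto simp: arrow_path_def)
    then have "B.substitution p k = (0 :: _ \<Rightarrow>\<^sub>0 'k)"
      unfolding that B.substitution_alt by (intro sum.neutral) auto
    then show ?thesis
      by (simp add: that B.derivation_basis restrict_basis klinear_0[OF A.klinear_derivation_left])
  qed
  consider "k \<in> common_keys" | "k = gg" | "basis k \<in> (special_set :: ('v, 'a, 'k) cochain set)"
    using cochains1_glued_key[OF f k] by blast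
  then show "B.derivation ?k (basis p) = A.derivation (restrict ?k) (basis p)"
  proof cases
    case 1
    then have kc: "?k \<in> common" by (simp add: common_def)
    then have "A.derivation ?k (basis p) \<in> A.parallel_span p"
      using A.derivation_in_parallel_span(2)[OF _ pp A.parallel_span_0] common_subset by blast
    then have fixed: "sp q = q" if "q \<in> Poly_Mapping.keys (A.derivation ?k (basis p))" for q
      using that pa common_key(6)[OF a, of q] by (auto simp: A.parallel_span_def parallel_def)
    have "relabel (A.derivation ?k (basis p)) = A.derivation ?k (basis p)"
      by (rule klinear_eq_on_keys[OF klinear_relabel klinear_id]) (simp add: relabel_def fixed)
    then show ?thesis
      using derivation_star[OF kc pp] common_key(6)[OF a pa] restrict_common(1)[OF kc] by simp
  next
    case 2
    then show ?thesis by (rule away)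
  next
    case 3
    then have "k \<in> {(A.arr \<alpha>, p) | p. p \<noteq> A.arr \<alpha>}" using special_keys[OF 3] by simp
    then show ?thesis using away by blast
  qed
qed

text \<open>At an arrow other than \<alpha> and \<beta> both brackets only evaluate derivations on
  paths parallel to a common arrow, where they agree. At \<alpha> and \<beta> both sides
  vanish.\<close>

lemma restrict_bracket:
  fixes f g :: "('v, 'a, 'k::field) cochain"
  assumes f: "f \<in> cochains1 QB ZB" and g: "g \<in> cochains1 QB ZB"
  shows "restrict (cochain_bracket QB ZB f g) = cochain_bracket Q Z (restrict f) (restrict g)"
proof (rule component_eqI)
  fix c
  have inner: "B.derivation f (component c g) = A.derivation (restrict f) (component c g)"
    if c: "c \<noteq> A.arr \<alpha>" "c \<noteq> A.arr \<beta>" and f: "f \<in> cochains1 QB ZB" and g: "g \<in> cochains1 QB ZB"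
    for f g :: "('v, 'a, 'k) cochain"
  proof (rule klinear_eq_on_keys[OF B.klinear_derivation A.klinear_derivation])
    fix p assume "p \<in> Poly_Mapping.keys (component c g)"
    then have k: "(c, p) \<in> Poly_Mapping.keys g" by (simp add: keys_component)
    have "(c, p) \<in> common_keys"
    proof -
      have "basis (c, p) \<notin> (special_set :: ('v, 'a, 'k) cochain set)"
        using special_keys[of "basis (c, p)"] c by auto
      then show ?thesis using cochains1_glued_key[OF g k] c by auto
    qed
    moreover from this obtain a where "c = A.arr a" unfolding common_keys_def by blast
    ultimately show "B.derivation f (basis p) = A.derivation (restrict f) (basis p)"
      using derivation_restrict[OF f] by blast
  qed
  show "component c (restrict (cochain_bracket QB ZB f g))
    = component c (cochain_bracket Q Z (restrict f) (restrict g))"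
    using inner[OF _ _ f g] inner[OF _ _ g f]
    by (simp add: component_restrict A.bracket_component B.bracket_component
        klinear_0[OF A.klinear_derivation])
qed

section \<open>The map \<open>psi1\<close> and the two differentials\<close>

lemma glued_arcs_image:
  assumes "v \<noteq> e1" "v \<noteq> e4"
  shows "{b \<in> arcs QB. tail QB b = sv v} = sa ` {a \<in> arcs Q. tail Q a = v}"
    and "{b \<in> arcs QB. head QB b = sv v} = sa ` {a \<in> arcs Q. head Q a = v}"
proof -
  have sub: "sa a \<in> arcs QB" if "a \<in> arcs Q" for a
    using that by (auto simp: glued_simps star_arrow_def)
  show "{b \<in> arcs QB. tail QB b = sv v} = sa ` {a \<in> arcs Q. tail Q a = v}"
  proof (intro equalityI subsetI)
    fix b assume "b \<in> {b \<in> arcs QB. tail QB b = sv v}"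
    then have b: "b \<in> arcs Q" "b \<noteq> \<beta>" "sv (tail Q b) = sv v" by (auto simp: glued_simps)
    have "tail Q b = v \<or> tail Q b = e1 \<and> v = e3"
      using b(3) assms incident[OF b(1)] by (auto simp: sv_eq_iff doubleton_eq_iff)
    then show "b \<in> sa ` {a \<in> arcs Q. tail Q a = v}"
    proof
      assume "tail Q b = e1 \<and> v = e3"
      then have "b = sa \<beta>" "\<beta> \<in> {a \<in> arcs Q. tail Q a = v}" using incident(2)[OF b(1)] by auto
      then show ?thesis by blast
    qed (use b in \<open>auto simp: sa_other intro!: image_eqI[of _ _ b]\<close>)
  qed (use sub in auto)
  show "{b \<in> arcs QB. head QB b = sv v} = sa ` {a \<in> arcs Q. head Q a = v}"
  proof (intro equalityI subsetI)
    fix b assume "b \<in> {b \<in> arcs QB. head QB b = sv v}"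
    then have b: "b \<in> arcs Q" "b \<noteq> \<beta>" "sv (head Q b) = sv v" by (auto simp: glued_simps)
    have "head Q b = v"
      using b assms incident[OF b(1)] by (auto simp: sv_eq_iff doubleton_eq_iff)
    then show "b \<in> sa ` {a \<in> arcs Q. head Q a = v}"
      using b by (auto simp: sa_other intro!: image_eqI[of _ _ b])
  qed (use sub in auto)
qed

text \<open>Common form of the two sums in \<open>delta0\<close>: \<open>c\<close> and
  \<open>d\<close> are the composites with an arrow before and after gluing, and the sum is
  reindexed along the arrows.\<close>

lemma psi1_sum:
  assumes inj: "inj_on sa S" and S: "S \<subseteq> arcs Q"
    and paths: "\<And>a. a \<in> S \<Longrightarrow> c a \<in> paths Q" and star: "\<And>a. a \<in> S \<Longrightarrow> sp (c a) = d (sa a)"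
  shows "psi1 Q \<alpha> \<beta> (\<Sum>a | a \<in> S \<and> c a \<in> BA. basis (A.arr a, c a))
    = (\<Sum>b | b \<in> sa ` S \<and> d b \<in> BB. basis (B.arr b, d b) :: ('v, 'a, 'k::field) cochain)"
proof -
  have "{b. b \<in> sa ` S \<and> d b \<in> BB} = sa ` {a. a \<in> S \<and> c a \<in> BA}"
    using star star_nonzero_iff[OF paths] by auto
  then have "(\<Sum>b | b \<in> sa ` S \<and> d b \<in> BB. basis (B.arr b, d b))
    = (\<Sum>a | a \<in> S \<and> c a \<in> BA. basis (B.arr (sa a), d (sa a)) :: ('v, 'a, 'k) cochain)"
    using inj by (simp add: sum.reindex inj_on_def)
  then show ?thesis
    by (simp add: klinear_sum[OF klinear_psi1] psi1_basis star_arrow_path star)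
qed

text \<open>The arrows at f_1 are the images of those at \<open>e3\<close>, and the arrows at f_2
  the images of those at \<open>e2\<close>. The vertices \<open>e1\<close> and \<open>e4\<close>
  must be excluded: their coboundaries map to \<open>gg\<close> and its negative, whereas the images
  of these vertices have the coboundaries coming from \<open>e3\<close> and
  \<open>e2\<close>.\<close>

lemma psi1_delta0:
  assumes p: "p \<in> BA" "fst p = v" "A.tgt p = v" and v: "v \<noteq> e1" "v \<noteq> e4"
  shows "psi1 Q \<alpha> \<beta> (delta0 Q Z (basis (vertex_path v, p)))
    = (delta0 QB ZB (basis (vertex_path (sv v), sp p)) :: ('v, 'a, 'k::field) cochain)"
proof -
  have path: "p \<in> paths Q" using p A.nonzero_in_paths by blast
  have inj: "inj_on sa {a \<in> arcs Q. tail Q a = v}" "inj_on sa {a \<in> arcs Q. head Q a = v}"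
    using incident by (auto simp: inj_on_def star_arrow_def)
  have 1: "psi1 Q \<alpha> \<beta> (\<Sum>a | a \<in> {a \<in> arcs Q. tail Q a = v} \<and> path_comp (A.arr a) p \<in> BA.
      basis (A.arr a, path_comp (A.arr a) p))
    = (\<Sum>b | b \<in> sa ` {a \<in> arcs Q. tail Q a = v} \<and> path_comp (B.arr b) (sp p) \<in> BB.
      basis (B.arr b, path_comp (B.arr b) (sp p)) :: ('v, 'a, 'k) cochain)"
    by (rule psi1_sum[OF inj(1)])
      (use p path in \<open>auto simp: path_comp_iff A.fst_arr arrow_path_in_paths star_path_path_comp star_arrow_path\<close>)
  have 2: "psi1 Q \<alpha> \<beta> (\<Sum>a | a \<in> {a \<in> arcs Q. head Q a = v} \<and> path_comp p (A.arr a) \<in> BA.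
      basis (A.arr a, path_comp p (A.arr a)))
    = (\<Sum>b | b \<in> sa ` {a \<in> arcs Q. head Q a = v} \<and> path_comp (sp p) (B.arr b) \<in> BB.
      basis (B.arr b, path_comp (sp p) (B.arr b)) :: ('v, 'a, 'k) cochain)"
    by (rule psi1_sum[OF inj(2)])
      (use p path in \<open>auto simp: path_comp_iff target_arrow_path arrow_path_in_paths star_path_path_comp star_arrow_path\<close>)
  show ?thesis
    unfolding delta0_original_basis delta0_glued_basis klinear_diff[OF klinear_psi1]
    using 1 2 unfolding glued_arcs_image[OF v, symmetric] by (simp add: conj_assoc)
qed

section \<open>The subspace Y\<close>

abbreviation "Y \<equiv> Y_sum Q Z \<alpha> \<beta>"

lemma Z_sp_eq: "Z_sp Q Z \<alpha> \<beta> = cochain.span special_set"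
  by (simp add: Z_sp_def special_set_def)

lemma Z_sp_keys: "z \<in> Z_sp Q Z \<alpha> \<beta> \<Longrightarrow> Poly_Mapping.keys z \<subseteq> {(A.arr \<alpha>, p) | p. p \<noteq> A.arr \<alpha>}"
  using cochain.span_minimal[OF _ subspace_keys, of special_set "{(A.arr \<alpha>, p) | p. p \<noteq> A.arr \<alpha>}"]
    special_keys unfolding Z_sp_eq by blast

lemma Z_sp_coboundary: "Z_sp Q Z \<alpha> \<beta> \<subseteq> im_delta0 QB ZB"
  unfolding Z_sp_eq by (rule cochain.span_minimal[OF special_coboundary B.subspace_im_delta0])

lemma restrict_Z_sp: "z \<in> Z_sp Q Z \<alpha> \<beta> \<Longrightarrow> restrict z = 0"
  by (rule klinear_eq_on_keys[OF klinear_restrict klinear_zero]) (use Z_sp_keys in \<open>force simp: restrict_basis\<close>)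

lemma subspace_Y: "cochain.subspace Y"
  unfolding Y_sum_def Z_sp_eq
  by (intro cochain.subspace_sums klinear_image_subspace[OF klinear_psi1] A.subspace_im_delta0
      cochain.subspace_span)

lemma psi1_in_Y: "x \<in> im_delta0 Q Z \<Longrightarrow> psi1 Q \<alpha> \<beta> x \<in> Y"
  unfolding Y_sum_def Z_sp_eq using cochain.span_zero by (intro CollectI exI[of _ "psi1 Q \<alpha> \<beta> x"] exI[of _ 0]) auto

lemma special_in_Y: "special_set \<subseteq> Y"
proof
  fix y :: "('v, 'a, 'k::field) cochain"
  assume "y \<in> special_set"
  moreover have "(0 :: ('v, 'a, 'k) cochain) \<in> psi1 Q \<alpha> \<beta> ` im_delta0 Q Z"
    using cochain.subspace_0[OF klinear_image_subspace[OF klinear_psi1 A.subspace_im_delta0]] .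
  ultimately show "y \<in> Y"
    unfolding Y_sum_def Z_sp_eq using cochain.span_base by (intro CollectI exI[of _ 0] exI[of _ y]) auto
qed

lemma gg_in_Y: "(basis gg :: ('v, 'a, 'k::field) cochain) \<in> Y"
proof -
  have "psi1 Q \<alpha> \<beta> (basis gg) = (basis gg :: ('v, 'a, 'k) cochain)"
    by (simp add: psi1_basis star_arrow_path glued_arrow_alpha)
  then show ?thesis using psi1_in_Y end_arrows_coboundary(1) by metis
qed

text \<open>By \<open>psi1_delta0\<close>, Y is generated by coboundaries of the glued algebra
  together with \<open>gg\<close>. The open \<open>W\<close> allows three uses: with the cocycles,
  with the preimage of a subspace containing the class of \<open>gg\<close>, and with the
  coboundaries themselves.\<close>

lemma Y_subset:
  fixes W :: "('v, 'a, 'k::field) cochain set"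
  assumes W: "cochain.subspace W" "im_delta0 QB ZB \<subseteq> W" "basis gg \<in> W"
  shows "Y \<subseteq> W"
proof -
  have "psi1 Q \<alpha> \<beta> (delta0 Q Z x) \<in> W" if x: "x \<in> cochains0 Q Z" for x
  proof (rule klinear_in_subspace[OF klinear_comp[OF klinear_psi1 A.klinear_delta0] W(1)])
    fix k assume "k \<in> Poly_Mapping.keys x"
    with x obtain v p where k: "k = (vertex_path v, p)" "v \<in> verts Q" "p \<in> BA" "fst p = v" "A.tgt p = v"
      by (rule A.cochain0_key)
    have path: "(v, snd p) \<in> paths Q" using k A.nonzero_in_paths by (metis prod.collapse)
    show "psi1 Q \<alpha> \<beta> (delta0 Q Z (basis k)) \<in> W"
    proof (cases "v = e1 \<or> v = e4")
      case True
      \<comment> \<open>At the two exceptional vertices the only closed path is the trivial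
        one.\<close>
      have "snd p = []" using True path path_to_e1[of e1 "snd p"] path_from_e4[of "snd p"] k(4,5)
        by (cases p) auto
      then have "p = (v, [])" using k(4) by (simp add: prod_eq_iff)
      then show ?thesis
        using True W cochain.subspace_neg[OF W(1)]
        by (auto simp: k(1) delta0_end_vertices psi1_basis star_arrow_path glued_arrow_alpha
            klinear_diff[OF klinear_psi1, of 0, simplified klinear_0[OF klinear_psi1] diff_0])
    next
      case False
      then have "psi1 Q \<alpha> \<beta> (delta0 Q Z (basis k))
        = (delta0 QB ZB (basis (vertex_path (sv v), sp p)) :: ('v, 'a, 'k) cochain)"
        unfolding k(1) using k by (intro psi1_delta0) auto
      moreover have "basis (vertex_path (sv v), sp p) \<in> cochains0 QB ZB"
        using star_cochain0[OF k(3)] k(4,5) by simp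
      ultimately show ?thesis using W(2) by (auto simp: im_delta0_def)
    qed
  qed
  then show ?thesis
    using Z_sp_coboundary W(2) cochain.subspace_add[OF W(1)]
    unfolding Y_sum_def im_delta0_def[of Q Z] by blast
qed

lemma Y_cocycle: "Y \<subseteq> ker_delta1 QB ZB"
  by (rule Y_subset[OF B.subspace_ker_delta1 _ gg_cocycle]) (use B.im_delta0_cocycle in blast)

lemma specialI:
  assumes "p \<in> BA" "1 \<le> length (snd p)"
    and ends: "fst p = e1 \<and> A.tgt p = e3 \<or> fst p = e2 \<and> A.tgt p = e4"
    and "delta0 QB ZB (basis (vertex_path (sv (fst p)), sp p)) \<noteq> (0 :: ('v, 'a, 'k::field) cochain)"
  shows "delta0 QB ZB (basis (vertex_path (sv (fst p)), sp p)) \<in> (special_set :: ('v, 'a, 'k) cochain set)"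
  using ends
proof
  assume e: "fst p = e1 \<and> A.tgt p = e3"
  then have "delta0 QB ZB (basis (vertex_path (sv (fst p)), sp p))
      \<in> (special_images Q Z \<alpha> \<beta> e1 e3 :: ('v, 'a, 'k) cochain set)"
    unfolding special_images_def Let_def using assms(1,2,4) by (intro CollectI exI[of _ p]) simp
  then show ?thesis by (simp add: special_set_def)
next
  assume e: "fst p = e2 \<and> A.tgt p = e4"
  then have "delta0 QB ZB (basis (vertex_path (sv (fst p)), sp p))
      \<in> (special_images Q Z \<alpha> \<beta> e2 e4 :: ('v, 'a, 'k) cochain set)"
    unfolding special_images_def Let_def using assms(1,2,4) by (intro CollectI exI[of _ p]) simp
  then show ?thesis by (simp add: special_set_def)
qed

text \<open>A closed nonzero path of the glued algebra lifts either to a closed path, whose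
  coboundary comes through \<open>psi1\<close>, or to an open one, which is special or has zero
  coboundary.\<close>

lemma coboundary_in_Y: "im_delta0 QB ZB \<subseteq> Y"
proof -
  have "delta0 QB ZB x \<in> Y" if x: "x \<in> cochains0 QB ZB" for x :: "('v, 'a, 'k::field) cochain"
  proof (rule klinear_in_subspace[OF B.klinear_delta0 subspace_Y])
    fix k assume "k \<in> Poly_Mapping.keys x"
    with x obtain v' p' where k: "k = (vertex_path v', p')" "p' \<in> BB" "fst p' = v'" "B.tgt p' = v'"
      by (rule B.cochain0_key)
    obtain q where q: "q \<in> BA" "sp q = p'" using nonzero_path_lift[OF k(2)] .
    have qp: "q \<in> paths Q" using q A.nonzero_in_paths by blast
    have v': "v' = sv (fst q)" "sv (fst q) = sv (A.tgt q)"
      using k(3,4) q(2) star_path_in_paths(2)[OF qp] fst_star_path[of q] by auto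
    have loop: "delta0 QB ZB (basis (vertex_path (sv v), sp p)) \<in> (Y :: ('v, 'a, 'k) cochain set)"
      if p: "p \<in> BA" "fst p = v" "A.tgt p = v" "v \<noteq> e1" "v \<noteq> e4" for v p
    proof -
      have "v \<in> verts Q" using p A.nonzero_in_paths fst_in_verts by blast
      then have "(basis (vertex_path v, p) :: ('v, 'a, 'k) cochain) \<in> cochains0 Q Z"
        using p by (simp add: cochains0_def cochains_def parallel_def vertex_path_def target_Nil)
      then have "delta0 Q Z (basis (vertex_path v, p) :: ('v, 'a, 'k) cochain) \<in> im_delta0 Q Z" by (simp add: im_delta0_def)
      then show ?thesis using psi1_in_Y psi1_delta0[OF p] by metis
    qed
    show "delta0 QB ZB (basis k) \<in> (Y :: ('v, 'a, 'k) cochain set)"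
    proof (cases "fst q = A.tgt q")
      case True
      obtain u as where qu: "q = (u, as)" by fastforce
      have trivial: "as = []" if "u = e1 \<or> u = e4"
        using that True qp path_to_e1[of u as] path_from_e4[of as] by (auto simp: qu)
      consider "u = e1" | "u = e4" | "u \<noteq> e1" "u \<noteq> e4" by blast
      then show ?thesis
      proof cases
        case 1
        \<comment> \<open>The trivial path at f_1 has two lifts; the one at \<open>e3\<close> is
          taken because \<open>psi1_delta0\<close> fails at \<open>e1\<close>.\<close>
        then have "k = (vertex_path (sv e3), sp (e3, []))"
          using trivial q(2) v'(1) by (auto simp: k(1) qu star_path_def)
        then show ?thesis using loop[of "(e3, [])" e3] by (simp add: vertex_nonzero target_Nil)
      next
        case 2
        then have "k = (vertex_path (sv e2), sp (e2, []))"
          using trivial q(2) v'(1) by (auto simp: k(1) qu star_path_def)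
        then show ?thesis using loop[of "(e2, [])" e2] by (simp add: vertex_nonzero target_Nil)
      next
        case 3
        then show ?thesis using loop[OF q(1), of u] True q v' by (simp add: k(1) qu)
      qed
    next
      case False
      note sc = star_cases[OF qp False v'(2)]
      have "1 \<le> length (snd q)" using False by (cases q; cases "snd q") (auto simp: target_Nil)
      moreover have "k = (vertex_path (sv (fst q)), sp q)" by (simp add: k(1) v' q)
      ultimately have "delta0 QB ZB (basis k) = (0 :: ('v, 'a, 'k) cochain)
        \<or> delta0 QB ZB (basis k) \<in> (special_set :: ('v, 'a, 'k) cochain set)"
        using specialI[OF q(1) _ sc] by metis
      then show ?thesis using special_in_Y cochain.subspace_0[OF subspace_Y] by auto
    qed
  qed
  then show ?thesis by (auto simp: im_delta0_def[of QB ZB])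
qed

text \<open>Restriction kills \<open>gg\<close> and \<open>Z_sp\<close>, hence sends
  \<open>psi1 x\<close> to the restriction of x, which differs from x by a coboundary. Conversely
  the restriction of f is its own image under \<open>psi1\<close>, and what was removed lies in
  Y.\<close>

lemma Y_iff:
  fixes f :: "('v, 'a, 'k::field) cochain"
  assumes f: "f \<in> cochains1 QB ZB"
  shows "f \<in> Y \<longleftrightarrow> restrict f \<in> im_delta0 Q Z"
proof
  assume "f \<in> Y"
  then obtain x z where xz: "f = psi1 Q \<alpha> \<beta> x + z" "x \<in> im_delta0 Q Z" "z \<in> Z_sp Q Z \<alpha> \<beta>"
    by (auto simp: Y_sum_def)
  have x1: "x \<in> ker_delta1 Q Z" using xz(2) A.im_delta0_cocycle by blast
  then have x2: "x \<in> cochains1 Q Z" by (simp add: ker_delta1_def)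
  have gg: "restrict (basis gg) = (0 :: ('v, 'a, 'k) cochain)" by (simp add: restrict_basis)
  have "psi1 Q \<alpha> \<beta> x - restrict x \<in> {f. restrict f = 0}"
  proof (rule original_remainder(2)[OF x2])
    show "cochain.subspace {f :: ('v, 'a, 'k) cochain. restrict f = 0}"
      by (rule cochain.subspaceI)
        (simp_all add: klinear_0[OF klinear_restrict] klinear_add[OF klinear_restrict]
          klinear_scale[OF klinear_restrict])
  qed (simp add: gg)
  then have "restrict (psi1 Q \<alpha> \<beta> x) = restrict x"
    using restrict_idem[OF x2] by (simp add: klinear_diff[OF klinear_restrict])
  then have "restrict f = x - (x - restrict x)"
    by (simp add: xz(1) klinear_add[OF klinear_restrict] restrict_Z_sp[OF xz(3)])
  then show "restrict f \<in> im_delta0 Q Z"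
    using cochain.subspace_diff[OF A.subspace_im_delta0 xz(2) restrict_original(1)[OF x1]] by simp
next
  assume r: "restrict f \<in> im_delta0 Q Z"
  have "restrict f \<in> Y"
    using psi1_in_Y[OF r] restrict_common(2)[OF restrict_in_common(2)[OF f]] by simp
  moreover have "f - restrict f \<in> Y"
    by (rule glued_remainder[OF f subspace_Y gg_in_Y special_in_Y])
  ultimately have "(f - restrict f) + restrict f \<in> Y"
    by (intro cochain.subspace_add[OF subspace_Y])
  then show "f \<in> Y" by simp
qed

text \<open>The supports are disjoint: images under \<open>psi1\<close> live on common pairs and
  \<open>gg\<close>, while \<open>Z_sp\<close> lives on the glued arrow paired with paths different
  from it.\<close>

lemma sum_direct: "psi1 Q \<alpha> \<beta> ` im_delta0 Q Z \<inter> Z_sp Q Z \<alpha> \<beta> = {0 :: ('v, 'a, 'k::field) cochain}"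
proof -
  have "psi1 Q \<alpha> \<beta> x = 0" if x: "x \<in> im_delta0 Q Z" and z: "psi1 Q \<alpha> \<beta> x \<in> Z_sp Q Z \<alpha> \<beta>"
    for x :: "('v, 'a, 'k) cochain"
  proof -
    have x1: "x \<in> cochains1 Q Z" using A.im_delta0_cocycle[OF x] by (simp add: ker_delta1_def)
    let ?K = "insert gg common_keys"
    have "psi1 Q \<alpha> \<beta> x \<in> {f. Poly_Mapping.keys f \<subseteq> ?K}"
    proof (rule klinear_in_subspace[OF klinear_psi1 subspace_keys])
      fix k assume "k \<in> Poly_Mapping.keys x"
      then consider "k \<in> common_keys" | "k = gg" | "k = (A.arr \<beta>, A.arr \<beta>)"
        using cochains1_original_key[OF x1] by blast
      then show "psi1 Q \<alpha> \<beta> (basis k) \<in> {f :: ('v, 'a, 'k) cochain. Poly_Mapping.keys f \<subseteq> ?K}"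
      proof cases
        case 1
        then have "psi1 Q \<alpha> \<beta> (basis k) = (basis k :: ('v, 'a, 'k) cochain)"
          by (intro restrict_common(2)) (simp add: common_def)
        then show ?thesis using 1 by simp
      qed (simp_all add: psi1_basis star_arrow_path glued_arrow_alpha)
    qed
    then have "Poly_Mapping.keys (psi1 Q \<alpha> \<beta> x) \<subseteq> ?K \<inter> {(A.arr \<alpha>, p) | p. p \<noteq> A.arr \<alpha>}"
      using Z_sp_keys[OF z] by (intro Int_greatest) simp_all
    moreover have "?K \<inter> {(A.arr \<alpha>, p) | p. p \<noteq> A.arr \<alpha>} = {}"
      unfolding common_keys_def by auto
    ultimately have "Poly_Mapping.keys (psi1 Q \<alpha> \<beta> x) = {}" by (simp only: subset_empty)
    then show ?thesis by simp
  qed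
  moreover have "0 \<in> psi1 Q \<alpha> \<beta> ` im_delta0 Q Z"
    using cochain.subspace_0[OF klinear_image_subspace[OF klinear_psi1 A.subspace_im_delta0]] .
  moreover have "0 \<in> Z_sp Q Z \<alpha> \<beta>" unfolding Z_sp_eq by (rule cochain.span_zero)
  ultimately show ?thesis by auto
qed

text \<open>
  Over the component \<open>C\<close> of \<open>\<alpha>\<close>, the coboundaries of the vertices sum to zero in the original
  algebra. If \<open>C\<close> does not contain \<open>\<beta>\<close>, all but the one of the source vertex survive in the glued
  algebra.
\<close>

lemma gg_coboundary:
  assumes blocks: "\<not> same_block Q \<alpha> \<beta>"
  shows "(basis gg :: ('v, 'a, 'k::field) cochain) \<in> im_delta0 QB ZB"
proof -
  let ?S = "with_proj (mk_symmetric Q)"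
  interpret S: pair_wf_digraph "mk_symmetric Q" by (rule wellformed_mk_symmetric)
  define C where "C = {v \<in> verts Q. e1 \<rightarrow>\<^sup>*\<^bsub>?S\<^esub> v}"
  have adj: "(tail Q a, head Q a) \<in> parcs (mk_symmetric Q)"
    "(head Q a, tail Q a) \<in> parcs (mk_symmetric Q)" if "a \<in> arcs Q" for a
    using that by (auto simp: parcs_mk_symmetric)
  have closed: "tail Q a \<in> C \<longleftrightarrow> head Q a \<in> C" if "a \<in> arcs Q" for a
    using S.reachable_adj_trans[OF _ adj(1)[OF that], of e1] S.reachable_adj_trans[OF _ adj(2)[OF that], of e1]
      that unfolding C_def by auto
  have "e1 \<in> C"
    unfolding C_def by (simp add: S.reachable_refl)
  moreover have "e3 \<notin> C" using blocks by (simp add: C_def same_block_def)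
  ultimately have ends: "e1 \<in> C" "e3 \<notin> C" "e4 \<notin> C" using closed[of \<beta>] by auto
  have fin: "finite C" unfolding C_def by simp
  have verts: "v \<in> verts Q" if "v \<in> C" for v using that by (simp add: C_def)
  let ?b = "\<lambda>v. basis (vertex_path v, (v, [])) :: ('v, 'a, 'k) cochain"
  have sub: "cochain.subspace (cochains0 Q Z :: ('v, 'a, 'k) cochain set)"
    unfolding cochains0_def cochains_def by (rule subspace_keys)
  have u: "(\<Sum>v\<in>C. ?b v) \<in> cochains0 Q Z"
    by (rule cochain.subspace_sum[OF sub]) (rule vertex_cochain[OF verts])
  have forget: "A.forget (\<Sum>v\<in>C. ?b v) = (\<Sum>v\<in>C. basis (v, []))"
    by (simp add: klinear_sum[OF A.klinear_forget] A.forget_basis)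
  \<comment> \<open>Each arrow has both ends in \<open>C\<close> or neither, so its contributions as
    an outgoing and as an incoming arrow cancel.\<close>
  have "delta0 Q Z (\<Sum>v\<in>C. ?b v) = 0"
  proof (rule component_eqI)
    fix c
    show "component c (delta0 Q Z (\<Sum>v\<in>C. ?b v)) = component c 0"
    proof (cases "c \<in> A.arr ` arcs Q")
      case True
      then obtain a where a: "a \<in> arcs Q" "c = A.arr a" by blast
      have "A.mult (basis (A.arr a)) (basis (v, [])) = (if v = tail Q a then basis (A.arr a) else (0 :: _ \<Rightarrow>\<^sub>0 'k))"
        "A.mult (basis (v, [])) (basis (A.arr a)) = (if v = head Q a then basis (A.arr a) else (0 :: _ \<Rightarrow>\<^sub>0 'k))"
        for v
        using arrow_nonzero[OF a(1)]
        by (auto simp: A.mult_basis target_Nil A.fst_arr target_arrow_path path_comp_def arrow_path_def target_Cons)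
      then show ?thesis
        using closed[OF a(1)] fin
        by (simp add: a(2) A.delta0_component(1)[OF u a(1)] forget klinear_sum[OF A.klinear_mult_left]
            klinear_sum[OF A.klinear_mult_right] klinear_0[OF klinear_component])
    qed (simp add: A.delta0_component(2)[OF u] klinear_0[OF klinear_component])
  qed
  then have "psi1 Q \<alpha> \<beta> (delta0 Q Z (\<Sum>v\<in>C. ?b v)) = 0" by (simp add: klinear_0[OF klinear_psi1])
  then have "(\<Sum>v\<in>C. psi1 Q \<alpha> \<beta> (delta0 Q Z (?b v))) = 0"
    by (simp add: klinear_sum[OF A.klinear_delta0] klinear_sum[OF klinear_psi1])
  moreover have "psi1 Q \<alpha> \<beta> (delta0 Q Z (?b e1)) = basis gg"
    by (simp add: delta0_end_vertices psi1_basis star_arrow_path glued_arrow_alpha)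
  ultimately have "basis gg = - (\<Sum>v\<in>C - {e1}. psi1 Q \<alpha> \<beta> (delta0 Q Z (?b v)))"
    using ends(1) fin by (simp add: sum.remove eq_neg_iff_add_eq_0)
  moreover have "psi1 Q \<alpha> \<beta> (delta0 Q Z (?b v)) \<in> im_delta0 QB ZB" if v: "v \<in> C - {e1}" for v
  proof -
    have "v \<in> verts Q" "v \<noteq> e1" "v \<noteq> e4" using v verts ends by auto
    then have "psi1 Q \<alpha> \<beta> (delta0 Q Z (?b v))
        = (delta0 QB ZB (basis (vertex_path (sv v), sp (v, []))) :: ('v, 'a, 'k) cochain)"
      by (intro psi1_delta0 vertex_nonzero) (simp_all add: target_Nil)
    moreover have "(basis (vertex_path (sv v), sp (v, [])) :: ('v, 'a, 'k) cochain) \<in> cochains0 QB ZB"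
      using star_cochain0[OF vertex_nonzero[OF \<open>v \<in> verts Q\<close>]] by (simp add: target_Nil)
    ultimately show ?thesis by (simp add: im_delta0_def)
  qed
  ultimately show ?thesis
    by (metis (no_types, lifting) B.subspace_im_delta0 cochain.subspace_neg cochain.subspace_sum)
qed

text \<open>\<open>h\<close> maps cocycles of the glued algebra to classes of the original one with
  kernel Y, and \<open>g\<close> is the map it induces on HH1, with kernel the image
  \<open>I\<close> of Y. Ideal and isomorphism are read off from \<open>g\<close>.\<close>

lemma HH1_glued:
  fixes I :: "('v, 'a, 'k::field) cochain set set" and Y :: "('v, 'a, 'k) cochain set"
  defines "Y \<equiv> Y_sum Q Z \<alpha> \<beta>"
  defines "I \<equiv> HH1_class QB ZB ` Y"
  shows "lie_ideal (HH1 QB ZB) I"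
    and "lie_isomorphic (HH1 Q Z) (lie_quot (HH1 QB ZB) I)"
    and "I = lie_span (HH1 QB ZB) {HH1_class QB ZB (basis gg)}"
    and "\<not> same_block Q \<alpha> \<beta> \<Longrightarrow> lie_isomorphic (HH1 Q Z) (HH1 QB ZB :: ('v, 'a, 'k) hh1)"
proof -
  let ?K = "cocycle_lie QB ZB :: (('v, 'a, 'k) cochain, 'k) lie"
  let ?HA = "HH1 Q Z :: ('v, 'a, 'k) hh1" and ?HB = "HH1 QB ZB :: ('v, 'a, 'k) hh1"
  define h :: "('v, 'a, 'k) cochain \<Rightarrow> ('v, 'a, 'k) cochain set" where "h f = HH1_class Q Z (restrict f)" for f
  note subA = lie_homD[OF A.lie_hom_HH1_class, unfolded cocycle_lie_def lie.simps]
  note subB = lie_homD[OF B.lie_hom_HH1_class, unfolded cocycle_lie_def lie.simps]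
  have f1: "f \<in> cochains1 QB ZB" if "f \<in> ker_delta1 QB ZB" for f :: "('v, 'a, 'k) cochain"
    using that by (simp add: ker_delta1_def)
  have hom: "lie_hom ?K ?HA h"
    unfolding lie_hom_def h_def cocycle_lie_def lie.simps
    by (simp add: subA restrict_cocycle f1 klinear_add[OF klinear_restrict] klinear_scale[OF klinear_restrict] restrict_bracket)
  have surj: "h ` carrier ?K = carrier ?HA"
  proof
    show "h ` carrier ?K \<subseteq> carrier ?HA" using lie_homD(1)[OF hom] by blast
    show "carrier ?HA \<subseteq> h ` carrier ?K"
    proof
      fix X assume "X \<in> carrier ?HA"
      then obtain f where f: "f \<in> ker_delta1 Q Z" "X = HH1_class Q Z f"
        by (auto simp: A.carrier_HH1)
      have "f \<in> cochains1 Q Z" using f by (simp add: ker_delta1_def)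
      then have "h (restrict f) = X"
        using A.HH1_class_eqI[OF f(1) restrict_original(2,1)[OF f(1)]]
        by (simp add: h_def f(2) restrict_idem)
      then show "X \<in> h ` carrier ?K"
        using restrict_original(3)[OF f(1)] by (auto simp: cocycle_lie_def)
    qed
  qed
  have ker: "f \<in> Y \<longleftrightarrow> h f = lzero ?HA" if "f \<in> carrier ?K" for f
    using that
    by (simp add: cocycle_lie_def h_def Y_def Y_iff[OF f1] A.HH1_class_zero_iff restrict_cocycle)
  have Y: "Y \<subseteq> carrier ?K" "im_delta0 QB ZB \<subseteq> Y"
    using Y_cocycle coboundary_in_Y by (simp_all add: cocycle_lie_def Y_def)
  have "h f = lzero ?HA" if "f \<in> im_delta0 QB ZB" for f
    using ker that Y by blast
  then obtain g where g: "lie_hom ?HB ?HA g" and gh: "\<And>f. f \<in> carrier ?K \<Longrightarrow> g (HH1_class QB ZB f) = h f"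
    using B.coboundaries.factor_hom[OF hom A.lie_algebra_HH1] unfolding HH1_def HH1_class_def by metis
  have carrier: "carrier ?HB = HH1_class QB ZB ` carrier ?K"
    by (simp add: B.carrier_HH1 cocycle_lie_def)
  have surj_g: "g ` carrier ?HB = carrier ?HA"
    unfolding carrier image_image using gh surj by (simp cong: image_cong)
  have I: "I \<subseteq> carrier ?HB" using Y(1) by (auto simp: I_def carrier)
  have ker_g: "X \<in> I \<longleftrightarrow> g X = lzero ?HA" if X: "X \<in> carrier ?HB" for X
  proof
    assume "X \<in> I"
    then show "g X = lzero ?HA" using gh ker Y(1) by (auto simp: I_def)
  next
    assume "g X = lzero ?HA"
    moreover obtain f where "f \<in> carrier ?K" "X = HH1_class QB ZB f" using X carrier by blast
    ultimately show "X \<in> I" using gh ker by (auto simp: I_def)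
  qed
  show ideal: "lie_ideal ?HB I"
    by (rule lie_ideal_kernel[OF B.lie_algebra_HH1 A.lie_algebra_HH1 g I ker_g])
  show "lie_isomorphic ?HA (lie_quot ?HB I)"
    by (rule lie_isomorphic_sym, rule lie_first_isomorphism[OF B.lie_algebra_HH1 A.lie_algebra_HH1 g surj_g I ker_g])
  show "I = lie_span ?HB {HH1_class QB ZB (basis gg)}"
  proof
    have "HH1_class QB ZB (basis gg) \<in> I"
      unfolding I_def Y_def by (rule imageI[OF gg_in_Y])
    then show "lie_span ?HB {HH1_class QB ZB (basis gg)} \<subseteq> I"
      using ideal by (auto simp: lie_span_def lie_ideal_def)
    show "I \<subseteq> lie_span ?HB {HH1_class QB ZB (basis gg)}"
      unfolding lie_span_def
    proof (rule Inter_greatest)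
      fix W assume "W \<in> {W. lie_subspace ?HB W \<and> {HH1_class QB ZB (basis gg)} \<subseteq> W}"
      then have W: "lzero ?HB \<in> W" "\<And>x y. x \<in> W \<Longrightarrow> y \<in> W \<Longrightarrow> ladd ?HB x y \<in> W"
        "\<And>c x. x \<in> W \<Longrightarrow> lscale ?HB c x \<in> W" "HH1_class QB ZB (basis gg) \<in> W"
        by (auto simp: lie_subspace_def)
      \<comment> \<open>The cocycles whose class lies in \<open>W\<close>: they contain the
        coboundaries, having class zero, and \<open>gg\<close>, so \<open>Y_subset\<close>
        applies.\<close>
      let ?V = "{f \<in> ker_delta1 QB ZB. HH1_class QB ZB f \<in> W}"
      note s = B.subspace_ker_delta1
      have "cochain.subspace ?V"
        by (rule cochain.subspaceI)
          (use W in \<open>simp_all add: B.zero_HH1[symmetric] subB cochain.subspace_0[OF s]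
            cochain.subspace_add[OF s] cochain.subspace_scale[OF s]\<close>)
      moreover have "im_delta0 QB ZB \<subseteq> ?V"
        using W(1) B.HH1_class_zero_iff B.im_delta0_cocycle by fastforce
      moreover have "basis gg \<in> ?V" using W(4) gg_cocycle by blast
      ultimately have "Y \<subseteq> ?V" unfolding Y_def by (rule Y_subset)
      then show "I \<subseteq> W" by (auto simp: I_def)
    qed
  qed
  show "lie_isomorphic ?HA ?HB" if "\<not> same_block Q \<alpha> \<beta>"
  proof -
    \<comment> \<open>Since \<open>gg\<close> is now a coboundary, Y consists of coboundaries only.
      The homomorphism theorem for \<open>h\<close> itself then has HH1 of the glued algebra as its
      quotient, with no second quotient to remove.\<close>
    have "Y \<subseteq> im_delta0 QB ZB"
      unfolding Y_def by (rule Y_subset[OF B.subspace_im_delta0 _ gg_coboundary[OF that]]) simp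
    then have "Y = im_delta0 QB ZB" using Y(2) by blast
    then have "lie_isomorphic (lie_quot ?K (im_delta0 QB ZB)) ?HA"
      using lie_first_isomorphism[OF B.lie_algebra_cocycles A.lie_algebra_HH1 hom surj Y(1) ker] by simp
    then show ?thesis unfolding HH1_def[of QB] by (rule lie_isomorphic_sym)
  qed
qed

end

theorem theorem3p21:
  fixes Q :: "('v, 'a) pre_digraph" and Z :: "('v, 'a) qpath set" and \<alpha> \<beta> :: 'a
  assumes "monomial_algebra Q Z"
    and "source_arrow Q \<alpha>" and "sink_arrow Q \<beta>"
    and "distinct [tail Q \<alpha>, head Q \<alpha>, tail Q \<beta>, head Q \<beta>]"
  shows
    "let QB = glued_quiver Q \<alpha> \<beta>;
         ZB = glued_relations Q Z \<alpha> \<beta>;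
         HA = (HH1 Q Z :: ('v, 'a, 'k::field) hh1);
         HB = (HH1 QB ZB :: ('v, 'a, 'k) hh1);
         Y = (Y_sum Q Z \<alpha> \<beta> :: ('v, 'a, 'k) cochain set);
         I = HH1_class QB ZB ` Y;
         g = arrow_path QB (star_arrow \<alpha> \<beta> \<alpha>)
     in psi1 Q \<alpha> \<beta> ` im_delta0 Q Z \<inter> Z_sp Q Z \<alpha> \<beta> = {0 :: ('v, 'a, 'k) cochain}
      \<and> im_delta0 QB ZB \<subseteq> Y \<and> Y \<subseteq> ker_delta1 QB ZB
      \<and> lie_ideal HB I
      \<and> lie_isomorphic HA (lie_quot HB I)
      \<and> (same_block Q \<alpha> \<beta> \<longrightarrow>
           lie_isomorphic HA (lie_quot HB (lie_span HB {HH1_class QB ZB (basis (g, g))})))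
      \<and> (\<not> same_block Q \<alpha> \<beta> \<longrightarrow> lie_isomorphic HA HB)"
proof -
  interpret gluing Q Z \<alpha> \<beta>
    using assms by (simp add: gluing_def gluing_axioms_def)
  \<comment> \<open>Makes the pair \<open>(g, g)\<close> of the statement equal to
    \<open>gg\<close>, so that the description of \<open>I\<close> as a span turns the quotient by
    \<open>I\<close> into the quotient by the class of \<open>gg\<close>.\<close>
  have "arrow_path QB (sa \<alpha>) = A.arr \<alpha>" by (simp add: glued_arrow_alpha)
  then show ?thesis
    unfolding Let_def
    using sum_direct coboundary_in_Y Y_cocycle HH1_glued(1,2,4) HH1_glued(2)[unfolded HH1_glued(3)]
    by auto
qed

end
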